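(* Let $\alpha,\gamma\in\{1,\dots,n\}$. The differential Galois group $\mathrm{Gal}(\mathrm{VE}_{2,\alpha}^{\gamma})$ over $K=\mathbb{C}(\mathrm{e}^{\mathrm{i}t})$ of the system $$\ddot x=-\omega_\alpha^2x,\qquad \ddot z=-\omega_\gamma^2z+\frac{\theta^\gamma_{\alpha,\alpha}}{\sin t}\,x^2$$ is virtually Abelian if and only if either $\theta^{\gamma}_{\alpha,\alpha}=0$, or $\theta^{\gamma}_{\alpha,\alpha}\neq0$ and $\omega_\alpha,\omega_\gamma\in\mathbb{Q}^{\star}$.
   Context: Setting: $V$ is a homogeneous potential of degree $2$ in $n$ complex variables, holomorphic near a Darboux point $d\ne0$ normalised by $V'(d)=d$, with $V''(d)=\operatorname{diag}(\omega_1^2,\dots,\omega_n^2)$, $\omega_i\in\mathbb{C}$; $F=-V'=-\operatorname{grad}V$ and $\theta^{\gamma}_{\alpha,\beta}=\frac{\partial^2F_\gamma}{\partial q_\alpha\partial q_\beta}(d)\in\mathbb{C}$. The system in the claim, called $\mathrm{VE}_{2,\alpha}^\gamma$, is a subsystem of the second order variational equations of $\ddot q=F(q)$ along the solution $q_0(t)=\sin(t)\,d$. Its Picard-Vessiot extension is the differential field extension of $K=\mathbb{C}(\mathrm{e}^{\mathrm{i}t})$, with derivation $d/dt$ and constants $\mathbb{C}$, generated by the components (and their derivatives) of all solutions $(x,z)$; $\mathrm{Gal}(\mathrm{VE}_{2,\alpha}^\gamma)$ is its group of differential $K$-automorphisms. A linear algebraic group is virtually Abelian if its identity component is Abelian.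 $\mathbb{Q}^\star=\mathbb{Q}\setminus\{0\}$. *)

theory Defs
  imports "HOL-Complex_Analysis.Complex_Analysis" "HOL-Algebra.Bij"
begin

section \<open>Homogeneous potentials near a Darboux point\<close>

text \<open>Holomorphic in several variables: complex differentiable at every point of the open set U.\<close>

definition holomorphic_potential_on :: "(complex^'n \<Rightarrow> complex) \<Rightarrow> (complex^'n) set \<Rightarrow> bool" where
  "holomorphic_potential_on V U \<longleftrightarrow> open U \<and>
     (\<forall>q\<in>U. \<exists>D. (V has_derivative D) (at q) \<and> (\<forall>c v. D (c *s v) = c * D v))"

text \<open>
  U need not be a cone: on a small neighbourhood of d the scalars concerned may all lie near 1.
  This allows potentials that are multivalued on a full cone, such as algebraic ones.
\<close>

definition homogeneous_potential_on ::
    "nat \<Rightarrow> (complex^'n \<Rightarrow> complex) \<Rightarrow> (complex^'n) set \<Rightarrow> bool" where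
  "homogeneous_potential_on k V U \<longleftrightarrow>
     (\<forall>c q. q \<in> U \<and> c *s q \<in> U \<longrightarrow> V (c *s q) = c ^ k * V q)"

definition partial :: "'n \<Rightarrow> (complex^'n \<Rightarrow> complex) \<Rightarrow> complex^'n \<Rightarrow> complex" where
  "partial i f q = deriv (\<lambda>s. f (q + axis i s)) 0"

definition grad :: "(complex^'n \<Rightarrow> complex) \<Rightarrow> complex^'n \<Rightarrow> complex^'n" where
  "grad V q = (\<chi> i. partial i V q)"

definition hessian :: "(complex^'n \<Rightarrow> complex) \<Rightarrow> complex^'n \<Rightarrow> complex^'n^'n" where
  "hessian V q = (\<chi> i j. partial i (partial j V) q)"

definition force :: "(complex^'n \<Rightarrow> complex) \<Rightarrow> complex^'n \<Rightarrow> complex^'n" where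
  "force V q = - grad V q"

definition theta ::
    "(complex^'n \<Rightarrow> complex) \<Rightarrow> complex^'n \<Rightarrow> 'n \<Rightarrow> 'n \<Rightarrow> 'n \<Rightarrow> complex" where
  "theta V d \<gamma> \<alpha> \<beta> = partial \<alpha> (partial \<beta> (\<lambda>q. force V q $ \<gamma>)) d"


section \<open>The Picard-Vessiot extension\<close>

text \<open>
  Functions of t are represented by their Laurent series at a base point t0 with sin t0 nonzero.
  As t0 is a regular point of the system, every formal solution converges, and the field of formal
  Laurent series with \<^term>\<open>fls_deriv\<close> contains all local solutions. Its constants are exactly
  the complex numbers, i.e. \<^term>\<open>range fls_const\<close> (lemma \<open>fls_deriv_eq_0_iff\<close>).
\<close>

definition germ :: "complex \<Rightarrow> (complex \<Rightarrow> complex) \<Rightarrow> complex fls" where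
  "germ t0 f = fps_to_fls (fps_expansion f t0)"

definition is_subfield :: "'a::field set \<Rightarrow> bool" where
  "is_subfield F \<longleftrightarrow> 0 \<in> F \<and> 1 \<in> F \<and>
     (\<forall>x\<in>F. \<forall>y\<in>F. x + y \<in> F \<and> x * y \<in> F) \<and> (\<forall>x\<in>F. - x \<in> F \<and> inverse x \<in> F)"

definition is_diff_subfield :: "complex fls set \<Rightarrow> bool" where
  "is_diff_subfield F \<longleftrightarrow> is_subfield F \<and> (\<forall>x\<in>F. fls_deriv x \<in> F)"

definition K_exp :: "complex \<Rightarrow> complex fls set" where
  "K_exp t0 = is_subfield hull (range fls_const \<union> {germ t0 (\<lambda>t. exp (\<i> * t))})"

text \<open>All solutions (x, z) of x'' = -a^2 x, z'' = -c^2 z + (th / sin t) x^2.\<close>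

definition VE2 ::
    "complex \<Rightarrow> complex \<Rightarrow> complex \<Rightarrow> complex \<Rightarrow> (complex fls \<times> complex fls) set" where
  "VE2 t0 a c th = {(x, z).
     fls_deriv (fls_deriv x) = - fls_const (a\<^sup>2) * x \<and>
     fls_deriv (fls_deriv z) = - fls_const (c\<^sup>2) * z + fls_const th / germ t0 sin * x\<^sup>2}"

definition solution_components :: "('a \<times> 'a) set \<Rightarrow> 'a set" where
  "solution_components S = fst ` S \<union> snd ` S"

definition PV_extension ::
    "complex fls set \<Rightarrow> (complex fls \<times> complex fls) set \<Rightarrow> complex fls set" where
  "PV_extension K S = is_diff_subfield hull (K \<union> solution_components S)"


section \<open>Differential Galois groups\<close>

definition diff_galois_group :: "complex fls set \<Rightarrow> complex fls set \<Rightarrow> (complex fls \<Rightarrow> complex fls) monoid"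
  where
  "diff_galois_group K L = (BijGroup L)\<lparr>carrier := {\<sigma> \<in> Bij L.
     (\<forall>x\<in>L. \<forall>y\<in>L. \<sigma> (x + y) = \<sigma> x + \<sigma> y \<and> \<sigma> (x * y) = \<sigma> x * \<sigma> y) \<and>
     (\<forall>x\<in>L. \<sigma> (fls_deriv x) = fls_deriv (\<sigma> x)) \<and>
     (\<forall>x\<in>K. \<sigma> x = x)}\<rparr>"

interpretation laurent: vector_space "\<lambda>(c::complex) f. fls_const c * f"
  by unfold_locales
    (simp_all add: algebra_simps fls_plus_const[symmetric] fls_const_mult_const[symmetric]
      del: fls_const_mult_const)

text \<open>
  The algebraic structure of the Galois group comes from its faithful linear representation on the
  finite-dimensional complex vector space W spanned by the components of all solutions. The
  polynomial functions on the group are the polynomials in the matrix coefficients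
  \<open>\<phi> (\<sigma> w)\<close> of this representation, with w in W and \<open>\<phi>\<close> a linear functional on W; this avoids
  the choice of a basis. The Zariski topology has their zero sets as a basis of closed sets;
  admitting the inverse of the determinant as well would yield the same closed sets.
\<close>

definition linear_functional_on :: "complex fls set \<Rightarrow> (complex fls \<Rightarrow> complex) \<Rightarrow> bool" where
  "linear_functional_on W \<phi> \<longleftrightarrow>
     (\<forall>v\<in>W. \<forall>w\<in>W. \<phi> (v + w) = \<phi> v + \<phi> w) \<and> (\<forall>c. \<forall>w\<in>W. \<phi> (fls_const c * w) = c * \<phi> w)"

inductive_set polynomial_functions ::
    "complex fls set \<Rightarrow> ((complex fls \<Rightarrow> complex fls) \<Rightarrow> complex) set"
  for W :: "complex fls set" where
  const: "(\<lambda>_. c) \<in> polynomial_functions W"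
| matrix_coeff: "w \<in> W \<Longrightarrow> linear_functional_on W \<phi> \<Longrightarrow> (\<lambda>\<sigma>. \<phi> (\<sigma> w)) \<in> polynomial_functions W"
| add: "f \<in> polynomial_functions W \<Longrightarrow> g \<in> polynomial_functions W \<Longrightarrow>
    (\<lambda>\<sigma>. f \<sigma> + g \<sigma>) \<in> polynomial_functions W"
| mult: "f \<in> polynomial_functions W \<Longrightarrow> g \<in> polynomial_functions W \<Longrightarrow>
    (\<lambda>\<sigma>. f \<sigma> * g \<sigma>) \<in> polynomial_functions W"

definition zariski_topology ::
    "complex fls set \<Rightarrow> (complex fls \<Rightarrow> complex fls) set \<Rightarrow> (complex fls \<Rightarrow> complex fls) topology" where
  "zariski_topology W G =
     topology_generated_by {{\<sigma> \<in> G. f \<sigma> \<noteq> 0} | f. f \<in> polynomial_functions W}"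

definition identity_component ::
    "complex fls set \<Rightarrow> (complex fls \<Rightarrow> complex fls) monoid \<Rightarrow> (complex fls \<Rightarrow> complex fls) set" where
  "identity_component W G =
     connected_component_of_set (zariski_topology W (carrier G)) \<one>\<^bsub>G\<^esub>"

definition virtually_abelian ::
    "complex fls set \<Rightarrow> (complex fls \<Rightarrow> complex fls) monoid \<Rightarrow> bool" where
  "virtually_abelian W G \<longleftrightarrow> comm_group (G\<lparr>carrier := identity_component W G\<rparr>)"

definition Gal_VE2 ::
    "complex \<Rightarrow> complex \<Rightarrow> complex \<Rightarrow> complex \<Rightarrow> (complex fls \<Rightarrow> complex fls) monoid" where
  "Gal_VE2 t0 a c th =
     diff_galois_group (K_exp t0) (PV_extension (K_exp t0) (VE2 t0 a c th))"

definition solution_span :: "complex \<Rightarrow> complex \<Rightarrow> complex \<Rightarrow> complex \<Rightarrow> complex fls set" where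
  "solution_span t0 a c th = laurent.span (solution_components (VE2 t0 a c th))"

end

theory Submission
  imports Defs
begin

text \<open>
  Write \<open>a = \<omega>\<^sub>\<alpha>\<close>, \<open>c = \<omega>\<^sub>\<gamma>\<close>, \<open>\<theta> = \<theta>\<^sup>\<gamma>\<^sub>\<alpha>\<^sub>\<alpha>\<close>, and let \<open>C\<^sub>b(t) = cos (b t)\<close> and \<open>S\<^sub>b(t) = sin (b t) / b\<close>
  (\<open>S\<^sub>0(t) = t\<close>) be the standard solutions of \<open>y'' = - b\<^sup>2 y\<close>. Over a solution \<open>x\<close> of the first
  equation, variation of constants gives \<open>z(t) = \<integral> S\<^sub>c(t - r) \<theta> x(r)\<^sup>2 / sin r dr\<close> up to a solution of the
  homogeneous equation with frequency \<open>c\<close>. Let \<open>G\<close> be the Galois group and \<open>G0\<close> its identity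
  component; \<open>G0\<close> is a subgroup because translations of \<open>G\<close> are homeomorphisms.

  Sufficiency. If \<open>\<theta> = 0\<close>, the system consists of two oscillators. For \<open>b \<noteq> 0\<close> every element of \<open>G\<close>
  scales the two exponential solutions of an oscillator, and for \<open>b = 0\<close> it adds a constant to \<open>t\<close>;
  in both cases any two elements commute (\<open>osc_commute\<close>). If \<open>a\<close> and \<open>c\<close> are nonzero rational
  numbers, \<open>exp (\<i> a t)\<close> and \<open>exp (\<i> c t)\<close> are roots of elements of \<open>K\<close>. They have finite orbits, so
  the connected group \<open>G0\<close> fixes them (\<open>G0_fixes_finite_orbit\<close>). Hence an element of \<open>G0\<close> fixes all
  homogeneous solutions, and it moves \<open>z\<close> by such a solution; two such motions commute.

  Necessity. Two elements of \<open>G\<close> come from analytic continuation: \<open>T\<close> from the translation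
  \<open>t \<mapsto> t + l\<close>, \<open>l = 2 \<pi> N\<close>, which fixes \<open>K\<close> since \<open>exp (\<i> t)\<close> is periodic, and \<open>h\<close> from a loop around a
  zero \<open>p\<close> of the sine. On entire functions \<open>T\<close> is the translation and \<open>h\<close> is the identity, while the
  residue at \<open>p\<close> gives \<open>h z = z + \<kappa> x(p)\<^sup>2 S\<^sub>c(t - p)\<close> with \<open>\<kappa> = 2 \<pi> \<i> \<theta> / cos p\<close>
  (\<open>pole_monodromy\<close>). Comparing \<open>T (h z)\<close> with \<open>h (T z)\<close>, the two commute on \<open>z\<close> only if
  \<open>x(p)\<^sup>2 S\<^sub>c(t + l - p) = x(p + l)\<^sup>2 S\<^sub>c(t - p)\<close>. The solution \<open>x(t) = S\<^sub>a(t - p)\<close> then yields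
  \<open>S\<^sub>a(l) = 0\<close>, and \<open>x(t) = C\<^sub>a(t - p)\<close> at \<open>t = p\<close> yields \<open>S\<^sub>c(l) = 0\<close>. As \<open>S\<^sub>0\<close> has no zero \<open>l \<noteq> 0\<close>, both
  frequencies are nonzero, and \<open>sin (2 \<pi> N a) = sin (2 \<pi> N c) = 0\<close> makes them rational
  (\<open>rational_if_virtually_abelian\<close>).

  It remains to see that \<open>T\<close> and \<open>h\<close> lie in \<open>G0\<close>. If the eigenvalues of \<open>\<sigma>\<close> on the space \<open>W\<close> are
  \<open>exp (2 \<pi> \<i> m)\<close> with \<open>m\<close> in a group \<open>M\<close> of complex numbers, the polynomial functions of \<open>\<sigma>\<^sup>k\<close> are exponential
  polynomials in \<open>k\<close> with exponents in \<open>M\<close>. If moreover \<open>M\<close> meets the integers only in 0, an exponential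
  polynomial that vanishes on the natural numbers vanishes identically, so their ring, like that of
  all entire functions, has no zero divisors. The powers of \<open>\<sigma>\<close> then form an irreducible, hence
  connected set, and \<open>\<sigma>\<close> lies in \<open>G0\<close> (\<open>annihilated_in_G0\<close>). For the unipotent \<open>h\<close>, \<open>M = {0}\<close> will do.
  For \<open>T\<close>, take for \<open>M\<close> the kernel of a \<open>\<rat>\<close>-linear map \<open>r : \<complex> \<rightarrow> \<rat>\<close> with \<open>r 1 = 1\<close>, and for \<open>N\<close> a common
  denominator of \<open>r a\<close> and \<open>r c\<close>: modulo integers, \<open>N a\<close> and \<open>N c\<close> then belong to \<open>M\<close>.
\<close>

section \<open>Germs of analytic functions as Laurent series\<close>

lemma germ_eqI:
  assumes "(\<lambda>x. f (t0 + x)) has_fps_expansion F"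
  shows "germ t0 f = fps_to_fls F"
proof -
  have "fps_nth F n = (deriv ^^ n) f t0 / fact n" for n
    using fps_nth_fps_expansion[OF assms, of n]
    by (simp add: higher_deriv_shift_0' o_def)
  then show ?thesis
    unfolding germ_def fps_expansion_def by (simp add: fps_eq_iff)
qed

lemma germ_const [simp]: "germ t0 (\<lambda>_. c) = fls_const c"
  using germ_eqI[of "\<lambda>_. c" t0 "fps_const c"] by (auto simp: fps_const_to_fls)

lemma
  assumes "f analytic_on {t0}" "g analytic_on {t0}"
  shows germ_add: "germ t0 (\<lambda>t. f t + g t) = germ t0 f + germ t0 g"
    and germ_diff: "germ t0 (\<lambda>t. f t - g t) = germ t0 f - germ t0 g"
    and germ_mult: "germ t0 (\<lambda>t. f t * g t) = germ t0 f * germ t0 g"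
proof -
  note e = assms[THEN analytic_at_imp_has_fps_expansion]
  show "germ t0 (\<lambda>t. f t + g t) = germ t0 f + germ t0 g"
    unfolding germ_eqI[OF has_fps_expansion_add[OF e]] germ_eqI[OF e(1)] germ_eqI[OF e(2)] by simp
  show "germ t0 (\<lambda>t. f t - g t) = germ t0 f - germ t0 g"
    unfolding germ_eqI[OF has_fps_expansion_diff[OF e]] germ_eqI[OF e(1)] germ_eqI[OF e(2)] by simp
  show "germ t0 (\<lambda>t. f t * g t) = germ t0 f * germ t0 g"
    unfolding germ_eqI[OF has_fps_expansion_mult[OF e]] germ_eqI[OF e(1)] germ_eqI[OF e(2)]
    by (simp add: fls_times_fps_to_fls)
qed

lemma germ_cmult:
  "f analytic_on {t0} \<Longrightarrow> germ t0 (\<lambda>t. c * f t) = fls_const c * germ t0 f"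
  using germ_mult[of "\<lambda>_. c" t0 f] by simp

lemma germ_deriv:
  assumes "f analytic_on {t0}"
  shows "fls_deriv (germ t0 f) = germ t0 (deriv f)"
proof -
  have "(\<lambda>x. deriv f (t0 + x)) = deriv (\<lambda>x. f (t0 + x))"
    by (rule ext) (simp add: deriv_shift_0' o_def add.commute add_ac)
  then have "(\<lambda>x. deriv f (t0 + x)) has_fps_expansion fps_deriv (fps_expansion f t0)"
    using has_fps_expansion_deriv[OF analytic_at_imp_has_fps_expansion[OF assms]] by simp
  from germ_eqI[OF this] show ?thesis
    by (simp add: germ_def fls_deriv_fps_to_fls)
qed

lemma germ_cong:
  "eventually (\<lambda>t. f t = g t) (nhds t0) \<Longrightarrow> germ t0 f = germ t0 g"
  unfolding germ_def by (simp add: fps_expansion_cong)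

lemma germ_eqD:
  assumes "f analytic_on {t0}" "g analytic_on {t0}" "germ t0 f = germ t0 g"
  shows "eventually (\<lambda>t. f t = g t) (nhds t0)"
proof -
  have eq: "fps_expansion f t0 = fps_expansion g t0"
    using assms(3) by (simp add: germ_def)
  from analytic_at_imp_has_fps_expansion[OF assms(1)] analytic_at_imp_has_fps_expansion[OF assms(2)]
  have "eventually (\<lambda>x. f (t0 + x) = g (t0 + x)) (nhds 0)"
    unfolding has_fps_expansion_def eq by (auto elim: eventually_elim2)
  then show ?thesis
    by (simp add: nhds_to_0[of t0] eventually_filtermap)
qed

lemma entire_eq_if_germ_eq:
  assumes "f holomorphic_on UNIV" "g holomorphic_on UNIV" "germ t0 f = germ t0 g"
  shows "f t = g t"
proof -
  have "f analytic_on {t0}" "g analytic_on {t0}"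
    using assms(1,2) by (auto simp: analytic_at intro: open_UNIV)
  then have "eventually (\<lambda>t. f t = g t) (nhds t0)"
    using assms(3) by (rule germ_eqD)
  then obtain A where A: "open A" "t0 \<in> A" "\<forall>t\<in>A. f t = g t"
    unfolding eventually_nhds by blast
  show ?thesis
    by (rule analytic_continuation_open[OF A(1) open_UNIV _ connected_UNIV _ assms(1,2)]) (use A in auto)
qed

lemma germ_inverse:
  assumes "f analytic_on {t0}" "f t0 \<noteq> 0"
  shows "germ t0 (\<lambda>t. inverse (f t)) = inverse (germ t0 f)"
proof -
  have "eventually (\<lambda>t. f t * inverse (f t) = 1) (nhds t0)"
  proof -
    have "isCont f t0" using assms(1) by (rule analytic_at_imp_isCont)
    then have "(f \<longlongrightarrow> f t0) (nhds t0)"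
      by (simp add: isCont_def tendsto_at_iff_tendsto_nhds)
    then have "eventually (\<lambda>t. f t \<noteq> 0) (nhds t0)"
      using assms(2) by (rule tendsto_imp_eventually_ne)
    then show ?thesis by eventually_elim simp
  qed
  then have "germ t0 (\<lambda>t. f t * inverse (f t)) = germ t0 (\<lambda>_. 1)"
    by (rule germ_cong)
  then have "germ t0 f * germ t0 (\<lambda>t. inverse (f t)) = 1"
    using assms by (subst (asm) germ_mult) (auto intro!: analytic_intros)
  then show ?thesis
    by (metis inverse_unique)
qed

lemma fls_deriv_eq_0_iff_const: "fls_deriv (f :: complex fls) = 0 \<longleftrightarrow> (\<exists>c. f = fls_const c)"
  by (metis fls_deriv_eq_0_iff fls_deriv_const)

lemma fls_deriv_quotient:
  fixes F H :: "complex fls"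
  assumes "H \<noteq> 0"
  shows "fls_deriv (F / H) = (fls_deriv F * H - F * fls_deriv H) / (H * H)"
proof -
  have "fls_deriv F = F / H * fls_deriv H + fls_deriv (F / H) * H"
    using fls_deriv_mult[of "F / H" H] assms by simp
  then show ?thesis using assms by (simp add: field_simps)
qed

section \<open>The harmonic oscillator\<close>

definition osc_cos :: "complex \<Rightarrow> complex \<Rightarrow> complex" where
  "osc_cos c t = cos (c * t)"

definition osc_sin :: "complex \<Rightarrow> complex \<Rightarrow> complex" where
  "osc_sin c t = (if c = 0 then t else sin (c * t) / c)"

text \<open>
  All solutions of \<open>y'' = - c\<^sup>2 y\<close>, by initial values \<open>p = y 0\<close> and \<open>q = y' 0\<close>. The basis
  \<open>osc_cos c\<close>, \<open>osc_sin c\<close> also covers \<open>c = 0\<close>, where it is \<open>1, t\<close>; so the frequency 0 needs no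
  separate treatment except in questions about exponentials.
\<close>

definition osc :: "complex \<Rightarrow> complex \<Rightarrow> complex \<Rightarrow> complex \<Rightarrow> complex" where
  "osc c p q t = p * osc_cos c t + q * osc_sin c t"

lemma osc_cos_0 [simp]: "osc_cos c 0 = 1"
  and osc_sin_0 [simp]: "osc_sin c 0 = 0"
  by (simp_all add: osc_cos_def osc_sin_def)

lemma has_field_derivative_osc_cos [derivative_intros]:
  "(f has_field_derivative f') (at t within S) \<Longrightarrow>
   ((\<lambda>t. osc_cos c (f t)) has_field_derivative (- (c\<^sup>2) * osc_sin c (f t)) * f') (at t within S)"
  unfolding osc_cos_def osc_sin_def
  by (cases "c = 0") (auto intro!: derivative_eq_intros simp: power2_eq_square)

lemma has_field_derivative_osc_sin [derivative_intros]:
  "(f has_field_derivative f') (at t within S) \<Longrightarrow>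
   ((\<lambda>t. osc_sin c (f t)) has_field_derivative osc_cos c (f t) * f') (at t within S)"
  unfolding osc_cos_def osc_sin_def
  by (cases "c = 0") (auto intro!: derivative_eq_intros)

lemma has_field_derivative_osc [derivative_intros]:
  "(f has_field_derivative f') (at t within S) \<Longrightarrow>
   ((\<lambda>t. osc c p q (f t)) has_field_derivative osc c q (- (c\<^sup>2) * p) (f t) * f') (at t within S)"
  unfolding osc_def by (auto intro!: derivative_eq_intros simp: algebra_simps)

lemma osc_holomorphic: "f holomorphic_on A \<Longrightarrow> (\<lambda>t. osc c p q (f t)) holomorphic_on A"
  unfolding osc_def osc_cos_def osc_sin_def
  by (cases "c = 0") (auto intro!: holomorphic_intros)

lemma osc_analytic: "(osc c p q) analytic_on A"
proof -
  have "osc c p q holomorphic_on UNIV"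
    using osc_holomorphic[OF holomorphic_on_ident, of c p q UNIV] by simp
  then show ?thesis
    by (metis analytic_on_open analytic_on_subset open_UNIV subset_UNIV)
qed

lemma osc_1_0: "osc_cos c = osc c 1 0" and osc_0_1: "osc_sin c = osc c 0 1"
  by (auto simp: osc_def)

lemma osc_cos_sin_squared: "osc_cos c t * osc_cos c t + c\<^sup>2 * (osc_sin c t * osc_sin c t) = 1"
  using sin_cos_squared_add[of "c * t"]
  by (auto simp: osc_cos_def osc_sin_def power2_eq_square field_simps)

lemma osc_cos_add: "osc_cos c (s + t) = osc_cos c s * osc_cos c t - c\<^sup>2 * (osc_sin c s * osc_sin c t)"
  by (auto simp: osc_cos_def osc_sin_def power2_eq_square cos_add ring_distribs)

lemma osc_sin_add: "osc_sin c (s + t) = osc_sin c s * osc_cos c t + osc_cos c s * osc_sin c t"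
  by (auto simp: osc_cos_def osc_sin_def sin_add ring_distribs field_simps)

lemma osc_sin_diff: "osc_sin c (t - p) = osc_sin c t * osc_cos c p - osc_cos c t * osc_sin c p"
  using osc_sin_add[of c t "- p"] by (simp add: osc_sin_def osc_cos_def)

lemma osc_cos_diff: "osc_cos c (t - p) = osc_cos c t * osc_cos c p + c\<^sup>2 * (osc_sin c t * osc_sin c p)"
  using osc_cos_add[of c t "- p"] by (simp add: osc_sin_def osc_cos_def)

lemma osc_shift:
  "osc c p q (t + l) = osc c (osc c p q l) (osc c q (- (c\<^sup>2) * p) l) t"
  by (simp add: osc_def osc_cos_add osc_sin_add algebra_simps)

lemma osc_linear:
  "u * osc c p q t + v * osc c p' q' t = osc c (u * p + v * p') (u * q + v * q') t"
  by (simp add: osc_def algebra_simps)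

lemma osc_exp: "b \<noteq> 0 \<Longrightarrow> exp (\<i> * b * t) = osc b 1 (\<i> * b) t"
  by (simp add: osc_def osc_cos_def osc_sin_def exp_Euler mult.assoc)

text \<open>
  A translation by \<open>l\<close> has the eigenvalues \<open>exp (\<plusminus> \<i> b l)\<close> on the solution space, and these have the
  product 1 and the sum \<open>2 cos (b l)\<close>. The offset \<open>u\<close> allows the recurrence to be iterated.
\<close>

lemma osc_recurrence: "osc b p q (t + (u + (l + l))) = 2 * osc_cos b l * osc b p q (t + (u + l)) - osc b p q (t + u)"
proof -
  have "osc b p q (v + (l + l)) = 2 * osc_cos b l * osc b p q (v + l) - osc b p q v" for v
  proof -
    have "osc b p q (v + (l + l)) + osc b p q v * (osc_cos b l * osc_cos b l + b\<^sup>2 * (osc_sin b l * osc_sin b l))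
        = 2 * osc_cos b l * osc b p q (v + l)"
      unfolding osc_def osc_cos_add osc_sin_add by (simp add: algebra_simps)
    then show ?thesis unfolding osc_cos_sin_squared by (simp add: algebra_simps)
  qed
  from this[of "t + u"] show ?thesis by (simp only: add.assoc)
qed

lemma osc_sin_translation_zero:
  assumes "osc_sin b (of_real (2 * pi * of_nat N)) = 0" "N > 0"
  shows "b \<in> \<rat> - {0}"
proof -
  have b: "b \<noteq> 0" using assms by (auto simp: osc_sin_def)
  then have "sin (b * of_real (2 * pi * of_nat N)) = 0"
    using assms(1) by (simp add: osc_sin_def)
  then obtain n :: int where "b * of_real (2 * pi * of_nat N) = of_real (of_int n * pi)"
    unfolding Complex_Transcendental.sin_eq_0 by auto
  then have "of_real pi * (2 * of_nat N * b) = of_real pi * of_int n"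
    by (simp add: mult_ac)
  then have "2 * of_nat N * b = of_int n" by (subst (asm) mult_cancel_left) simp
  then have "b = of_int n / (2 * of_nat N)" using assms(2) by (simp add: field_simps)
  then show ?thesis using b by simp
qed

lemma deriv_osc: "deriv (osc c p q) = osc c q (- (c\<^sup>2) * p)"
proof
  fix t
  have "(osc c p q has_field_derivative osc c q (- (c\<^sup>2) * p) t) (at t)"
    using has_field_derivative_osc[OF DERIV_ident, of c p q t] by simp
  then show "deriv (osc c p q) t = osc c q (- (c\<^sup>2) * p) t"
    by (rule DERIV_imp_deriv)
qed

lemma germ_osc: "germ t0 (osc c p q) = fls_const p * germ t0 (osc_cos c) + fls_const q * germ t0 (osc_sin c)"
proof -
  have an: "osc_cos c analytic_on {t0}" "osc_sin c analytic_on {t0}"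
    by (simp_all add: osc_1_0 osc_0_1 osc_analytic)
  have "osc c p q = (\<lambda>t. p * osc_cos c t + q * osc_sin c t)"
    by (simp add: osc_def fun_eq_iff)
  then show ?thesis
    using an by (simp add: germ_add germ_cmult analytic_intros)
qed

lemma fls_deriv_germ_osc: "fls_deriv (germ t0 (osc c p q)) = germ t0 (osc c q (- (c\<^sup>2) * p))"
  by (simp add: germ_deriv osc_analytic deriv_osc)

lemma
  shows fls_deriv_germ_osc_cos: "fls_deriv (germ t0 (osc_cos c)) = - fls_const (c\<^sup>2) * germ t0 (osc_sin c)"
    and fls_deriv_germ_osc_sin: "fls_deriv (germ t0 (osc_sin c)) = germ t0 (osc_cos c)"
    and germ_osc_cos_sin_squared: "germ t0 (osc_cos c) * germ t0 (osc_cos c)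
      + fls_const (c\<^sup>2) * (germ t0 (osc_sin c) * germ t0 (osc_sin c)) = 1"
proof -
  show "fls_deriv (germ t0 (osc_cos c)) = - fls_const (c\<^sup>2) * germ t0 (osc_sin c)"
    unfolding osc_1_0 fls_deriv_germ_osc by (simp add: germ_osc)
  show "fls_deriv (germ t0 (osc_sin c)) = germ t0 (osc_cos c)"
    unfolding osc_0_1 fls_deriv_germ_osc by (simp add: germ_osc)
  have an: "osc_cos c analytic_on {t0}" "osc_sin c analytic_on {t0}"
    by (simp_all add: osc_1_0 osc_0_1 osc_analytic)
  have "germ t0 (osc_cos c) * germ t0 (osc_cos c) + fls_const (c\<^sup>2) * (germ t0 (osc_sin c) * germ t0 (osc_sin c))
      = germ t0 (\<lambda>t. osc_cos c t * osc_cos c t + c\<^sup>2 * (osc_sin c t * osc_sin c t))"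
    using an by (simp add: germ_add germ_mult germ_cmult analytic_intros)
  then show "germ t0 (osc_cos c) * germ t0 (osc_cos c)
      + fls_const (c\<^sup>2) * (germ t0 (osc_sin c) * germ t0 (osc_sin c)) = 1"
    by (simp add: osc_cos_sin_squared)
qed

lemma fls_deriv2_germ_osc:
  "fls_deriv (fls_deriv (germ t0 (osc c p q))) = - fls_const (c\<^sup>2) * germ t0 (osc c p q)"
proof -
  have c: "fls_const (- (c\<^sup>2) * u) = - fls_const (c\<^sup>2) * fls_const u" for u
    by (simp only: fls_const_mult_const[symmetric] fls_const_uminus[symmetric])
  show ?thesis
    unfolding fls_deriv_germ_osc unfolding germ_osc c by (simp only: distrib_left mult.assoc)
qed

text \<open>
  Both \<open>y C - y' S\<close> and \<open>y' C + c\<^sup>2 y S\<close> have derivative 0, so they are constants \<open>p\<close> and \<open>q\<close>, and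
  \<open>C\<^sup>2 + c\<^sup>2 S\<^sup>2 = 1\<close> recovers \<open>y\<close> from them.
\<close>

lemma osc_solutions:
  fixes y :: "complex fls"
  assumes y: "fls_deriv (fls_deriv y) = - fls_const (c\<^sup>2) * y"
  obtains p q where "y = germ t0 (osc c p q)"
proof -
  define C S where "C = germ t0 (osc_cos c)" and "S = germ t0 (osc_sin c)"
  have C': "fls_deriv C = - fls_const (c\<^sup>2) * S" and S': "fls_deriv S = C"
    and CS: "C * C + fls_const (c\<^sup>2) * (S * S) = 1"
    unfolding C_def S_def
    by (rule fls_deriv_germ_osc_cos fls_deriv_germ_osc_sin germ_osc_cos_sin_squared)+
  have "fls_deriv (y * C - fls_deriv y * S) = 0"
    by (simp add: C' S' y algebra_simps)
  then obtain p where p: "y * C - fls_deriv y * S = fls_const p"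
    unfolding fls_deriv_eq_0_iff_const by blast
  have "fls_deriv (fls_deriv y * C + fls_const (c\<^sup>2) * (y * S)) = 0"
    by (simp add: C' S' y algebra_simps)
  then obtain q where q: "fls_deriv y * C + fls_const (c\<^sup>2) * (y * S) = fls_const q"
    unfolding fls_deriv_eq_0_iff_const by blast
  have "y = y * (C * C + fls_const (c\<^sup>2) * (S * S))"
    by (simp add: CS)
  also have "\<dots> = fls_const p * C + fls_const q * S"
    unfolding p[symmetric] q[symmetric] by (simp add: algebra_simps)
  also have "\<dots> = germ t0 (osc c p q)"
    by (simp add: germ_osc C_def S_def)
  finally show ?thesis by (rule that)
qed

section \<open>The Picard-Vessiot extension and its Galois group\<close>

lemma is_subfield_hull: "is_subfield (is_subfield hull X)"
  unfolding hull_def is_subfield_def by blast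

lemma is_diff_subfield_hull: "is_diff_subfield (is_diff_subfield hull X)"
  unfolding hull_def is_diff_subfield_def is_subfield_def by blast

lemma
  assumes "is_subfield F"
  shows subfield_add: "x \<in> F \<Longrightarrow> y \<in> F \<Longrightarrow> x + y \<in> F"
    and subfield_mult: "x \<in> F \<Longrightarrow> y \<in> F \<Longrightarrow> x * y \<in> F"
    and subfield_uminus: "x \<in> F \<Longrightarrow> - x \<in> F"
    and subfield_inverse: "x \<in> F \<Longrightarrow> inverse x \<in> F"
    and subfield_0: "0 \<in> F"
    and subfield_1: "1 \<in> F"
    and subfield_diff: "x \<in> F \<Longrightarrow> y \<in> F \<Longrightarrow> x - y \<in> F"
proof -
  show "x \<in> F \<Longrightarrow> y \<in> F \<Longrightarrow> x - y \<in> F"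
    unfolding diff_conv_add_uminus using assms unfolding is_subfield_def by blast
qed (use assms in \<open>auto simp: is_subfield_def\<close>)

lemma is_diff_subfieldI:
  assumes "0 \<in> F" "1 \<in> F"
    and "\<And>x y. x \<in> F \<Longrightarrow> y \<in> F \<Longrightarrow> x + y \<in> F" "\<And>x y. x \<in> F \<Longrightarrow> y \<in> F \<Longrightarrow> x * y \<in> F"
    and "\<And>x. x \<in> F \<Longrightarrow> - x \<in> F" "\<And>x. x \<in> F \<Longrightarrow> inverse x \<in> F" "\<And>x. x \<in> F \<Longrightarrow> fls_deriv x \<in> F"
  shows "is_diff_subfield F"
  using assms by (simp add: is_diff_subfield_def is_subfield_def)

lemma exp_i_analytic: "(\<lambda>t. exp (\<i> * t)) analytic_on A"
  by (intro analytic_intros)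

lemma K_exp_is_subfield: "is_subfield (K_exp t0)"
  unfolding K_exp_def by (rule is_subfield_hull)

lemma fls_const_in_K_exp: "fls_const c \<in> K_exp t0"
  unfolding K_exp_def by (rule hull_inc) simp

lemma germ_exp_in_K_exp: "germ t0 (\<lambda>t. exp (\<i> * t)) \<in> K_exp t0"
  unfolding K_exp_def by (rule hull_inc) simp

lemma germ_sin_in_K_exp: "germ t0 sin \<in> K_exp t0"
proof -
  let ?u = "germ t0 (\<lambda>t. exp (\<i> * t))"
  have "sin = (\<lambda>t. 1 / (2 * \<i>) * (exp (\<i> * t) - inverse (exp (\<i> * t))))"
    by (simp add: fun_eq_iff sin_exp_eq exp_minus)
  moreover have "germ t0 (\<lambda>t. 1 / (2 * \<i>) * (exp (\<i> * t) - inverse (exp (\<i> * t))))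
      = fls_const (1 / (2 * \<i>)) * (?u - inverse ?u)"
  proof -
    have inv: "(\<lambda>t. inverse (exp (\<i> * t))) analytic_on {t0}"
      by (intro analytic_intros) auto
    show ?thesis
      by (simp only: germ_cmult germ_diff[OF exp_i_analytic inv] analytic_on_diff[OF exp_i_analytic inv]
            germ_inverse[OF exp_i_analytic exp_not_eq_zero])
  qed
  ultimately have "germ t0 sin = fls_const (1 / (2 * \<i>)) * (?u - inverse ?u)"
    by metis
  then show ?thesis
    by (metis K_exp_is_subfield fls_const_in_K_exp germ_exp_in_K_exp subfield_mult subfield_diff
        subfield_inverse)
qed

locale variational_equation =
  fixes t0 a c th :: complex
  assumes sin_t0: "sin t0 \<noteq> 0"

begin

abbreviation "sols \<equiv> VE2 t0 a c th"

abbreviation "K \<equiv> K_exp t0"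

abbreviation "L \<equiv> PV_extension K sols"

abbreviation "G \<equiv> Gal_VE2 t0 a c th"

abbreviation "W \<equiv> solution_span t0 a c th"

abbreviation "G0 \<equiv> identity_component W G"

lemma VE2_D:
  assumes "(x, z) \<in> sols"
  shows "fls_deriv (fls_deriv x) = - fls_const (a\<^sup>2) * x"
    and "fls_deriv (fls_deriv z) = - fls_const (c\<^sup>2) * z + fls_const th / germ t0 sin * x\<^sup>2"
  using assms by (auto simp: VE2_def)

lemma homogeneous_solution_in_sols: "(0, germ t0 (osc c p q)) \<in> sols"
  by (simp add: VE2_def fls_deriv2_germ_osc)

lemma sols_diff_homogeneous:
  assumes "(x, z) \<in> sols" "(x, z') \<in> sols"
  obtains p q where "z' = z + germ t0 (osc c p q)"
proof -
  have "fls_deriv (fls_deriv (z' - z)) = - fls_const (c\<^sup>2) * (z' - z)"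
    using VE2_D(2)[OF assms(1)] VE2_D(2)[OF assms(2)] by (simp add: algebra_simps)
  then obtain p q where "z' - z = germ t0 (osc c p q)"
    by (rule osc_solutions)
  then have "z' = z + germ t0 (osc c p q)" by (simp add: algebra_simps)
  then show thesis by (rule that)
qed

lemma L_diff_subfield: "is_diff_subfield L"
  unfolding PV_extension_def by (rule is_diff_subfield_hull)

lemma L_subfield: "is_subfield L" and L_deriv: "x \<in> L \<Longrightarrow> fls_deriv x \<in> L"
  using L_diff_subfield by (auto simp: is_diff_subfield_def)

lemma K_sub_L: "x \<in> K \<Longrightarrow> x \<in> L"
  unfolding PV_extension_def by (rule hull_inc) simp

lemma components_sub_L: "x \<in> solution_components sols \<Longrightarrow> x \<in> L"
  unfolding PV_extension_def by (rule hull_inc) simp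

lemma sols_sub_L: "(x, z) \<in> sols \<Longrightarrow> x \<in> L" "(x, z) \<in> sols \<Longrightarrow> z \<in> L"
  by (force intro!: components_sub_L simp: solution_components_def)+

lemma fls_const_in_L: "fls_const k \<in> L"
  by (intro K_sub_L fls_const_in_K_exp)

lemma L_minimal:
  assumes "is_diff_subfield F" "K \<subseteq> F" "\<And>x z. (x, z) \<in> sols \<Longrightarrow> x \<in> F \<and> z \<in> F"
  shows "L \<subseteq> F"
  unfolding PV_extension_def
  by (rule hull_minimal) (use assms in \<open>auto simp: solution_components_def\<close>)

lemma W_subspace: "laurent.subspace W"
  unfolding solution_span_def by (rule laurent.subspace_span)

lemma W_closed:
  "x \<in> W \<Longrightarrow> y \<in> W \<Longrightarrow> x + y \<in> W" "x \<in> W \<Longrightarrow> fls_const k * x \<in> W"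
  "x \<in> W \<Longrightarrow> y \<in> W \<Longrightarrow> x - y \<in> W"
  by (simp_all add: W_subspace laurent.subspace_add laurent.subspace_scale laurent.subspace_diff)

lemma sols_sub_W: "(x, z) \<in> sols \<Longrightarrow> x \<in> W" "(x, z) \<in> sols \<Longrightarrow> z \<in> W"
  unfolding solution_span_def
  by (force intro!: laurent.span_base simp: solution_components_def)+

lemma W_sub_L: "w \<in> W \<Longrightarrow> w \<in> L"
proof -
  have "laurent.subspace L"
    by (intro laurent.subspaceI subfield_0 subfield_add subfield_mult L_subfield fls_const_in_L)
  then have "W \<subseteq> L"
    unfolding solution_span_def by (intro laurent.span_minimal subsetI components_sub_L)
  then show "w \<in> W \<Longrightarrow> w \<in> L" by blast
qed

lemma G_carrier:
  "\<sigma> \<in> carrier G \<longleftrightarrow> \<sigma> \<in> Bij L \<and>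
     (\<forall>x\<in>L. \<forall>y\<in>L. \<sigma> (x + y) = \<sigma> x + \<sigma> y \<and> \<sigma> (x * y) = \<sigma> x * \<sigma> y) \<and>
     (\<forall>x\<in>L. \<sigma> (fls_deriv x) = fls_deriv (\<sigma> x)) \<and> (\<forall>x\<in>K. \<sigma> x = x)"
  by (simp add: Gal_VE2_def diff_galois_group_def)

lemma
  assumes "\<sigma> \<in> carrier G"
  shows G_closed: "x \<in> L \<Longrightarrow> \<sigma> x \<in> L"
    and G_inj: "x \<in> L \<Longrightarrow> y \<in> L \<Longrightarrow> \<sigma> x = \<sigma> y \<Longrightarrow> x = y"
    and G_add: "x \<in> L \<Longrightarrow> y \<in> L \<Longrightarrow> \<sigma> (x + y) = \<sigma> x + \<sigma> y"
    and G_mult: "x \<in> L \<Longrightarrow> y \<in> L \<Longrightarrow> \<sigma> (x * y) = \<sigma> x * \<sigma> y"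
    and G_deriv: "x \<in> L \<Longrightarrow> \<sigma> (fls_deriv x) = fls_deriv (\<sigma> x)"
    and G_fixes_K: "x \<in> K \<Longrightarrow> \<sigma> x = x"
    and G_fixes_const: "\<sigma> (fls_const k) = fls_const k"
    and G_scale: "x \<in> L \<Longrightarrow> \<sigma> (fls_const k * x) = fls_const k * \<sigma> x"
    and G_uminus: "x \<in> L \<Longrightarrow> \<sigma> (- x) = - \<sigma> x"
    and G_diff: "x \<in> L \<Longrightarrow> y \<in> L \<Longrightarrow> \<sigma> (x - y) = \<sigma> x - \<sigma> y"
    and G_inverse: "x \<in> L \<Longrightarrow> \<sigma> (inverse x) = inverse (\<sigma> x)"
    and G_power: "x \<in> L \<Longrightarrow> \<sigma> (x ^ n) = \<sigma> x ^ n"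
proof -
  have bij: "bij_betw \<sigma> L L"
    using assms by (auto simp: G_carrier Bij_def)
  show closed: "\<sigma> x \<in> L" if "x \<in> L" for x
    using bij that by (auto simp: bij_betw_def)
  show inj: "x = y" if "x \<in> L" "y \<in> L" "\<sigma> x = \<sigma> y" for x y
    using bij that by (auto simp: bij_betw_def inj_on_def)
  show add: "\<sigma> (x + y) = \<sigma> x + \<sigma> y" if "x \<in> L" "y \<in> L" for x y
    using assms that by (simp add: G_carrier)
  show mult: "\<sigma> (x * y) = \<sigma> x * \<sigma> y" if "x \<in> L" "y \<in> L" for x y
    using assms that by (simp add: G_carrier)
  show "\<sigma> (fls_deriv x) = fls_deriv (\<sigma> x)" if "x \<in> L" for x
    using assms that by (simp add: G_carrier)
  show fixK: "\<sigma> x = x" if "x \<in> K" for x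
    using assms that by (simp add: G_carrier)
  show const: "\<sigma> (fls_const k) = fls_const k" for k
    by (simp add: fixK fls_const_in_K_exp)
  show scale: "\<sigma> (fls_const k * x) = fls_const k * \<sigma> x" if "x \<in> L" for x k
    using that by (simp add: mult const fls_const_in_L)
  show um: "\<sigma> (- x) = - \<sigma> x" if "x \<in> L" for x
    using scale[OF that, of "-1"] by simp
  show "\<sigma> (x - y) = \<sigma> x - \<sigma> y" if "x \<in> L" "y \<in> L" for x y
    using that add[of x "- y"] by (simp add: um subfield_uminus[OF L_subfield])
  have one: "\<sigma> 1 = 1" and zero: "\<sigma> 0 = 0"
    using const[of 1] const[of 0] by simp_all
  show "\<sigma> (inverse x) = inverse (\<sigma> x)" if x: "x \<in> L" for x
  proof (cases "x = 0")
    case False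
    then have "\<sigma> x * \<sigma> (inverse x) = 1"
      using mult[OF x subfield_inverse[OF L_subfield x]] one by simp
    then show ?thesis by (metis inverse_unique)
  qed (simp add: zero)
  show "\<sigma> (x ^ n) = \<sigma> x ^ n" if x: "x \<in> L" for x n
  proof (induction n)
    case (Suc n)
    have "x ^ n \<in> L"
      by (induction n) (simp_all add: x subfield_1[OF L_subfield] subfield_mult[OF L_subfield])
    then show ?case using Suc x by (simp add: mult)
  qed (simp add: one)
qed

lemma G_sols:
  assumes "\<sigma> \<in> carrier G" "(x, z) \<in> sols"
  shows "(\<sigma> x, \<sigma> z) \<in> sols"
proof -
  note L = sols_sub_L[OF assms(2)]
  note VE = VE2_D[OF assms(2)]
  let ?k = "fls_const th / germ t0 sin"
  have k: "?k \<in> K" unfolding divide_inverse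
    by (intro subfield_mult subfield_inverse K_exp_is_subfield fls_const_in_K_exp germ_sin_in_K_exp)
  have k2: "- fls_const (u\<^sup>2) \<in> K" for u
    by (intro subfield_uminus K_exp_is_subfield fls_const_in_K_exp)
  have x2: "x\<^sup>2 \<in> L" unfolding power2_eq_square by (intro subfield_mult L_subfield L)
  have inL: "- fls_const (c\<^sup>2) * z \<in> L" "?k * x\<^sup>2 \<in> L"
    by (intro subfield_mult L_subfield K_sub_L k k2 L x2)+
  have "fls_deriv (fls_deriv (\<sigma> x)) = - fls_const (a\<^sup>2) * \<sigma> x"
    using arg_cong[OF VE(1), of \<sigma>] assms(1) L k2[of a]
    by (simp only: G_deriv L_deriv G_mult K_sub_L G_fixes_K)
  moreover have "fls_deriv (fls_deriv (\<sigma> z)) = - fls_const (c\<^sup>2) * \<sigma> z + ?k * (\<sigma> x)\<^sup>2"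
    using arg_cong[OF VE(2), of \<sigma>] assms(1) L k2[of c] k x2 inL
    by (simp only: G_deriv L_deriv G_add G_mult K_sub_L G_fixes_K G_power)
  ultimately show ?thesis by (simp add: VE2_def)
qed

lemma G_W:
  assumes s: "\<sigma> \<in> carrier G" and w: "w \<in> W"
  shows "\<sigma> w \<in> W"
proof -
  have "laurent.subspace {w \<in> W. \<sigma> w \<in> W}"
    by (intro laurent.subspaceI)
      (use G_fixes_const[OF s, of 0] in \<open>auto simp: W_closed W_sub_L G_add[OF s] G_scale[OF s]
        laurent.subspace_0[OF W_subspace]\<close>)
  moreover have "solution_components sols \<subseteq> {w \<in> W. \<sigma> w \<in> W}"
  proof
    fix w assume "w \<in> solution_components sols"
    then obtain x z where "(x, z) \<in> sols" "w = x \<or> w = z"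
      by (auto simp: solution_components_def)
    then show "w \<in> {w \<in> W. \<sigma> w \<in> W}"
      using sols_sub_W sols_sub_W[OF G_sols[OF s]] by auto
  qed
  ultimately have "W \<subseteq> {w \<in> W. \<sigma> w \<in> W}"
    unfolding solution_span_def by (intro laurent.span_minimal)
  then show ?thesis using w by blast
qed

lemma G_group: "group G"
proof -
  interpret B: group "BijGroup L" by (rule group_BijGroup)
  have mult: "\<sigma> \<otimes>\<^bsub>BijGroup L\<^esub> \<tau> = compose L \<sigma> \<tau>" if "\<sigma> \<in> Bij L" "\<tau> \<in> Bij L" for \<sigma> \<tau>
    using that by (simp add: BijGroup_def)
  have car: "carrier (BijGroup L) = Bij L" by (simp add: BijGroup_def)
  have "subgroup (carrier G) (BijGroup L)"
  proof (rule B.subgroupI)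
    show "carrier G \<subseteq> carrier (BijGroup L)"
      by (auto simp: G_carrier car)
    have "(\<lambda>x\<in>L. x) \<in> carrier G"
      unfolding G_carrier
      by (auto simp: id_Bij K_sub_L L_deriv subfield_add[OF L_subfield] subfield_mult[OF L_subfield])
    then show "carrier G \<noteq> {}" by blast
    fix \<sigma> assume s: "\<sigma> \<in> carrier G"
    then have sB: "\<sigma> \<in> Bij L" by (simp add: G_carrier)
    let ?i = "restrict (inv_into L \<sigma>) L"
    have im: "\<sigma> ` L = L" using sB by (simp add: Bij_def bij_betw_def)
    have i1: "inv_into L \<sigma> x \<in> L" and i2: "\<sigma> (inv_into L \<sigma> x) = x" if "x \<in> L" for x
      using that im by (auto intro: inv_into_into f_inv_into_f)
    have iu: "inv_into L \<sigma> x = y" if "x \<in> L" "y \<in> L" "\<sigma> y = x" for x y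
      using that i1 i2 G_inj[OF s] by metis
    have "?i \<in> carrier G"
      unfolding G_carrier
    proof (intro conjI ballI)
      show "?i \<in> Bij L" by (rule restrict_inv_into_Bij[OF sB])
      fix x y assume xy: "x \<in> L" "y \<in> L"
      show "?i (x + y) = ?i x + ?i y"
        using xy by (simp add: subfield_add[OF L_subfield])
          (intro iu; simp add: subfield_add[OF L_subfield] i1 i2 G_add[OF s])
      show "?i (x * y) = ?i x * ?i y"
        using xy by (simp add: subfield_mult[OF L_subfield])
          (intro iu; simp add: subfield_mult[OF L_subfield] i1 i2 G_mult[OF s])
    next
      fix x assume "x \<in> L"
      then show "?i (fls_deriv x) = fls_deriv (?i x)"
        by (simp add: L_deriv) (intro iu; simp add: L_deriv i1 i2 G_deriv[OF s])
    next
      fix x assume "x \<in> K"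
      then show "?i x = x"
        by (simp add: K_sub_L) (intro iu; simp add: K_sub_L G_fixes_K[OF s])
    qed
    moreover have "inv\<^bsub>BijGroup L\<^esub> \<sigma> = ?i"
      by (rule B.inv_equality)
        (use sB restrict_inv_into_Bij[OF sB] in \<open>simp_all add: car mult Bij_compose_restrict_eq, simp add: BijGroup_def\<close>)
    ultimately show "inv\<^bsub>BijGroup L\<^esub> \<sigma> \<in> carrier G" by simp
  next
    fix \<sigma> \<tau> assume s: "\<sigma> \<in> carrier G" and t: "\<tau> \<in> carrier G"
    then have B: "\<sigma> \<in> Bij L" "\<tau> \<in> Bij L" by (auto simp: G_carrier)
    have "compose L \<sigma> \<tau> \<in> carrier G"
      unfolding G_carrier
      by (auto simp: compose_Bij B compose_eq subfield_add[OF L_subfield] subfield_mult[OF L_subfield]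
          L_deriv K_sub_L G_closed[OF s] G_closed[OF t] G_add[OF s] G_add[OF t] G_mult[OF s] G_mult[OF t]
          G_deriv[OF s] G_deriv[OF t] G_fixes_K[OF s] G_fixes_K[OF t])
    then show "\<sigma> \<otimes>\<^bsub>BijGroup L\<^esub> \<tau> \<in> carrier G" by (simp add: mult B)
  qed
  then have "group ((BijGroup L)\<lparr>carrier := carrier G\<rparr>)"
    by (rule subgroup.subgroup_is_group[OF _ B.is_group])
  moreover have "(BijGroup L)\<lparr>carrier := carrier G\<rparr> = G"
    by (simp add: Gal_VE2_def diff_galois_group_def)
  ultimately show ?thesis by simp
qed

lemma G_mult_compose:
  "\<sigma> \<in> carrier G \<Longrightarrow> \<tau> \<in> carrier G \<Longrightarrow> \<sigma> \<otimes>\<^bsub>G\<^esub> \<tau> = compose L \<sigma> \<tau>"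
  by (simp add: Gal_VE2_def diff_galois_group_def BijGroup_def)

lemma G_mult_apply:
  "\<sigma> \<in> carrier G \<Longrightarrow> \<tau> \<in> carrier G \<Longrightarrow> x \<in> L \<Longrightarrow> (\<sigma> \<otimes>\<^bsub>G\<^esub> \<tau>) x = \<sigma> (\<tau> x)"
  by (simp add: G_mult_compose compose_eq)

lemma G_one_apply: "x \<in> L \<Longrightarrow> \<one>\<^bsub>G\<^esub> x = x"
  by (simp add: Gal_VE2_def diff_galois_group_def BijGroup_def)

lemma G_pow_apply:
  assumes "\<sigma> \<in> carrier G" "x \<in> L"
  shows "(\<sigma> [^]\<^bsub>G\<^esub> (n::nat)) x = (\<sigma> ^^ n) x"
proof -
  interpret group G by (rule G_group)
  show ?thesis using assms(2)
  proof (induction n arbitrary: x)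
    case (Suc n)
    then show ?case
      using assms(1) by (simp add: G_mult_apply G_closed funpow_swap1)
  qed (simp add: G_one_apply)
qed

lemma G_ext:
  assumes "\<sigma> \<in> carrier G" "\<tau> \<in> carrier G" "\<And>x. x \<in> L \<Longrightarrow> \<sigma> x = \<tau> x"
  shows "\<sigma> = \<tau>"
  by (rule extensionalityI[of _ L]) (use assms in \<open>auto simp: G_carrier Bij_def\<close>)

text \<open>
  The elements of \<open>L\<close> on which two automorphisms commute form a differential subfield.
\<close>

lemma G_commute_if_commute_on_solutions:
  assumes s: "\<sigma> \<in> carrier G" and t: "\<tau> \<in> carrier G"
    and comm: "\<And>x z. (x, z) \<in> sols \<Longrightarrow> \<sigma> (\<tau> x) = \<tau> (\<sigma> x) \<and> \<sigma> (\<tau> z) = \<tau> (\<sigma> z)"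
  shows "\<sigma> \<otimes>\<^bsub>G\<^esub> \<tau> = \<tau> \<otimes>\<^bsub>G\<^esub> \<sigma>"
proof -
  interpret group G by (rule G_group)
  let ?F = "{x \<in> L. \<sigma> (\<tau> x) = \<tau> (\<sigma> x)}"
  have "is_diff_subfield ?F"
    unfolding is_diff_subfield_def is_subfield_def
    by (auto simp: subfield_0[OF L_subfield] subfield_1[OF L_subfield] subfield_add[OF L_subfield]
        subfield_mult[OF L_subfield] subfield_uminus[OF L_subfield] subfield_inverse[OF L_subfield] L_deriv
        G_closed[OF s] G_closed[OF t] G_add[OF s] G_add[OF t] G_mult[OF s] G_mult[OF t]
        G_deriv[OF s] G_deriv[OF t] G_uminus[OF s] G_uminus[OF t] G_inverse[OF s] G_inverse[OF t]
        G_fixes_const[OF s, of 0, simplified] G_fixes_const[OF t, of 0, simplified]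
        G_fixes_const[OF s, of 1, simplified] G_fixes_const[OF t, of 1, simplified])
  moreover have "K \<subseteq> ?F"
    by (auto simp: K_sub_L G_fixes_K[OF s] G_fixes_K[OF t])
  ultimately have "L \<subseteq> ?F"
    using comm sols_sub_L by (intro L_minimal) auto
  then show ?thesis
    using s t by (intro G_ext) (auto simp: G_mult_apply)
qed

text \<open>
  Analytic continuation comes as a relation between germs, which is defined beyond \<open>L\<close>. A one-to-one relation
  that respects the field operations and the derivation and fixes \<open>K\<close> carries solutions to solutions. As
  every solution has a partner on either side, the relation maps the generators of \<open>L\<close>, and so
  \<open>L\<close> itself, bijectively to \<open>L\<close>.
\<close>

lemma galois_element_of_correspondence:
  assumes add: "\<And>x x' y y'. S x y \<Longrightarrow> S x' y' \<Longrightarrow> S (x + x') (y + y')"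
    and mult: "\<And>x x' y y'. S x y \<Longrightarrow> S x' y' \<Longrightarrow> S (x * x') (y * y')"
    and uminus: "\<And>x y. S x y \<Longrightarrow> S (- x) (- y)"
    and inverse: "\<And>x y. S x y \<Longrightarrow> S (inverse x) (inverse y)"
    and deriv: "\<And>x y. S x y \<Longrightarrow> S (fls_deriv x) (fls_deriv y)"
    and fun1: "\<And>x y y'. S x y \<Longrightarrow> S x y' \<Longrightarrow> y = y'"
    and fun2: "\<And>x x' y. S x y \<Longrightarrow> S x' y \<Longrightarrow> x = x'"
    and fix_K: "\<And>k. k \<in> K \<Longrightarrow> S k k"
    and sols1: "\<And>x z. (x, z) \<in> sols \<Longrightarrow> (\<exists>y. S x y) \<and> (\<exists>y. S z y)"
    and sols2: "\<And>x z. (x, z) \<in> sols \<Longrightarrow> (\<exists>y. S y x) \<and> (\<exists>y. S y z)"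
  obtains \<sigma> where "\<sigma> \<in> carrier G" "\<And>x y. x \<in> L \<Longrightarrow> S x y \<Longrightarrow> \<sigma> x = y"
proof -
  let ?k = "fls_const th / germ t0 sin"
  have k: "?k \<in> K" unfolding divide_inverse
    by (intro subfield_mult subfield_inverse K_exp_is_subfield fls_const_in_K_exp germ_sin_in_K_exp)
  have k2: "- fls_const (u\<^sup>2) \<in> K" for u
    by (intro subfield_uminus K_exp_is_subfield fls_const_in_K_exp)
  have zero: "S 0 0" and one: "S 1 1"
    by (intro fix_K subfield_0 subfield_1 K_exp_is_subfield)+
  note L_ops = L_deriv subfield_0[OF L_subfield] subfield_1[OF L_subfield] subfield_add[OF L_subfield]
    subfield_mult[OF L_subfield] subfield_uminus[OF L_subfield] subfield_inverse[OF L_subfield]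
  \<comment> \<open>The correspondence transports solutions to solutions, in both directions.\<close>
  have fwd: "(x', z') \<in> sols" if xz: "(x, z) \<in> sols" "S x x'" "S z z'" for x z x' z'
  proof -
    have "S (fls_deriv (fls_deriv x)) (- fls_const (a\<^sup>2) * x')"
      unfolding VE2_D[OF xz(1)] by (intro mult fix_K k2 xz)
    moreover have "S (fls_deriv (fls_deriv z)) (- fls_const (c\<^sup>2) * z' + ?k * x'\<^sup>2)"
      unfolding VE2_D[OF xz(1)] power2_eq_square[of x] power2_eq_square[of x'] by (intro add mult fix_K k k2 xz)
    ultimately show ?thesis
      using fun1 deriv[OF deriv[OF xz(2)]] deriv[OF deriv[OF xz(3)]] unfolding VE2_def by blast
  qed
  have bwd: "(x, z) \<in> sols" if xz: "(x', z') \<in> sols" "S x x'" "S z z'" for x z x' z'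
  proof -
    have "S (- fls_const (a\<^sup>2) * x) (fls_deriv (fls_deriv x'))"
      unfolding VE2_D[OF xz(1)] by (intro mult fix_K k2 xz)
    moreover have "S (- fls_const (c\<^sup>2) * z + ?k * x\<^sup>2) (fls_deriv (fls_deriv z'))"
      unfolding VE2_D[OF xz(1)] power2_eq_square[of x] power2_eq_square[of x'] by (intro add mult fix_K k k2 xz)
    ultimately show ?thesis
      using fun2 deriv[OF deriv[OF xz(2)]] deriv[OF deriv[OF xz(3)]] unfolding VE2_def by blast
  qed
  have "is_diff_subfield {x. \<exists>y\<in>L. S x y}"
    by (rule is_diff_subfieldI) (blast intro: L_ops zero one add mult uminus inverse deriv)+
  moreover have "K \<subseteq> {x. \<exists>y\<in>L. S x y}" using fix_K K_sub_L by blast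
  ultimately have dom: "L \<subseteq> {x. \<exists>y\<in>L. S x y}"
    by (rule L_minimal) (use sols1 fwd sols_sub_L in blast)
  have "is_diff_subfield {y. \<exists>x\<in>L. S x y}"
    by (rule is_diff_subfieldI) (blast intro: L_ops zero one add mult uminus inverse deriv)+
  moreover have "K \<subseteq> {y. \<exists>x\<in>L. S x y}" using fix_K K_sub_L by blast
  ultimately have ran: "L \<subseteq> {y. \<exists>x\<in>L. S x y}"
    by (rule L_minimal) (use sols2 bwd sols_sub_L in blast)
  define \<sigma> where "\<sigma> = (\<lambda>x\<in>L. THE y. S x y)"
  have eq: "\<sigma> x = y" if "x \<in> L" "S x y" for x y
    unfolding \<sigma>_def using that fun1 by (auto intro!: the_equality)
  have S\<sigma>: "S x (\<sigma> x)" "\<sigma> x \<in> L" if "x \<in> L" for x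
    using dom that eq by blast+
  have "\<sigma> \<in> carrier G"
    unfolding G_carrier
  proof (intro conjI ballI)
    have "\<sigma> ` L = L" using ran eq S\<sigma> by blast
    moreover have "inj_on \<sigma> L" using S\<sigma> fun2 by (metis inj_onI)
    ultimately show "\<sigma> \<in> Bij L"
      by (auto simp: Bij_def bij_betw_def \<sigma>_def)
    fix x y assume "x \<in> L" "y \<in> L"
    then show "\<sigma> (x + y) = \<sigma> x + \<sigma> y" and "\<sigma> (x * y) = \<sigma> x * \<sigma> y"
      by (blast intro: eq add mult S\<sigma> L_ops)+
  next
    fix x assume "x \<in> L"
    then show "\<sigma> (fls_deriv x) = fls_deriv (\<sigma> x)"
      by (intro eq deriv S\<sigma> L_ops)
  next
    fix x assume "x \<in> K"
    then show "\<sigma> x = x"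
      by (intro eq fix_K K_sub_L)
  qed
  then show thesis using eq by (rule that)
qed

section \<open>The Zariski topology and the identity component\<close>

abbreviation "Zar \<equiv> zariski_topology W (carrier G)"

text \<open>
  The nonvanishing sets of polynomial functions are closed under finite intersections, since a
  product of functions vanishes only where a factor does. So they form a basis, not just a subbasis.
\<close>

lemma openin_zariski:
  "openin Zar U \<longleftrightarrow> U \<subseteq> carrier G \<and>
     (\<forall>\<sigma>\<in>U. \<exists>f\<in>polynomial_functions W. f \<sigma> \<noteq> 0 \<and> {\<tau> \<in> carrier G. f \<tau> \<noteq> 0} \<subseteq> U)"
proof
  assume "openin Zar U"
  then have "generate_topology_on {{\<sigma> \<in> carrier G. f \<sigma> \<noteq> 0} | f. f \<in> polynomial_functions W} U"
    unfolding zariski_topology_def by (rule openin_topology_generated_by)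
  then show "U \<subseteq> carrier G \<and>
     (\<forall>\<sigma>\<in>U. \<exists>f\<in>polynomial_functions W. f \<sigma> \<noteq> 0 \<and> {\<tau> \<in> carrier G. f \<tau> \<noteq> 0} \<subseteq> U)"
  proof induction
    case (Int U V)
    show ?case
    proof (intro conjI ballI)
      show "U \<inter> V \<subseteq> carrier G" using Int by blast
      fix \<sigma> assume "\<sigma> \<in> U \<inter> V"
      then obtain f g where f: "f \<in> polynomial_functions W" "f \<sigma> \<noteq> 0" "{\<tau> \<in> carrier G. f \<tau> \<noteq> 0} \<subseteq> U"
        and g: "g \<in> polynomial_functions W" "g \<sigma> \<noteq> 0" "{\<tau> \<in> carrier G. g \<tau> \<noteq> 0} \<subseteq> V"
        using Int by blast
      show "\<exists>f\<in>polynomial_functions W. f \<sigma> \<noteq> 0 \<and> {\<tau> \<in> carrier G. f \<tau> \<noteq> 0} \<subseteq> U \<inter> V"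
        by (rule bexI[OF _ polynomial_functions.mult[OF f(1) g(1)]]) (use f g in auto)
    qed
  next
    case (UN K)
    then show ?case by (blast elim!: ballE)
  qed auto
next
  assume U: "U \<subseteq> carrier G \<and>
     (\<forall>\<sigma>\<in>U. \<exists>f\<in>polynomial_functions W. f \<sigma> \<noteq> 0 \<and> {\<tau> \<in> carrier G. f \<tau> \<noteq> 0} \<subseteq> U)"
  show "openin Zar U"
  proof (subst openin_subopen, intro ballI)
    fix \<sigma> assume "\<sigma> \<in> U"
    with U obtain f where f: "f \<in> polynomial_functions W" "f \<sigma> \<noteq> 0" "{\<tau> \<in> carrier G. f \<tau> \<noteq> 0} \<subseteq> U"
      by blast
    have "openin Zar {\<tau> \<in> carrier G. f \<tau> \<noteq> 0}"
      unfolding zariski_topology_def by (rule topology_generated_by_Basis) (use f in blast)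
    then show "\<exists>V. openin Zar V \<and> \<sigma> \<in> V \<and> V \<subseteq> U"
      using f U \<open>\<sigma> \<in> U\<close> by blast
  qed
qed

lemma openin_nonvanishing:
  "f \<in> polynomial_functions W \<Longrightarrow> openin Zar {\<tau> \<in> carrier G. f \<tau> \<noteq> 0}"
  unfolding openin_zariski by blast

lemma topspace_zariski [simp]: "topspace Zar = carrier G"
proof
  show "topspace Zar \<subseteq> carrier G"
    using openin_topspace[of Zar] unfolding openin_zariski by blast
  have "openin Zar {\<tau> \<in> carrier G. (1::complex) \<noteq> 0}"
    by (rule openin_nonvanishing) (rule polynomial_functions.const)
  then show "carrier G \<subseteq> topspace Zar"
    using openin_subset by fastforce
qed

text \<open>
  A left translation replaces the functional in a matrix coefficient by its composition with \<open>g\<close>.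
\<close>

lemma polynomial_functions_translate:
  assumes g: "g \<in> carrier G" and f: "f \<in> polynomial_functions W"
  shows "\<exists>f'\<in>polynomial_functions W. \<forall>\<sigma>\<in>carrier G. f' \<sigma> = f (g \<otimes>\<^bsub>G\<^esub> \<sigma>)"
  using f
proof induction
  case (const k)
  show ?case by (rule bexI[OF _ polynomial_functions.const[of k]]) simp
next
  case (matrix_coeff w \<phi>)
  have "linear_functional_on W (\<lambda>v. \<phi> (g v))"
    using matrix_coeff(2) unfolding linear_functional_on_def
    by (simp add: G_add[OF g] G_scale[OF g] G_W[OF g] W_sub_L)
  then show ?case
    by (intro bexI[OF _ polynomial_functions.matrix_coeff[OF matrix_coeff(1)]])
      (auto simp: G_mult_apply[OF g] W_sub_L matrix_coeff(1))
next
  case (add f1 f2)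
  then obtain g1 g2 where "g1 \<in> polynomial_functions W" "g2 \<in> polynomial_functions W"
    "\<forall>\<sigma>\<in>carrier G. g1 \<sigma> = f1 (g \<otimes>\<^bsub>G\<^esub> \<sigma>)" "\<forall>\<sigma>\<in>carrier G. g2 \<sigma> = f2 (g \<otimes>\<^bsub>G\<^esub> \<sigma>)" by blast
  then show ?case by (intro bexI[OF _ polynomial_functions.add[of g1 W g2]]) auto
next
  case (mult f1 f2)
  then obtain g1 g2 where "g1 \<in> polynomial_functions W" "g2 \<in> polynomial_functions W"
    "\<forall>\<sigma>\<in>carrier G. g1 \<sigma> = f1 (g \<otimes>\<^bsub>G\<^esub> \<sigma>)" "\<forall>\<sigma>\<in>carrier G. g2 \<sigma> = f2 (g \<otimes>\<^bsub>G\<^esub> \<sigma>)" by blast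
  then show ?case by (intro bexI[OF _ polynomial_functions.mult[of g1 W g2]]) auto
qed

lemma continuous_map_translate:
  assumes g: "g \<in> carrier G"
  shows "continuous_map Zar Zar (\<lambda>\<sigma>. g \<otimes>\<^bsub>G\<^esub> \<sigma>)"
proof -
  interpret group G by (rule G_group)
  have "openin Zar {\<sigma> \<in> carrier G. g \<otimes>\<^bsub>G\<^esub> \<sigma> \<in> U}" if U: "openin Zar U" for U
    unfolding openin_zariski
  proof (intro conjI ballI)
    fix \<sigma> assume "\<sigma> \<in> {\<sigma> \<in> carrier G. g \<otimes>\<^bsub>G\<^esub> \<sigma> \<in> U}"
    then have \<sigma>: "\<sigma> \<in> carrier G" "g \<otimes>\<^bsub>G\<^esub> \<sigma> \<in> U" by auto
    then obtain f where f: "f \<in> polynomial_functions W" "f (g \<otimes>\<^bsub>G\<^esub> \<sigma>) \<noteq> 0"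
        "{\<tau> \<in> carrier G. f \<tau> \<noteq> 0} \<subseteq> U"
      using U unfolding openin_zariski by blast
    obtain f' where f': "f' \<in> polynomial_functions W" "\<forall>\<sigma>\<in>carrier G. f' \<sigma> = f (g \<otimes>\<^bsub>G\<^esub> \<sigma>)"
      using polynomial_functions_translate[OF g f(1)] by blast
    show "\<exists>f\<in>polynomial_functions W. f \<sigma> \<noteq> 0 \<and>
        {\<tau> \<in> carrier G. f \<tau> \<noteq> 0} \<subseteq> {\<sigma> \<in> carrier G. g \<otimes>\<^bsub>G\<^esub> \<sigma> \<in> U}"
      by (rule bexI[OF _ f'(1)]) (use f f' \<sigma> g in auto)
  qed auto
  then show ?thesis
    using g by (auto simp: continuous_map_def)
qed

lemma one_in_G0: "\<one>\<^bsub>G\<^esub> \<in> G0"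
proof -
  interpret group G by (rule G_group)
  show ?thesis by (simp add: identity_component_def connected_component_of_refl)
qed

lemma connectedin_G0: "connectedin Zar G0"
  unfolding identity_component_def by (rule connectedin_connected_component_of)

lemma G0_sub_G: "G0 \<subseteq> carrier G"
  using connectedin_subset_topspace[OF connectedin_G0] by simp

lemma connectedin_sub_G0: "connectedin Zar C \<Longrightarrow> \<one>\<^bsub>G\<^esub> \<in> C \<Longrightarrow> C \<subseteq> G0"
  unfolding identity_component_def by (rule connected_component_of_maximal)

text \<open>
  Multiplication is continuous in each variable only, but left translations are enough: \<open>inv g G0\<close> and
  \<open>g G0\<close> are connected and contain the unit for \<open>g\<close> in \<open>G0\<close>.
\<close>

lemma G0_subgroup: "subgroup G0 G"
proof -
  interpret group G by (rule G_group)
  have tr: "connectedin Zar ((\<lambda>\<sigma>. g \<otimes>\<^bsub>G\<^esub> \<sigma>) ` G0)" if "g \<in> carrier G" for g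
    by (rule connectedin_continuous_map_image[OF continuous_map_translate[OF that] connectedin_G0])
  have inv: "inv\<^bsub>G\<^esub> g \<in> G0" if g: "g \<in> G0" for g
  proof -
    have gG: "g \<in> carrier G" using g G0_sub_G by blast
    have "\<one>\<^bsub>G\<^esub> \<in> (\<lambda>\<sigma>. inv\<^bsub>G\<^esub> g \<otimes>\<^bsub>G\<^esub> \<sigma>) ` G0"
      by (rule image_eqI[OF _ g]) (simp add: gG)
    moreover have "inv\<^bsub>G\<^esub> g \<in> (\<lambda>\<sigma>. inv\<^bsub>G\<^esub> g \<otimes>\<^bsub>G\<^esub> \<sigma>) ` G0"
      by (rule image_eqI[OF _ one_in_G0]) (simp add: gG)
    ultimately show ?thesis
      using connectedin_sub_G0[OF tr[OF inv_closed[OF gG]]] by blast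
  qed
  have mult: "g \<otimes>\<^bsub>G\<^esub> h \<in> G0" if g: "g \<in> G0" and h: "h \<in> G0" for g h
  proof -
    have gG: "g \<in> carrier G" using g G0_sub_G by blast
    have "\<one>\<^bsub>G\<^esub> \<in> (\<lambda>\<sigma>. g \<otimes>\<^bsub>G\<^esub> \<sigma>) ` G0"
      by (rule image_eqI[OF _ inv[OF g]]) (simp add: gG)
    then show ?thesis
      using connectedin_sub_G0[OF tr[OF gG]] h by blast
  qed
  show ?thesis
    by (rule subgroupI) (use G0_sub_G one_in_G0 inv mult in auto)
qed

lemma virtually_abelian_iff:
  "virtually_abelian W G \<longleftrightarrow> (\<forall>\<sigma>\<in>G0. \<forall>\<tau>\<in>G0. \<sigma> \<otimes>\<^bsub>G\<^esub> \<tau> = \<tau> \<otimes>\<^bsub>G\<^esub> \<sigma>)"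
proof
  assume "virtually_abelian W G"
  then interpret comm_group "G\<lparr>carrier := G0\<rparr>"
    unfolding virtually_abelian_def .
  show "\<forall>\<sigma>\<in>G0. \<forall>\<tau>\<in>G0. \<sigma> \<otimes>\<^bsub>G\<^esub> \<tau> = \<tau> \<otimes>\<^bsub>G\<^esub> \<sigma>"
    using m_comm by simp
next
  assume comm: "\<forall>\<sigma>\<in>G0. \<forall>\<tau>\<in>G0. \<sigma> \<otimes>\<^bsub>G\<^esub> \<tau> = \<tau> \<otimes>\<^bsub>G\<^esub> \<sigma>"
  have "group (G\<lparr>carrier := G0\<rparr>)"
    by (rule subgroup.subgroup_is_group[OF G0_subgroup G_group])
  then show "virtually_abelian W G"
    unfolding virtually_abelian_def
    by (rule group.group_comm_groupI) (use comm in simp)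
qed

text \<open>
  Under the hypothesis any two nonempty relatively open subsets of the set of powers intersect, so
  this set, which contains the unit and \<open>\<sigma>\<close>, is connected.
\<close>

lemma irreducible_powers_in_G0:
  assumes \<sigma>: "\<sigma> \<in> carrier G"
    and irr: "\<And>f g i j. f \<in> polynomial_functions W \<Longrightarrow> g \<in> polynomial_functions W \<Longrightarrow>
      f (\<sigma> [^]\<^bsub>G\<^esub> (i::nat)) \<noteq> 0 \<Longrightarrow> g (\<sigma> [^]\<^bsub>G\<^esub> (j::nat)) \<noteq> 0 \<Longrightarrow>
      \<exists>k::nat. f (\<sigma> [^]\<^bsub>G\<^esub> k) \<noteq> 0 \<and> g (\<sigma> [^]\<^bsub>G\<^esub> k) \<noteq> 0"
  shows "\<sigma> \<in> G0"
proof -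
  interpret group G by (rule G_group)
  let ?C = "range (\<lambda>k::nat. \<sigma> [^]\<^bsub>G\<^esub> k)"
  have C: "?C \<subseteq> carrier G" using \<sigma> by auto
  have "connectedin Zar ?C"
    unfolding connectedin
  proof (intro conjI notI)
    show "?C \<subseteq> topspace Zar" using C by simp
    assume "\<exists>E1 E2. openin Zar E1 \<and> openin Zar E2 \<and> ?C \<subseteq> E1 \<union> E2 \<and> E1 \<inter> E2 \<inter> ?C = {} \<and>
      E1 \<inter> ?C \<noteq> {} \<and> E2 \<inter> ?C \<noteq> {}"
    then obtain E1 E2 i j where E: "openin Zar E1" "openin Zar E2" "E1 \<inter> E2 \<inter> ?C = {}"
      and ij: "\<sigma> [^]\<^bsub>G\<^esub> (i::nat) \<in> E1" "\<sigma> [^]\<^bsub>G\<^esub> (j::nat) \<in> E2" by blast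
    obtain f where f: "f \<in> polynomial_functions W" "f (\<sigma> [^]\<^bsub>G\<^esub> i) \<noteq> 0" "{\<tau> \<in> carrier G. f \<tau> \<noteq> 0} \<subseteq> E1"
      using E(1) ij(1) unfolding openin_zariski by blast
    obtain g where g: "g \<in> polynomial_functions W" "g (\<sigma> [^]\<^bsub>G\<^esub> j) \<noteq> 0" "{\<tau> \<in> carrier G. g \<tau> \<noteq> 0} \<subseteq> E2"
      using E(2) ij(2) unfolding openin_zariski by blast
    obtain k::nat where "f (\<sigma> [^]\<^bsub>G\<^esub> k) \<noteq> 0" "g (\<sigma> [^]\<^bsub>G\<^esub> k) \<noteq> 0"
      using irr f g by blast
    then have "\<sigma> [^]\<^bsub>G\<^esub> k \<in> E1 \<inter> E2 \<inter> ?C"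
      using f g \<sigma> by auto
    then show False using E by blast
  qed
  moreover have "\<one>\<^bsub>G\<^esub> \<in> ?C" by (rule range_eqI[of _ _ 0]) simp
  moreover have "\<sigma> \<in> ?C" by (rule range_eqI[of _ _ 1]) (simp add: \<sigma>)
  ultimately show ?thesis using connectedin_sub_G0 by blast
qed

end

section \<open>Exponential polynomials\<close>

lemma polynomial_vanishes_on_nat:
  fixes p :: "complex poly"
  assumes "\<And>k::nat. poly p (of_nat k) = 0"
  shows "p = 0"
proof (rule ccontr)
  assume "p \<noteq> 0"
  then have "finite {x. poly p x = 0}" by (rule poly_roots_finite)
  moreover have "range (of_nat :: nat \<Rightarrow> complex) \<subseteq> {x. poly p x = 0}" using assms by auto
  ultimately have "finite (range (of_nat :: nat \<Rightarrow> complex))" by (rule rev_finite_subset)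
  then show False
    using range_inj_infinite[of "of_nat :: nat \<Rightarrow> complex"] by (simp add: inj_of_nat)
qed

text \<open>
  The operator \<open>f(k) \<mapsto> f(k + 1) - \<mu>0 f(k)\<close> lowers the degree of the coefficient of \<open>\<mu>0\<^sup>k\<close>
  and preserves the degrees of the other coefficients. By induction on the total degree these others vanish,
  and what remains is a single polynomial with infinitely many zeros.
\<close>

lemma exponentials_independent:
  fixes p :: "complex \<Rightarrow> complex poly"
  assumes fin: "finite \<Lambda>" and nz: "0 \<notin> \<Lambda>"
    and eq: "\<And>k::nat. (\<Sum>\<mu>\<in>\<Lambda>. poly (p \<mu>) (of_nat k) * \<mu> ^ k) = 0"
    and "\<mu> \<in> \<Lambda>"
  shows "p \<mu> = 0"
proof -
  define wt :: "complex poly \<Rightarrow> nat" where "wt q = (if q = 0 then 0 else Suc (degree q))" for q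
  have "\<forall>\<mu>\<in>\<Lambda>. p \<mu> = 0"
    using eq
  proof (induction "\<Sum>\<mu>\<in>\<Lambda>. wt (p \<mu>)" arbitrary: p rule: less_induct)
    case (less p)
    show ?case
    proof (rule ccontr)
      assume "\<not> (\<forall>\<mu>\<in>\<Lambda>. p \<mu> = 0)"
      then obtain \<mu>0 where \<mu>0: "\<mu>0 \<in> \<Lambda>" "p \<mu>0 \<noteq> 0" by blast
      define p' where "p' \<mu> = smult \<mu> (p \<mu> \<circ>\<^sub>p [:1, 1:]) - smult \<mu>0 (p \<mu>)" for \<mu>
      have deg: "degree (p' \<mu>) \<le> degree (p \<mu>)" for \<mu>
        unfolding p'_def
        by (rule degree_diff_le) (auto intro: order_trans[OF degree_smult_le] simp: degree_pcompose)
      \<comment> \<open>The leading coefficient is multiplied by \<open>\<mu> - \<mu>0\<close>, so it disappears only for \<open>\<mu>0\<close>.\<close>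
      have lc: "coeff (p' \<mu>) (degree (p \<mu>)) = (\<mu> - \<mu>0) * lead_coeff (p \<mu>)" for \<mu>
      proof -
        have "coeff (p \<mu> \<circ>\<^sub>p [:1, 1:]) (degree (p \<mu>)) = lead_coeff (p \<mu>)"
          using lead_coeff_comp[of "[:1, 1::complex:]" "p \<mu>"] by (simp add: degree_pcompose)
        then show ?thesis by (simp add: p'_def algebra_simps)
      qed
      have wt_le: "wt (p' \<mu>) \<le> wt (p \<mu>)" for \<mu>
        using deg[of \<mu>] by (auto simp: wt_def p'_def)
      have wt_less: "wt (p' \<mu>0) < wt (p \<mu>0)"
      proof (cases "p' \<mu>0 = 0")
        case False
        then have "degree (p' \<mu>0) \<noteq> degree (p \<mu>0)"
          using lc[of \<mu>0] by (metis diff_self leading_coeff_0_iff mult_zero_left)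
        then show ?thesis using deg[of \<mu>0] False \<mu>0 by (simp add: wt_def)
      qed (simp add: wt_def \<mu>0)
      have "(\<Sum>\<mu>\<in>\<Lambda>. wt (p' \<mu>)) < (\<Sum>\<mu>\<in>\<Lambda>. wt (p \<mu>))"
        by (rule sum_strict_mono_ex1[OF fin]) (use wt_le wt_less \<mu>0 in auto)
      moreover have "(\<Sum>\<mu>\<in>\<Lambda>. poly (p' \<mu>) (of_nat k) * \<mu> ^ k) = 0" for k :: nat
      proof -
        have "(\<Sum>\<mu>\<in>\<Lambda>. poly (p' \<mu>) (of_nat k) * \<mu> ^ k) =
            (\<Sum>\<mu>\<in>\<Lambda>. poly (p \<mu>) (of_nat (Suc k)) * \<mu> ^ Suc k - \<mu>0 * (poly (p \<mu>) (of_nat k) * \<mu> ^ k))"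
          by (rule sum.cong) (simp_all add: p'_def poly_pcompose algebra_simps)
        also have "\<dots> = (\<Sum>\<mu>\<in>\<Lambda>. poly (p \<mu>) (of_nat (Suc k)) * \<mu> ^ Suc k)
            - \<mu>0 * (\<Sum>\<mu>\<in>\<Lambda>. poly (p \<mu>) (of_nat k) * \<mu> ^ k)"
          by (simp only: sum_subtractf sum_distrib_left)
        also have "\<dots> = 0" by (simp only: less.prems mult_zero_right diff_zero)
        finally show ?thesis .
      qed
      ultimately have p'0: "\<forall>\<mu>\<in>\<Lambda>. p' \<mu> = 0" by (rule less.hyps)
      have "p \<mu> = 0" if "\<mu> \<in> \<Lambda>" "\<mu> \<noteq> \<mu>0" for \<mu>
        using lc[of \<mu>] p'0 that by auto
      then have "poly (p \<mu>0) (of_nat k) * \<mu>0 ^ k = 0" for k :: nat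
        using less.prems[of k] \<mu>0(1) fin
        by (subst (asm) sum.remove[OF fin \<mu>0(1)]) auto
      then have "poly (p \<mu>0) (of_nat k) = 0" for k :: nat
        using nz \<mu>0(1) by (metis mult_eq_0_iff power_not_zero)
      then show False using \<mu>0(2) polynomial_vanishes_on_nat by blast
    qed
  qed
  then show ?thesis using assms(4) by blast
qed

definition e2pi :: "complex \<Rightarrow> complex" where
  "e2pi m = exp (2 * pi * \<i> * m)"

lemma e2pi_add: "e2pi (m + m') = e2pi m * e2pi m'"
  by (simp add: e2pi_def ring_distribs exp_add)

lemma e2pi_nonzero [simp]: "e2pi m \<noteq> 0"
  by (simp add: e2pi_def)

lemma e2pi_0 [simp]: "e2pi 0 = 1"
  by (simp add: e2pi_def)

lemma e2pi_of_nat_mult: "e2pi (m * of_nat k) = e2pi m ^ k"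
  by (induction k) (simp_all add: ring_distribs e2pi_add)

lemma e2pi_eq_1_iff: "e2pi m = 1 \<longleftrightarrow> m \<in> \<int>"
proof -
  have "e2pi m = 1 \<longleftrightarrow> (\<exists>n::int. m = of_int n)"
    unfolding e2pi_def exp_eq_1 by (auto simp: complex_eq_iff field_simps)
  then show ?thesis by (auto elim: Ints_cases)
qed

lemma e2pi_eq_iff: "e2pi m = e2pi m' \<longleftrightarrow> m - m' \<in> \<int>"
  using e2pi_add[of "m - m'" m'] e2pi_eq_1_iff[of "m - m'"] by auto

lemma e2pi_holomorphic [holomorphic_intros]:
  "f holomorphic_on A \<Longrightarrow> (\<lambda>s. e2pi (f s)) holomorphic_on A"
  unfolding e2pi_def by (intro holomorphic_intros)

text \<open>
  Exponential polynomials are taken as functions on \<open>\<complex>\<close> rather than on the natural numbers, in order that the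
  identity theorem applies to them.
\<close>

inductive_set exp_poly :: "complex set \<Rightarrow> (complex \<Rightarrow> complex) set" for M where
  zero: "(\<lambda>_. 0) \<in> exp_poly M"
| step: "F \<in> exp_poly M \<Longrightarrow> m \<in> M \<Longrightarrow>
    (\<lambda>s. F s + k * s ^ j * e2pi (m * s)) \<in> exp_poly M"

lemma exp_poly_monomial: "m \<in> M \<Longrightarrow> (\<lambda>s. k * s ^ j * e2pi (m * s)) \<in> exp_poly M"
  using exp_poly.step[OF exp_poly.zero, of m M k j] by simp

lemma exp_poly_add:
  assumes F: "F \<in> exp_poly M" and "G \<in> exp_poly M"
  shows "(\<lambda>s. F s + G s) \<in> exp_poly M"
  using assms(2)
proof induction
  case (step G m k j)
  show ?case using exp_poly.step[OF step.IH step.hyps(2), of k j] by (simp add: add.assoc)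
qed (use F in simp)

lemma exp_poly_cmult:
  assumes "F \<in> exp_poly M"
  shows "(\<lambda>s. u * F s) \<in> exp_poly M"
  using assms
proof induction
  case (step G m k j)
  show ?case using exp_poly.step[OF step.IH step.hyps(2), of "u * k" j] by (simp add: algebra_simps)
qed (simp add: exp_poly.zero)

lemma exp_poly_sum:
  "(\<And>i. i \<in> I \<Longrightarrow> F i \<in> exp_poly M) \<Longrightarrow> (\<lambda>s. \<Sum>i\<in>I. F i s) \<in> exp_poly M"
  by (induction I rule: infinite_finite_induct) (auto intro: exp_poly.zero exp_poly_add)

lemma exp_poly_mult:
  assumes M: "\<And>m m'. m \<in> M \<Longrightarrow> m' \<in> M \<Longrightarrow> m + m' \<in> M"
    and F: "F \<in> exp_poly M" and G: "G \<in> exp_poly M"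
  shows "(\<lambda>s. F s * G s) \<in> exp_poly M"
proof -
  have *: "(\<lambda>s. F s * (k * s ^ j * e2pi (m * s))) \<in> exp_poly M" if m: "m \<in> M" for m k j
    using F
  proof induction
    case (step F m' k' j')
    show ?case
      using exp_poly.step[OF step.IH M[OF step.hyps(2) m], of "k * k'" "j + j'"]
      by (simp add: algebra_simps e2pi_add power_add)
  qed (simp add: exp_poly.zero)
  show ?thesis
    using G
  proof induction
    case (step G m k j)
    show ?case
      using exp_poly_add[OF step.IH *[OF step.hyps(2), of k j]] by (simp add: algebra_simps)
  qed (simp add: exp_poly.zero)
qed

lemma exp_poly_holomorphic: "F \<in> exp_poly M \<Longrightarrow> F holomorphic_on A"
  by (induction rule: exp_poly.induct) (auto intro!: holomorphic_intros)

lemma exp_poly_normal_form: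
  assumes "F \<in> exp_poly M"
  shows "\<exists>S p. finite S \<and> S \<subseteq> M \<and> F = (\<lambda>s. \<Sum>m\<in>S. poly (p m) s * e2pi (m * s))"
  using assms
proof induction
  case zero
  show ?case by (rule exI[of _ "{}"]) simp
next
  case (step F m k j)
  then obtain S p where S: "finite S" "S \<subseteq> M" and F: "F = (\<lambda>s. \<Sum>m\<in>S. poly (p m) s * e2pi (m * s))"
    by blast
  define p' where "p' m' = (if m' \<in> S then p m' else 0) + (if m' = m then monom k j else 0)" for m'
  have "(\<Sum>m\<in>insert m S. poly (p' m) s * e2pi (m * s)) = F s + k * s ^ j * e2pi (m * s)" for s
  proof -
    have "(\<Sum>m\<in>insert m S. poly (p' m) s * e2pi (m * s)) =
       (\<Sum>m'\<in>insert m S. if m' \<in> S then poly (p m') s * e2pi (m' * s) else 0)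
       + (\<Sum>m'\<in>insert m S. if m' = m then poly (monom k j) s * e2pi (m' * s) else 0)"
      unfolding sum.distrib[symmetric] by (rule sum.cong) (auto simp: p'_def algebra_simps)
    also have "(\<Sum>m'\<in>insert m S. if m' \<in> S then poly (p m') s * e2pi (m' * s) else 0) = F s"
      unfolding F by (rule sum.mono_neutral_cong_right) (use S in auto)
    also have "(\<Sum>m'\<in>insert m S. if m' = m then poly (monom k j) s * e2pi (m' * s) else 0)
        = k * s ^ j * e2pi (m * s)"
      using S by (simp add: sum.delta poly_monom)
    finally show ?thesis .
  qed
  then show ?case
    using S step.hyps by (intro exI[of _ "insert m S"] exI[of _ p']) auto
qed

text \<open>
  Groups of exponents on which \<open>m \<mapsto> exp (2 \<pi> \<i> m)\<close> is injective. They serve as a choice of logarithms that is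
  compatible with multiplication of eigenvalues.
\<close>

locale exponents =
  fixes M :: "complex set"
  assumes M_0: "0 \<in> M"
    and M_add: "m \<in> M \<Longrightarrow> m' \<in> M \<Longrightarrow> m + m' \<in> M"
    and M_uminus: "m \<in> M \<Longrightarrow> - m \<in> M"
    and M_Ints: "m \<in> M \<Longrightarrow> m \<in> \<int> \<Longrightarrow> m = 0"

begin

lemma M_diff: "m \<in> M \<Longrightarrow> m' \<in> M \<Longrightarrow> m - m' \<in> M"
  using M_add[of m "- m'"] M_uminus[of m'] by simp

text \<open>
  On the natural numbers distinct exponents in \<open>M\<close> give distinct bases \<open>exp (2 \<pi> \<i> m)\<close>, so
  linear independence of the sequences \<open>k\<^sup>j \<mu>\<^sup>k\<close> applies.
\<close>

lemma exp_poly_vanishes_on_nat: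
  assumes F: "F \<in> exp_poly M" and zero: "\<And>k::nat. F (of_nat k) = 0"
  shows "F s = 0"
proof -
  obtain S p where S: "finite S" "S \<subseteq> M" and F: "F = (\<lambda>s. \<Sum>m\<in>S. poly (p m) s * e2pi (m * s))"
    using exp_poly_normal_form[OF F] by blast
  have inj: "inj_on e2pi S"
  proof (rule inj_onI)
    fix m m' assume m: "m \<in> S" "m' \<in> S" "e2pi m = e2pi m'"
    then have "m - m' \<in> \<int>" "m - m' \<in> M" using S(2) M_diff by (auto simp: e2pi_eq_iff)
    then show "m = m'" using M_Ints by force
  qed
  define q where "q = p \<circ> the_inv_into S e2pi"
  have q: "q (e2pi m) = p m" if "m \<in> S" for m
    using that by (simp add: q_def the_inv_into_f_f[OF inj])
  have "(\<Sum>\<mu>\<in>e2pi ` S. poly (q \<mu>) (of_nat k) * \<mu> ^ k) = 0" for k :: nat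
  proof -
    have "(\<Sum>\<mu>\<in>e2pi ` S. poly (q \<mu>) (of_nat k) * \<mu> ^ k) = (\<Sum>m\<in>S. poly (q (e2pi m)) (of_nat k) * e2pi m ^ k)"
      by (rule sum.reindex[OF inj, unfolded o_def])
    also have "\<dots> = F (of_nat k)"
      unfolding F by (rule sum.cong) (simp_all add: q e2pi_of_nat_mult)
    finally show ?thesis using zero by simp
  qed
  then have "q \<mu> = 0" if "\<mu> \<in> e2pi ` S" for \<mu>
    by (rule exponentials_independent[rotated 2]) (use S that in auto)
  then have "p m = 0" if "m \<in> S" for m
    using q that by force
  then show ?thesis unfolding F by simp
qed

text \<open>
  If the sequences \<open>F\<close> and \<open>G\<close> had no common point of nonvanishing, the entire function \<open>F G\<close> would be 0,
  and so would be one of its factors.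
\<close>

lemma exp_poly_no_zero_divisors:
  assumes F: "F \<in> exp_poly M" and G: "G \<in> exp_poly M" and "F (of_nat i) \<noteq> 0" "G (of_nat j) \<noteq> 0"
  shows "\<exists>k::nat. F (of_nat k) \<noteq> 0 \<and> G (of_nat k) \<noteq> 0"
proof (rule ccontr)
  assume "\<not> ?thesis"
  then have FG: "F s * G s = 0" for s
    using exp_poly_vanishes_on_nat[OF exp_poly_mult[OF M_add F G]] by auto
  have cont: "continuous_on UNIV F"
    using exp_poly_holomorphic[OF F] by (rule holomorphic_on_imp_continuous_on)
  have op: "open {s. F s \<noteq> 0}"
    by (rule open_Collect_neq[OF cont continuous_on_const])
  have "G s = 0" for s
    by (rule analytic_continuation_open[OF op open_UNIV _ connected_UNIV _ exp_poly_holomorphic[OF G]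
        holomorphic_on_const])
      (use FG assms(3) in auto)
  then show False using assms(4) by blast
qed

text \<open>
  Substituting \<open>s\<^sup>j \<mu>\<^sup>s\<close> in the left side gives \<open>(\<mu> - \<mu>0) s\<^sup>j \<mu>\<^sup>s\<close> plus terms of lower degree. In the
  resonant case \<open>\<mu> = \<mu>0\<close> the next higher power of \<open>s\<close> takes this role. The lower terms are removed by induction.
\<close>

lemma exp_poly_recurrence_monomial:
  assumes "m0 \<in> M" "m \<in> M"
  shows "\<exists>P\<in>exp_poly M. \<forall>s. P (s + 1) - e2pi m0 * P s = s ^ j * e2pi (m * s)"
proof (induction j rule: less_induct)
  case (less j)
  define e :: "complex \<Rightarrow> complex" where "e = (\<lambda>s. e2pi (m * s))"
  define \<mu> \<mu>0 :: complex where "\<mu> = e2pi m" and "\<mu>0 = e2pi m0"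
  have e1: "e (s + 1) = \<mu> * e s" for s
    by (simp add: e_def \<mu>_def ring_distribs e2pi_add mult.commute)
  have nz: "\<mu> \<noteq> 0" by (simp add: \<mu>_def)
  obtain Q where Q: "\<And>i. i < j \<Longrightarrow> Q i \<in> exp_poly M"
    "\<And>i s. i < j \<Longrightarrow> Q i (s + 1) - \<mu>0 * Q i s = s ^ i * e s"
    using less.IH unfolding e_def \<mu>0_def by metis
  define R where "R n = (\<lambda>s. \<Sum>i<j. of_nat (n choose i) * Q i s)" for n :: nat
  have R: "R n \<in> exp_poly M" for n
    unfolding R_def by (intro exp_poly_sum exp_poly_cmult Q) simp
  have R1: "R n (s + 1) - \<mu>0 * R n s = (\<Sum>i<j. of_nat (n choose i) * s ^ i) * e s" for n s
  proof -
    have "R n (s + 1) - \<mu>0 * R n s = (\<Sum>i<j. of_nat (n choose i) * (Q i (s + 1) - \<mu>0 * Q i s))"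
      unfolding R_def by (simp add: sum_distrib_left sum_subtractf algebra_simps)
    also have "\<dots> = (\<Sum>i<j. of_nat (n choose i) * (s ^ i * e s))"
      by (rule sum.cong) (simp_all add: Q)
    finally show ?thesis by (simp add: sum_distrib_right mult.assoc)
  qed
  have mon: "(\<lambda>s. u * s ^ n * e s) \<in> exp_poly M" for u n
    unfolding e_def by (rule exp_poly_monomial[OF assms(2)])
  show ?case
  proof (cases "\<mu> = \<mu>0")
    case False
    let ?P = "\<lambda>s. 1 / (\<mu> - \<mu>0) * (1 * s ^ j * e s + - \<mu> * R j s)"
    have "?P \<in> exp_poly M"
      by (intro exp_poly_cmult exp_poly_add mon R)
    moreover have "?P (s + 1) - \<mu>0 * ?P s = s ^ j * e s" for s
    proof -
      have bin: "(s + 1) ^ j = (\<Sum>i<j. of_nat (j choose i) * s ^ i) + s ^ j"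
        using binomial_ring[of s 1 j] by (simp add: lessThan_Suc_atMost[symmetric])
      have "?P (s + 1) - \<mu>0 * ?P s = 1 / (\<mu> - \<mu>0) * ((s + 1) ^ j * (\<mu> * e s) - \<mu>0 * s ^ j * e s
          - \<mu> * (R j (s + 1) - \<mu>0 * R j s))"
        unfolding e1 by (simp add: algebra_simps)
      also have "\<dots> = 1 / (\<mu> - \<mu>0) * ((\<mu> - \<mu>0) * (s ^ j * e s))"
        unfolding R1 bin by (simp add: algebra_simps)
      finally show ?thesis using False by simp
    qed
    ultimately show ?thesis unfolding e_def \<mu>0_def by (intro bexI) auto
  next
    case True
    let ?P = "\<lambda>s. 1 / of_nat (Suc j) * (1 / \<mu> * s ^ Suc j * e s + - 1 * R (Suc j) s)"
    have "?P \<in> exp_poly M"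
      by (intro exp_poly_cmult exp_poly_add mon R)
    moreover have "?P (s + 1) - \<mu>0 * ?P s = s ^ j * e s" for s
    proof -
      have bin: "(s + 1) ^ Suc j = (\<Sum>i<j. of_nat (Suc j choose i) * s ^ i) + of_nat (Suc j) * s ^ j + s ^ Suc j"
        using binomial_ring[of s 1 "Suc j"] by (simp add: lessThan_Suc_atMost[symmetric] del: power_Suc)
      have "?P (s + 1) - \<mu>0 * ?P s = 1 / of_nat (Suc j) * ((s + 1) ^ Suc j * e s - s ^ Suc j * e s
          - (R (Suc j) (s + 1) - \<mu>0 * R (Suc j) s))"
        unfolding e1 True[symmetric] using nz by (simp add: algebra_simps del: power_Suc of_nat_Suc)
      also have "\<dots> = 1 / of_nat (Suc j) * (of_nat (Suc j) * s ^ j * e s)"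
        unfolding R1 bin by (simp add: algebra_simps del: power_Suc of_nat_Suc)
      finally show ?thesis by (simp del: of_nat_Suc)
    qed
    ultimately show ?thesis unfolding e_def \<mu>0_def by (intro bexI) auto
  qed
qed

lemma exp_poly_recurrence:
  fixes f :: "nat \<Rightarrow> complex"
  assumes m0: "m0 \<in> M" and F: "F \<in> exp_poly M"
    and f: "\<And>k. f (Suc k) - e2pi m0 * f k = F (of_nat k)"
  shows "\<exists>H\<in>exp_poly M. \<forall>k. f k = H (of_nat k)"
proof -
  have "\<exists>P\<in>exp_poly M. \<forall>s. P (s + 1) - e2pi m0 * P s = F s"
    using F
  proof induction
    case zero
    show ?case by (rule bexI[OF _ exp_poly.zero]) simp
  next
    case (step F m k j)
    then obtain P where P: "P \<in> exp_poly M" "\<And>s. P (s + 1) - e2pi m0 * P s = F s" by blast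
    obtain Q where Q: "Q \<in> exp_poly M"
      "\<And>s. Q (s + 1) - e2pi m0 * Q s = s ^ j * e2pi (m * s)"
      using exp_poly_recurrence_monomial[OF m0 step.hyps(2)] by blast
    have "P (s + 1) + k * Q (s + 1) - e2pi m0 * (P s + k * Q s)
        = F s + k * s ^ j * e2pi (m * s)" for s
    proof -
      have "P (s + 1) + k * Q (s + 1) - e2pi m0 * (P s + k * Q s)
          = (P (s + 1) - e2pi m0 * P s) + k * (Q (s + 1) - e2pi m0 * Q s)"
        by (simp add: algebra_simps)
      then show ?thesis by (simp only: P Q mult.assoc)
    qed
    then show ?case by (intro bexI[OF _ exp_poly_add[OF P(1) exp_poly_cmult[OF Q(1)]]]) auto
  qed
  then obtain P where P: "P \<in> exp_poly M" "\<And>s. P (s + 1) - e2pi m0 * P s = F s" by blast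
  let ?r = "f 0 - P 0"
  let ?H = "\<lambda>s. P s + ?r * s ^ 0 * e2pi (m0 * s)"
  have "f k = ?H (of_nat k)" for k
  proof (induction k)
    case (Suc k)
    have "f (Suc k) = e2pi m0 * f k + F (of_nat k)" using f[of k] by (simp add: algebra_simps)
    also have "F (of_nat k) = P (of_nat k + 1) - e2pi m0 * P (of_nat k)" by (rule P(2)[symmetric])
    finally show ?case unfolding Suc by (simp add: algebra_simps e2pi_add)
  qed simp
  then show ?thesis by (intro bexI[OF _ exp_poly.step[OF P(1) m0]] allI)
qed

end

lemma rational_vector_space: "vector_space (\<lambda>(q::rat) (z::complex). of_rat q * z)"
proof
  fix a b :: rat and x y :: complex
  show "of_rat a * (x + y) = of_rat a * x + of_rat a * y" by (rule distrib_left)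
  show "of_rat (a + b) * x = of_rat a * x + of_rat b * x" by (simp only: of_rat_add distrib_right)
  show "of_rat a * (of_rat b * x) = of_rat (a * b) * x" by (simp only: of_rat_mult mult.assoc)
  show "of_rat 1 * x = x" by simp
qed

text \<open>
  Let \<open>r\<close> be the coordinate at 1 with respect to a basis of \<open>\<complex>\<close> over \<open>\<rat>\<close> that contains 1. Its kernel \<open>M\<close>
  meets \<open>\<rat>\<close> only in 0, and \<open>x - r x\<close> lies in \<open>M\<close> for every \<open>x\<close>. So \<open>N\<close> has to make \<open>N r a\<close> and
  \<open>N r c\<close> integers.
\<close>

lemma exponents_exist:
  fixes a c :: complex
  obtains M and N :: nat where "exponents M" "N > 0"
    "\<exists>k\<in>\<int>. of_nat N * a - k \<in> M" "\<exists>k\<in>\<int>. of_nat N * c - k \<in> M"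
proof -
  interpret Q: vector_space "\<lambda>(q::rat) (z::complex). of_rat q * z"
    by (rule rational_vector_space)
  define B where "B = Q.extend_basis {1}"
  have ind1: "Q.independent {1}" by simp
  have B: "Q.independent B" "Q.span B = UNIV" "1 \<in> B"
    using Q.independent_extend_basis[OF ind1] Q.span_extend_basis[OF ind1] Q.extend_basis_superset[OF ind1]
    by (auto simp: B_def)
  define r where "r z = Q.representation B z 1" for z
  have r_add: "r (x + y) = r x + r y" for x y
    unfolding r_def by (subst Q.representation_add) (use B in auto)
  have r_scale: "r (of_rat q * x) = q * r x" for q x
    unfolding r_def by (subst Q.representation_scale) (use B in auto)
  have r_1: "r 1 = 1" unfolding r_def by (subst Q.representation_basis) (use B in auto)
  have r_rat: "r (of_rat q) = q" for q using r_scale[of q 1] r_1 by simp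
  have r_uminus: "r (- x) = - r x" for x using r_scale[of "-1" x] by (simp add: of_rat_minus)
  have ex: "exponents {z. r z = 0}"
  proof
    show "m = 0" if "m \<in> {z. r z = 0}" "m \<in> \<int>" for m
    proof -
      obtain k where k: "m = of_int k" using \<open>m \<in> \<int>\<close> by (rule Ints_cases)
      then have "m = of_rat (of_int k)" by simp
      with that(1) have "of_int k = (0::rat)" using r_rat by (metis mem_Collect_eq)
      then show ?thesis using k by simp
    qed
    show "0 \<in> {z. r z = 0}" using r_rat[of 0] by simp
  qed (auto simp: r_add r_uminus)
  obtain p1 n1 where 1: "quotient_of (r a) = (p1, n1)" by force
  obtain p2 n2 where 2: "quotient_of (r c) = (p2, n2)" by force
  have n: "n1 > 0" "n2 > 0" using 1 2 by (auto dest: quotient_of_denom_pos)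
  have ra: "r a = of_int p1 / of_int n1" and rc: "r c = of_int p2 / of_int n2"
    using 1 2 by (auto dest: quotient_of_div)
  \<comment> \<open>The product of the two denominators.\<close>
  define N where "N = nat (n1 * n2)"
  have N: "(of_nat N :: complex) = of_rat (of_int (n1 * n2))"
    using n by (simp add: N_def of_rat_mult)
  have r_int: "r (of_int k) = of_int k" for k using r_rat[of "of_int k"] by simp
  have r_diff: "r (x - y) = r x - r y" for x y using r_add[of x "- y"] by (simp add: r_uminus)
  have a: "r (of_nat N * a - of_int (n2 * p1)) = 0"
    using n unfolding r_diff N r_scale r_int ra by simp
  have c: "r (of_nat N * c - of_int (n1 * p2)) = 0"
    using n unfolding r_diff N r_scale r_int rc by simp
  show thesis
  proof (rule that[OF ex])
    show "N > 0" using n by (simp add: N_def)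
    show "\<exists>k\<in>\<int>. of_nat N * a - k \<in> {z. r z = 0}" using a by (intro bexI[OF _ Ints_of_int[of "n2 * p1"]]) auto
    show "\<exists>k\<in>\<int>. of_nat N * c - k \<in> {z. r z = 0}" using c by (intro bexI[OF _ Ints_of_int[of "n1 * p2"]]) auto
  qed
qed

section \<open>Elements of the identity component\<close>

text \<open>
  If \<open>x\<^sub>k\<close> satisfies \<open>x\<^sub>k\<^sub>+\<^sub>2 = r x\<^sub>k\<^sub>+\<^sub>1 - x\<^sub>k\<close>, its square satisfies a recurrence of order three; the
  characteristic roots are \<open>\<mu>\<^sup>2\<close>, 1 and the inverse of \<open>\<mu>\<^sup>2\<close>, where \<open>\<mu>\<close> and its inverse have sum \<open>r\<close>.
\<close>

lemma squares_recurrence: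
  fixes r x0 x1 :: "'a :: comm_ring_1"
  shows "(r * (r * x1 - x0) - x1)\<^sup>2 - (r * r - 1) * (r * x1 - x0)\<^sup>2 + (r * r - 1) * x1\<^sup>2 - x0\<^sup>2 = 0"
  by (simp add: power2_eq_square algebra_simps)

context variational_equation
begin

lemma funpow_W: "\<sigma> \<in> carrier G \<Longrightarrow> w \<in> W \<Longrightarrow> (\<sigma> ^^ k) w \<in> W"
  by (induction k) (simp_all add: G_W)

lemma
  assumes s: "\<sigma> \<in> carrier G" and w: "w \<in> W"
  shows funpow_add: "v \<in> W \<Longrightarrow> (\<sigma> ^^ k) (v + w) = (\<sigma> ^^ k) v + (\<sigma> ^^ k) w"
    and funpow_diff: "v \<in> W \<Longrightarrow> (\<sigma> ^^ k) (v - w) = (\<sigma> ^^ k) v - (\<sigma> ^^ k) w"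
    and funpow_scale: "(\<sigma> ^^ k) (fls_const u * w) = fls_const u * (\<sigma> ^^ k) w"
  by (induction k) (simp_all add: G_add[OF s] G_diff[OF s] G_scale[OF s] funpow_W[OF s, THEN W_sub_L] w)

text \<open>
  Along the powers of \<open>\<sigma>\<close>, the coefficient of \<open>\<sigma> w - \<mu> w\<close> is the sequence \<open>f(k + 1) - \<mu> f(k)\<close>, where
  \<open>f\<close> is that of \<open>w\<close>. So each factor of the annihilating operator is undone by solving one recurrence.
\<close>

lemma annihilated_matrix_coefficient:
  assumes M: "exponents M" and s: "\<sigma> \<in> carrier G" and \<phi>: "linear_functional_on W \<phi>"
    and "w \<in> W" "set ms \<subseteq> M"
    and "fold (\<lambda>m w. \<sigma> w - fls_const (e2pi m) * w) ms w = 0"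
  shows "\<exists>H\<in>exp_poly M. \<forall>k. \<phi> ((\<sigma> ^^ k) w) = H (of_nat k)"
  using assms(4-)
proof (induction ms arbitrary: w)
  case Nil
  have "(\<sigma> ^^ k) 0 = 0" for k
    using funpow_scale[OF s Nil(1), of k 0] by simp
  moreover have "\<phi> (fls_const 0 * w) = 0 * \<phi> w"
    using \<phi> Nil(1) unfolding linear_functional_on_def by blast
  ultimately show ?case using Nil
    by (intro bexI[OF _ exp_poly.zero]) simp
next
  case (Cons m ms)
  interpret exponents M by (rule M)
  let ?w = "\<sigma> w - fls_const (e2pi m) * w"
  have w': "?w \<in> W" using Cons(2) by (simp add: W_closed G_W[OF s])
  obtain H where H: "H \<in> exp_poly M" "\<And>k. \<phi> ((\<sigma> ^^ k) ?w) = H (of_nat k)"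
    using Cons.IH[OF w'] Cons.prems by auto
  have "\<phi> ((\<sigma> ^^ Suc k) w) - e2pi m * \<phi> ((\<sigma> ^^ k) w) = H (of_nat k)" for k
  proof -
    have "(\<sigma> ^^ k) ?w = (\<sigma> ^^ k) (\<sigma> w) - fls_const (e2pi m) * (\<sigma> ^^ k) w"
      using Cons(2) by (simp add: funpow_diff[OF s] funpow_scale[OF s] G_W[OF s] W_closed)
    also have "\<dots> = (\<sigma> ^^ Suc k) w + fls_const (- e2pi m) * (\<sigma> ^^ k) w"
      by (simp add: funpow_swap1)
    finally have "\<phi> ((\<sigma> ^^ k) ?w) = \<phi> ((\<sigma> ^^ Suc k) w + fls_const (- e2pi m) * (\<sigma> ^^ k) w)"
      by simp
    also have "\<dots> = \<phi> ((\<sigma> ^^ Suc k) w) + - e2pi m * \<phi> ((\<sigma> ^^ k) w)"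
      using \<phi> Cons(2) funpow_W[OF s Cons(2)] W_closed(2)
      unfolding linear_functional_on_def by metis
    finally show ?thesis using H(2)[of k] by simp
  qed
  then show ?case
    using exp_poly_recurrence[OF _ H(1), of m "\<lambda>k. \<phi> ((\<sigma> ^^ k) w)"] Cons(3) by simp
qed

text \<open>
  An annihilating product of factors \<open>\<sigma> - exp (2 \<pi> \<i> m)\<close> on each generator of \<open>W\<close> replaces the
  knowledge of the eigenvalues of \<open>\<sigma>\<close> on \<open>W\<close>.
\<close>

lemma annihilated_in_G0:
  assumes M: "exponents M" and s: "\<sigma> \<in> carrier G"
    and ann: "\<And>x z. (x, z) \<in> sols \<Longrightarrow>
      (\<exists>ms. set ms \<subseteq> M \<and> fold (\<lambda>m w. \<sigma> w - fls_const (e2pi m) * w) ms x = 0) \<and>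
      (\<exists>ms. set ms \<subseteq> M \<and> fold (\<lambda>m w. \<sigma> w - fls_const (e2pi m) * w) ms z = 0)"
  shows "\<sigma> \<in> G0"
proof -
  interpret exponents M by (rule M)
  have coeff: "\<exists>H\<in>exp_poly M. \<forall>k. \<phi> ((\<sigma> ^^ k) w) = H (of_nat k)"
    if w: "w \<in> W" and \<phi>: "linear_functional_on W \<phi>" for w \<phi>
  proof -
    let ?V = "{w \<in> W. \<exists>H\<in>exp_poly M. \<forall>k. \<phi> ((\<sigma> ^^ k) w) = H (of_nat k)}"
    have "laurent.subspace ?V"
    proof (rule laurent.subspaceI)
      have "0 \<in> W" by (rule laurent.subspace_0[OF W_subspace])
      then show "0 \<in> ?V"
        using annihilated_matrix_coefficient[OF M s \<phi>, of 0 "[]"] by simp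
    next
      fix v w assume v: "v \<in> ?V" and w: "w \<in> ?V"
      obtain H1 where H1: "H1 \<in> exp_poly M" "\<forall>k. \<phi> ((\<sigma> ^^ k) v) = H1 (of_nat k)" using v by blast
      obtain H2 where H2: "H2 \<in> exp_poly M" "\<forall>k. \<phi> ((\<sigma> ^^ k) w) = H2 (of_nat k)" using w by blast
      have "\<phi> ((\<sigma> ^^ k) (v + w)) = H1 (of_nat k) + H2 (of_nat k)" for k
      proof -
        have "v \<in> W" "w \<in> W" using v w by auto
        then have "\<phi> ((\<sigma> ^^ k) (v + w)) = \<phi> ((\<sigma> ^^ k) v) + \<phi> ((\<sigma> ^^ k) w)"
          using \<phi> by (simp add: funpow_add[OF s] funpow_W[OF s] linear_functional_on_def)
        then show ?thesis using H1 H2 by simp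
      qed
      then show "v + w \<in> ?V"
        using v w by (auto intro: W_closed bexI[OF _ exp_poly_add[OF H1(1) H2(1)]])
    next
      fix u w assume w: "w \<in> ?V"
      obtain H2 where H2: "H2 \<in> exp_poly M" "\<forall>k. \<phi> ((\<sigma> ^^ k) w) = H2 (of_nat k)" using w by blast
      have "\<phi> ((\<sigma> ^^ k) (fls_const u * w)) = u * H2 (of_nat k)" for k
      proof -
        have "w \<in> W" using w by auto
        then have "\<phi> ((\<sigma> ^^ k) (fls_const u * w)) = u * \<phi> ((\<sigma> ^^ k) w)"
          using \<phi> by (simp add: funpow_scale[OF s] funpow_W[OF s] linear_functional_on_def)
        then show ?thesis using H2 by simp
      qed
      then show "fls_const u * w \<in> ?V"
        using w by (auto intro: W_closed bexI[OF _ exp_poly_cmult[OF H2(1)]])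
    qed
    moreover have "solution_components sols \<subseteq> ?V"
    proof
      fix w assume "w \<in> solution_components sols"
      then obtain x z where xz: "(x, z) \<in> sols" "w = x \<or> w = z"
        by (auto simp: solution_components_def)
      then have "w \<in> W" using sols_sub_W by blast
      moreover obtain ms where "set ms \<subseteq> M" "fold (\<lambda>m w. \<sigma> w - fls_const (e2pi m) * w) ms w = 0"
        using ann[OF xz(1)] xz(2) by blast
      ultimately show "w \<in> ?V"
        using annihilated_matrix_coefficient[OF M s \<phi>] by blast
    qed
    ultimately have "W \<subseteq> ?V"
      unfolding solution_span_def by (intro laurent.span_minimal)
    then show ?thesis using w by blast
  qed
  have poly: "\<exists>H\<in>exp_poly M. \<forall>k::nat. f (\<sigma> [^]\<^bsub>G\<^esub> k) = H (of_nat k)"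
    if "f \<in> polynomial_functions W" for f
    using that
  proof induction
    case (const k)
    have "(\<lambda>s. k * s ^ 0 * e2pi (0 * s)) \<in> exp_poly M"
      by (rule exp_poly_monomial[OF M_0])
    then show ?case by (rule bexI[rotated]) simp
  next
    case (matrix_coeff w \<phi>)
    then show ?case
      using coeff[OF matrix_coeff] by (simp add: G_pow_apply[OF s] W_sub_L)
  next
    case (add f g)
    then obtain F H where "F \<in> exp_poly M" "H \<in> exp_poly M"
      "\<forall>k::nat. f (\<sigma> [^]\<^bsub>G\<^esub> k) = F (of_nat k)" "\<forall>k::nat. g (\<sigma> [^]\<^bsub>G\<^esub> k) = H (of_nat k)" by blast
    then show ?case by (intro bexI[OF _ exp_poly_add[of F M H]]) auto
  next
    case (mult f g)
    then obtain F H where "F \<in> exp_poly M" "H \<in> exp_poly M"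
      "\<forall>k::nat. f (\<sigma> [^]\<^bsub>G\<^esub> k) = F (of_nat k)" "\<forall>k::nat. g (\<sigma> [^]\<^bsub>G\<^esub> k) = H (of_nat k)" by blast
    then show ?case by (intro bexI[OF _ exp_poly_mult[OF M_add, of F H]]) auto
  qed
  show ?thesis
  proof (rule irreducible_powers_in_G0[OF s])
    fix f g and i j :: nat
    assume fg: "f \<in> polynomial_functions W" "g \<in> polynomial_functions W"
      "f (\<sigma> [^]\<^bsub>G\<^esub> i) \<noteq> 0" "g (\<sigma> [^]\<^bsub>G\<^esub> j) \<noteq> 0"
    obtain F where F: "F \<in> exp_poly M" "\<forall>k::nat. f (\<sigma> [^]\<^bsub>G\<^esub> k) = F (of_nat k)"
      using poly[OF fg(1)] by blast
    obtain H where H: "H \<in> exp_poly M" "\<forall>k::nat. g (\<sigma> [^]\<^bsub>G\<^esub> k) = H (of_nat k)"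
      using poly[OF fg(2)] by blast
    show "\<exists>k::nat. f (\<sigma> [^]\<^bsub>G\<^esub> k) \<noteq> 0 \<and> g (\<sigma> [^]\<^bsub>G\<^esub> k) \<noteq> 0"
      using exp_poly_no_zero_divisors[OF F(1) H(1), of i j] fg F(2) H(2) by simp
  qed
qed

lemma unipotent_in_G0:
  assumes s: "\<sigma> \<in> carrier G"
    and fix_x: "\<And>x z. (x, z) \<in> sols \<Longrightarrow> \<sigma> x = x"
    and fix_z: "\<And>x z. (x, z) \<in> sols \<Longrightarrow> \<sigma> (\<sigma> z - z) = \<sigma> z - z"
  shows "\<sigma> \<in> G0"
proof (rule annihilated_in_G0[OF _ s])
  show "exponents {0}" by unfold_locales auto
  fix x z assume xz: "(x, z) \<in> sols"
  show "(\<exists>ms. set ms \<subseteq> {0} \<and> fold (\<lambda>m w. \<sigma> w - fls_const (e2pi m) * w) ms x = 0) \<and>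
      (\<exists>ms. set ms \<subseteq> {0} \<and> fold (\<lambda>m w. \<sigma> w - fls_const (e2pi m) * w) ms z = 0)"
    using fix_x[OF xz] fix_z[OF xz]
    by (intro conjI exI[of _ "[0]"] exI[of _ "[0, 0]"]) auto
qed

lemma osc_shift_analytic: "(\<lambda>t. osc b p q (t + u)) analytic_on {t0}"
  by (simp add: osc_shift osc_analytic)

lemma germ_osc_recurrence:
  "germ t0 (\<lambda>t. osc b p q (t + (u + (l + l)))) =
    fls_const (2 * osc_cos b l) * germ t0 (\<lambda>t. osc b p q (t + (u + l))) - germ t0 (\<lambda>t. osc b p q (t + u))"
  unfolding osc_recurrence[of b p q _ u l]
  by (simp only: germ_diff germ_cmult osc_shift_analytic analytic_on_mult analytic_on_const)

lemma operator_product2: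
  assumes s: "\<sigma> \<in> carrier G" and w: "w \<in> L"
  shows "\<sigma> (\<sigma> w - fls_const u * w) - fls_const v * (\<sigma> w - fls_const u * w) =
    \<sigma> (\<sigma> w) - (fls_const u + fls_const v) * \<sigma> w + fls_const u * fls_const v * w"
proof -
  have "\<sigma> (\<sigma> w - fls_const u * w) = \<sigma> (\<sigma> w) - fls_const u * \<sigma> w"
    using w by (simp add: G_diff[OF s] G_scale[OF s] G_closed[OF s] subfield_mult[OF L_subfield] fls_const_in_L)
  then show ?thesis by (simp add: algebra_simps del: fls_const_mult_const)
qed

lemma operator_product3:
  fixes u v k :: complex
  assumes s: "\<sigma> \<in> carrier G" and w: "w \<in> L"
  defines "y \<equiv> \<sigma> w - fls_const u * w"
  shows "\<sigma> (\<sigma> y - fls_const v * y) - fls_const k * (\<sigma> y - fls_const v * y) =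
    \<sigma> (\<sigma> (\<sigma> w)) - (fls_const u + fls_const v + fls_const k) * \<sigma> (\<sigma> w)
    + (fls_const u * fls_const v + fls_const u * fls_const k + fls_const v * fls_const k) * \<sigma> w
    - fls_const u * fls_const v * fls_const k * w"
proof -
  have yL: "y \<in> L"
    unfolding y_def using w by (intro subfield_diff subfield_mult L_subfield fls_const_in_L G_closed[OF s])
  have sy: "\<sigma> y = \<sigma> (\<sigma> w) - fls_const u * \<sigma> w"
    unfolding y_def using w
    by (simp add: G_diff[OF s] G_scale[OF s] G_closed[OF s] subfield_mult[OF L_subfield] fls_const_in_L)
  have ssy: "\<sigma> (\<sigma> y) = \<sigma> (\<sigma> (\<sigma> w)) - fls_const u * \<sigma> (\<sigma> w)"
    unfolding sy using w
    by (simp add: G_diff[OF s] G_scale[OF s] G_closed[OF s] subfield_mult[OF L_subfield] fls_const_in_L)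
  show ?thesis
    unfolding operator_product2[OF s yL, of v k] unfolding ssy unfolding sy unfolding y_def
    by (simp add: algebra_simps del: fls_const_mult_const)
qed

text \<open>
  Let \<open>\<mu> = exp (\<i> a l)\<close>. The oscillator solutions are annihilated by two factors. The squares \<open>x\<^sup>2\<close>, which drive
  the equation for \<open>z\<close>, are annihilated by the three factors with \<open>\<mu>\<^sup>2\<close>, 1 and the inverse of \<open>\<mu>\<^sup>2\<close>; hence these three take
  \<open>z\<close> to a solution of the homogeneous equation, and the two factors for the frequency \<open>c\<close> finish it.
\<close>

lemma translation_in_G0:
  assumes M: "exponents M" and s: "\<sigma> \<in> carrier G"
    and tr: "\<And>b p q u. germ t0 (\<lambda>t. osc b p q (t + u)) \<in> L \<Longrightarrow>
      \<sigma> (germ t0 (\<lambda>t. osc b p q (t + u))) = germ t0 (\<lambda>t. osc b p q (t + (u + l)))"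
    and ma: "ma \<in> M" "e2pi ma = exp (\<i> * a * l)" and mc: "mc \<in> M" "e2pi mc = exp (\<i> * c * l)"
  shows "\<sigma> \<in> G0"
proof (rule annihilated_in_G0[OF M s])
  interpret exponents M by (rule M)
  let ?f = "\<lambda>m w. \<sigma> w - fls_const (e2pi m) * w"
  have e_minus: "e2pi (- m) = inverse (e2pi m)" for m
    using e2pi_add[of m "- m"] by (simp add: inverse_unique)
  have osc_cos_e: "2 * osc_cos b l = e2pi m + e2pi (- m)" if "e2pi m = exp (\<i> * b * l)" for m b
    using that by (simp add: osc_cos_def cos_exp_eq e_minus exp_minus mult.assoc)
  have hom: "fold ?f [m, - m] y = 0"
    if y: "y = germ t0 (osc b p q)" "y \<in> L" and m: "e2pi m = exp (\<i> * b * l)" for y b p q m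
  proof -
    have 0: "y = germ t0 (\<lambda>t. osc b p q (t + 0))" using y by simp
    have 1: "\<sigma> y = germ t0 (\<lambda>t. osc b p q (t + (0 + l)))"
      using tr[of b p q 0] y by simp
    have 2: "\<sigma> (\<sigma> y) = germ t0 (\<lambda>t. osc b p q (t + (0 + (l + l))))"
      using tr[of b p q "0 + l"] G_closed[OF s y(2)] unfolding 1 by (simp add: add.assoc)
    have rec: "\<sigma> (\<sigma> y) = fls_const (e2pi m + e2pi (- m)) * \<sigma> y - y"
      unfolding 2 germ_osc_recurrence osc_cos_e[OF m] 1[symmetric] 0[symmetric] ..
    have "fold ?f [m, - m] y = \<sigma> (\<sigma> y) - (fls_const (e2pi m) + fls_const (e2pi (- m))) * \<sigma> y
        + fls_const (e2pi m) * fls_const (e2pi (- m)) * y"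
      using operator_product2[OF s y(2)] by simp
    also have "fls_const (e2pi m) * fls_const (e2pi (- m)) = 1"
      by (simp add: e_minus)
    also have "\<sigma> (\<sigma> y) - (fls_const (e2pi m) + fls_const (e2pi (- m))) * \<sigma> y + 1 * y = 0"
      unfolding rec by (simp add: fls_plus_const)
    finally show ?thesis .
  qed
  fix x z assume xz: "(x, z) \<in> sols"
  note xzL = sols_sub_L[OF xz]
  obtain p q where x: "x = germ t0 (osc a p q)"
    using osc_solutions[OF VE2_D(1)[OF xz]] by blast
  have "fold ?f [ma, - ma] x = 0" by (rule hom[OF x xzL(1) ma(2)])
  then have "\<exists>ms. set ms \<subseteq> M \<and> fold ?f ms x = 0"
    using ma(1) M_uminus by (intro exI[of _ "[ma, - ma]"]) auto
  moreover have "\<exists>ms. set ms \<subseteq> M \<and> fold ?f ms z = 0"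
  proof -
    define x1 x2 x3 where "x1 = \<sigma> x" and "x2 = \<sigma> x1" and "x3 = \<sigma> x2"
    define z1 z2 z3 where "z1 = \<sigma> z" and "z2 = \<sigma> z1" and "z3 = \<sigma> z2"
    define r where "r = e2pi ma + e2pi (- ma)"
    define e where "e = r * r - 1"
    have sols: "(x1, z1) \<in> sols" "(x2, z2) \<in> sols" "(x3, z3) \<in> sols"
      unfolding x1_def x2_def x3_def z1_def z2_def z3_def by (intro G_sols[OF s] xz)+
    note zL = xzL(2) sols[THEN sols_sub_L(2)]
    have 0: "x = germ t0 (\<lambda>t. osc a p q (t + 0))" using x by simp
    have 1: "x1 = germ t0 (\<lambda>t. osc a p q (t + (0 + l)))"
      using tr[of a p q 0] xzL(1) x by (simp add: x1_def)
    have 2: "x2 = germ t0 (\<lambda>t. osc a p q (t + (0 + (l + l))))"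
      using tr[of a p q "0 + l"] sols_sub_L(1)[OF sols(1)] unfolding x2_def 1 by (simp add: add.assoc)
    have 3: "x3 = germ t0 (\<lambda>t. osc a p q (t + (l + (l + l))))"
      using tr[of a p q "0 + (l + l)"] sols_sub_L(1)[OF sols(2)] unfolding x3_def 2 by (simp add: add_ac)
    have rec2: "x2 = fls_const r * x1 - x"
      unfolding 2 germ_osc_recurrence osc_cos_e[OF ma(2)] 1[symmetric] 0[symmetric] r_def ..
    have rec3: "x3 = fls_const r * x2 - x1"
    proof -
      have x1': "x1 = germ t0 (\<lambda>t. osc a p q (t + l))" using 1 by simp
      have x2': "x2 = germ t0 (\<lambda>t. osc a p q (t + (l + l)))" using 2 by simp
      show ?thesis
        unfolding 3 germ_osc_recurrence osc_cos_e[OF ma(2)] x1'[symmetric] x2'[symmetric] r_def ..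
    qed
    have squares: "x3\<^sup>2 - fls_const e * x2\<^sup>2 + fls_const e * x1\<^sup>2 - x\<^sup>2 = 0"
    proof -
      have e: "fls_const e = fls_const r * fls_const r - 1"
        by (simp add: e_def fls_minus_const[symmetric])
      show ?thesis
        unfolding e rec3 rec2 by (rule squares_recurrence)
    qed
    \<comment> \<open>The same combination of the \<open>z\<close> as the vanishing one of the squares.\<close>
    define y where "y = z3 - fls_const e * z2 + fls_const e * z1 - z"
    have "fls_deriv (fls_deriv y) = - fls_const (c\<^sup>2) * y
       + fls_const th / germ t0 sin * (x3\<^sup>2 - fls_const e * x2\<^sup>2 + fls_const e * x1\<^sup>2 - x\<^sup>2)"
      unfolding y_def
      by (simp add: VE2_D(2)[OF xz] sols[THEN VE2_D(2)] algebra_simps)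
    then have "fls_deriv (fls_deriv y) = - fls_const (c\<^sup>2) * y"
      unfolding squares by simp
    then obtain p' q' where y: "y = germ t0 (osc c p' q')"
      by (rule osc_solutions)
    have yL: "y \<in> L"
      unfolding y_def by (intro subfield_add subfield_diff subfield_mult L_subfield fls_const_in_L zL)
    have e3: "e = e2pi (ma + ma) + 1 + e2pi (- (ma + ma))"
      unfolding e_def r_def e_minus e2pi_add by (simp add: field_simps)
    have ee: "e2pi (ma + ma) * e2pi (- (ma + ma)) = 1"
      by (simp add: e_minus)
    define E E' where "E = fls_const (e2pi (ma + ma))" and "E' = fls_const (e2pi (- (ma + ma)))"
    have E: "E * E' = 1" "fls_const e = E + 1 + E'" "E \<in> L" "E' \<in> L"
      unfolding E_def E'_def e3 fls_const_mult_const ee by (simp_all only: fls_const_in_L fls_const_1 fls_plus_const[symmetric])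
    have "fold ?f [ma + ma, 0, - (ma + ma)] z
        = z3 - (E + fls_const (e2pi 0) + E') * z2 + (E * fls_const (e2pi 0) + E * E' + fls_const (e2pi 0) * E') * z1
          - E * fls_const (e2pi 0) * E' * z"
      unfolding E_def E'_def z3_def z2_def z1_def
      by (simp only: fold_simps operator_product3[OF s zL(1)])
    also have "\<dots> = z3 - (E + 1 + E') * z2 + (E + E * E' + E') * z1 - E * E' * z"
      by simp
    also have "\<dots> = y" unfolding y_def E(1,2) by (simp add: algebra_simps)
    finally have "fold ?f ([ma + ma, 0, - (ma + ma)] @ [mc, - mc]) z = fold ?f [mc, - mc] y"
      by (simp only: fold_append o_apply)
    also have "\<dots> = 0" by (rule hom[OF y yL mc(2)])
    finally have "fold ?f ([ma + ma, 0, - (ma + ma)] @ [mc, - mc]) z = 0" .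
    moreover have "set ([ma + ma, 0, - (ma + ma)] @ [mc, - mc]) \<subseteq> M"
      using M_add[OF ma(1) ma(1)] M_uminus[OF M_add[OF ma(1) ma(1)]] M_0 mc(1) M_uminus[OF mc(1)] by simp
    ultimately show ?thesis by blast
  qed
  ultimately show "(\<exists>ms. set ms \<subseteq> M \<and> fold ?f ms x = 0) \<and> (\<exists>ms. set ms \<subseteq> M \<and> fold ?f ms z = 0)"
    by blast
qed

end

section \<open>Analytic continuation in a chart\<close>

text \<open>
  A chart represents multivalued functions of \<open>t\<close> by functions on a convex domain \<open>P\<close>, via \<open>t = g s\<close>. As
  \<open>P\<close> avoids the poles of \<open>1 / sin\<close> and holomorphic functions on it have primitives, all solutions of the
  variational equation live on \<open>P\<close>. The substitution \<open>s \<mapsto> s + \<tau>\<close> continues them along a path from \<open>t\<close> to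
  \<open>t + l\<close>; it fixes \<open>K\<close> since \<open>l\<close> is a period of \<open>exp (\<i> t)\<close>.
\<close>

locale chart = variational_equation +
  fixes P :: "complex set" and g :: "complex \<Rightarrow> complex" and s0 \<tau> l :: complex
  assumes open_P: "open P" and convex_P: "convex P" and s0_P: "s0 \<in> P"
    and g_holo: "g holomorphic_on P"
    and g'_nz: "s \<in> P \<Longrightarrow> deriv g s \<noteq> 0"
    and g_s0: "g s0 = t0"
    and sin_g: "s \<in> P \<Longrightarrow> sin (g s) \<noteq> 0"
    and P_shift: "s + \<tau> \<in> P \<longleftrightarrow> s \<in> P"
    and g_shift: "s \<in> P \<Longrightarrow> g (s + \<tau>) = g s + l"
    and exp_l: "exp (\<i> * l) = 1"

begin

lemma local_inverse_exists:
  "\<exists>k B. open B \<and> s0 \<in> B \<and> B \<subseteq> P \<and> open (g ` B) \<and> k holomorphic_on g ` B \<and>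
     (\<forall>s\<in>B. k (g s) = s \<and> deriv g s * deriv k (g s) = 1)"
proof -
  obtain r where r: "r > 0" "ball s0 r \<subseteq> P" "inj_on g (ball s0 r)"
    using has_complex_derivative_locally_injective[OF g_holo s0_P open_P g'_nz[OF s0_P]] by blast
  have holo: "g holomorphic_on ball s0 r" by (rule holomorphic_on_subset[OF g_holo r(2)])
  obtain k where k: "k holomorphic_on g ` ball s0 r"
    "\<And>s. s \<in> ball s0 r \<Longrightarrow> deriv g s * deriv k (g s) = 1"
    "\<And>s. s \<in> ball s0 r \<Longrightarrow> k (g s) = s"
    using holomorphic_has_inverse[OF holo open_ball r(3)] by blast
  have "open (g ` ball s0 r)"
    using open_mapping_thm3[OF holo open_ball r(3)] .
  then show ?thesis using r k by (intro exI[of _ k] exI[of _ "ball s0 r"]) auto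
qed

definition ginv :: "complex \<Rightarrow> complex" where
  "ginv = (SOME k. \<exists>B. open B \<and> s0 \<in> B \<and> B \<subseteq> P \<and> open (g ` B) \<and> k holomorphic_on g ` B \<and>
     (\<forall>s\<in>B. k (g s) = s \<and> deriv g s * deriv k (g s) = 1))"

lemma ginv_neighbourhood:
  obtains B where "open B" "s0 \<in> B" "B \<subseteq> P" "open (g ` B)" "ginv holomorphic_on g ` B"
    "\<And>s. s \<in> B \<Longrightarrow> ginv (g s) = s" "\<And>s. s \<in> B \<Longrightarrow> deriv g s * deriv ginv (g s) = 1"
proof -
  have "\<exists>B. open B \<and> s0 \<in> B \<and> B \<subseteq> P \<and> open (g ` B) \<and> ginv holomorphic_on g ` B \<and>
     (\<forall>s\<in>B. ginv (g s) = s \<and> deriv g s * deriv ginv (g s) = 1)"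
    unfolding ginv_def by (rule someI_ex[OF local_inverse_exists])
  then show ?thesis using that by blast
qed

lemma ginv_eventually:
  "eventually (\<lambda>t. ginv t \<in> P \<and> g (ginv t) = t \<and> deriv g (ginv t) * deriv ginv t = 1
     \<and> ginv field_differentiable at t) (nhds t0)"
proof -
  obtain B where B: "open B" "s0 \<in> B" "B \<subseteq> P" "open (g ` B)" "ginv holomorphic_on g ` B"
    "\<And>s. s \<in> B \<Longrightarrow> ginv (g s) = s" "\<And>s. s \<in> B \<Longrightarrow> deriv g s * deriv ginv (g s) = 1"
    by (rule ginv_neighbourhood) blast
  have "eventually (\<lambda>t. t \<in> g ` B) (nhds t0)"
    by (rule eventually_nhds_in_open[OF B(4)]) (use B(2) g_s0 in blast)
  then show ?thesis
  proof eventually_elim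
    case (elim t)
    then obtain s where "s \<in> B" "t = g s" by blast
    then show ?case
      using B holomorphic_on_imp_differentiable_at[OF B(5,4)] by auto
  qed
qed

lemma ginv_t0: "ginv t0 = s0"
proof -
  obtain B where B: "open B" "s0 \<in> B" "B \<subseteq> P" "open (g ` B)" "ginv holomorphic_on g ` B"
    "\<And>s. s \<in> B \<Longrightarrow> ginv (g s) = s" "\<And>s. s \<in> B \<Longrightarrow> deriv g s * deriv ginv (g s) = 1"
    by (rule ginv_neighbourhood) blast
  show ?thesis using B(2,6) g_s0 by metis
qed

lemma ginv_analytic: "ginv analytic_on {t0}"
proof -
  obtain B where B: "open B" "s0 \<in> B" "B \<subseteq> P" "open (g ` B)" "ginv holomorphic_on g ` B"
    "\<And>s. s \<in> B \<Longrightarrow> ginv (g s) = s" "\<And>s. s \<in> B \<Longrightarrow> deriv g s * deriv ginv (g s) = 1"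
    by (rule ginv_neighbourhood) blast
  then show ?thesis unfolding analytic_at using g_s0 by blast
qed

text \<open>
  The germ at \<open>t0\<close> of the branch that a function on \<open>P\<close> has near \<open>s0\<close>. The derivation \<open>d/dt\<close>
  corresponds to \<open>F \<mapsto> F' / g'\<close> on \<open>P\<close>.
\<close>

definition cgerm :: "(complex \<Rightarrow> complex) \<Rightarrow> complex fls" where
  "cgerm F = germ t0 (\<lambda>t. F (ginv t))"

lemma analytic_comp_ginv:
  assumes "F holomorphic_on P"
  shows "(\<lambda>t. F (ginv t)) analytic_on {t0}"
proof -
  have "F analytic_on {s0}" unfolding analytic_at using assms open_P s0_P by blast
  then have "(F \<circ> ginv) analytic_on {t0}"
    by (intro analytic_on_compose ginv_analytic) (simp add: ginv_t0)
  then show ?thesis by (simp add: o_def)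
qed

lemma
  assumes "F holomorphic_on P" "H holomorphic_on P"
  shows cgerm_add: "cgerm (\<lambda>s. F s + H s) = cgerm F + cgerm H"
    and cgerm_diff: "cgerm (\<lambda>s. F s - H s) = cgerm F - cgerm H"
    and cgerm_mult: "cgerm (\<lambda>s. F s * H s) = cgerm F * cgerm H"
  unfolding cgerm_def
  by (simp_all add: germ_add germ_diff germ_mult analytic_comp_ginv assms)

lemma cgerm_const [simp]: "cgerm (\<lambda>_. k) = fls_const k"
  by (simp add: cgerm_def)

lemma cgerm_cong:
  assumes "\<And>s. s \<in> P \<Longrightarrow> F s = H s"
  shows "cgerm F = cgerm H"
  unfolding cgerm_def
  by (rule germ_cong, rule eventually_mono[OF ginv_eventually]) (use assms in auto)

text \<open>
  The identity theorem on the connected set \<open>P\<close>: a germ determines the function, and so also its continuation.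
\<close>

lemma cgerm_eqD:
  assumes F: "F holomorphic_on P" and H: "H holomorphic_on P" and eq: "cgerm F = cgerm H" and s: "s \<in> P"
  shows "F s = H s"
proof -
  obtain B where B: "open B" "s0 \<in> B" "B \<subseteq> P" "open (g ` B)" "ginv holomorphic_on g ` B"
    "\<And>s. s \<in> B \<Longrightarrow> ginv (g s) = s" "\<And>s. s \<in> B \<Longrightarrow> deriv g s * deriv ginv (g s) = 1"
    by (rule ginv_neighbourhood) blast
  have "eventually (\<lambda>t. F (ginv t) = H (ginv t)) (nhds t0)"
    using eq unfolding cgerm_def by (intro germ_eqD analytic_comp_ginv F H)
  moreover have "filterlim g (nhds t0) (nhds s0)"
  proof -
    have "isCont g s0"
      using g_holo open_P s0_P holomorphic_on_imp_continuous_on continuous_on_eq_continuous_at by blast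
    then show ?thesis
      using tendsto_at_iff_tendsto_nhds[of g s0] g_s0 by (simp add: isCont_def)
  qed
  ultimately have "eventually (\<lambda>s. F (ginv (g s)) = H (ginv (g s))) (nhds s0)"
    by (rule eventually_compose_filterlim)
  moreover have "eventually (\<lambda>s. s \<in> B) (nhds s0)"
    by (rule eventually_nhds_in_open[OF B(1,2)])
  ultimately have "eventually (\<lambda>s. s \<in> P \<and> F s = H s) (nhds s0)"
    by eventually_elim (use B in auto)
  then obtain A where A: "open A" "s0 \<in> A" "\<forall>s\<in>A. s \<in> P \<and> F s = H s"
    unfolding eventually_nhds by blast
  show ?thesis
    by (rule analytic_continuation_open[OF A(1) open_P _ convex_connected[OF convex_P] _ F H _ s])
      (use A in auto)
qed

lemma cgerm_comp:
  assumes "X analytic_on {t0}"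
  shows "cgerm (\<lambda>s. X (g s)) = germ t0 X"
  unfolding cgerm_def
  by (rule germ_cong, rule eventually_mono[OF ginv_eventually]) auto

lemma cgerm_deriv:
  assumes F: "F holomorphic_on P"
  shows "fls_deriv (cgerm F) = cgerm (\<lambda>s. deriv F s / deriv g s)"
proof -
  have "fls_deriv (cgerm F) = germ t0 (deriv (\<lambda>t. F (ginv t)))"
    unfolding cgerm_def by (rule germ_deriv[OF analytic_comp_ginv[OF F]])
  also have "\<dots> = cgerm (\<lambda>s. deriv F s / deriv g s)"
    unfolding cgerm_def
  proof (rule germ_cong, rule eventually_mono[OF ginv_eventually])
    fix t assume t: "ginv t \<in> P \<and> g (ginv t) = t \<and> deriv g (ginv t) * deriv ginv t = 1
      \<and> ginv field_differentiable at t"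
    have "deriv (F \<circ> ginv) t = deriv F (ginv t) * deriv ginv t"
      using t F open_P by (intro deriv_chain) (auto intro: holomorphic_on_imp_differentiable_at)
    moreover have "deriv ginv t = 1 / deriv g (ginv t)"
      using t g'_nz by (simp add: field_simps)
    ultimately show "deriv (\<lambda>t. F (ginv t)) t = deriv F (ginv t) / deriv g (ginv t)"
      by (simp add: o_def)
  qed
  finally show ?thesis .
qed

definition shift :: "(complex \<Rightarrow> complex) \<Rightarrow> complex \<Rightarrow> complex" where
  "shift F s = F (s + \<tau>)"

lemma shift_const [simp]: "shift (\<lambda>_. k) = (\<lambda>_. k)"
  by (simp add: shift_def fun_eq_iff)

lemma P_minus: "s \<in> P \<Longrightarrow> s - \<tau> \<in> P"
  using P_shift[of "s - \<tau>"] by simp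

lemma shift_holo: "F holomorphic_on P \<Longrightarrow> shift F holomorphic_on P"
  unfolding shift_def
  by (rule holomorphic_on_compose_gen[of "\<lambda>s. s + \<tau>" P F P, unfolded o_def])
    (auto intro!: holomorphic_intros simp: P_shift)

lemma unshift_holo:
  assumes "F holomorphic_on P"
  shows "(\<lambda>s. F (s - \<tau>)) holomorphic_on P"
  by (rule holomorphic_on_compose_gen[of "\<lambda>s. s - \<tau>" P F P, unfolded o_def])
    (auto intro!: holomorphic_intros P_minus assms)

lemma cgerm_shift_eq_iff:
  assumes "F holomorphic_on P" "H holomorphic_on P"
  shows "cgerm (shift F) = cgerm (shift H) \<longleftrightarrow> cgerm F = cgerm H"
proof
  assume eq: "cgerm F = cgerm H"
  show "cgerm (shift F) = cgerm (shift H)"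
    by (rule cgerm_cong) (use cgerm_eqD[OF assms eq] in \<open>simp add: shift_def P_shift\<close>)
next
  assume eq: "cgerm (shift F) = cgerm (shift H)"
  show "cgerm F = cgerm H"
  proof (rule cgerm_cong)
    fix s assume "s \<in> P"
    then show "F s = H s"
      using cgerm_eqD[OF shift_holo[OF assms(1)] shift_holo[OF assms(2)] eq, of "s - \<tau>"]
      by (simp add: shift_def P_minus)
  qed
qed

lemma
  assumes "F holomorphic_on P" "H holomorphic_on P"
  shows cgerm_shift_add: "cgerm (shift (\<lambda>s. F s + H s)) = cgerm (shift F) + cgerm (shift H)"
    and cgerm_shift_diff: "cgerm (shift (\<lambda>s. F s - H s)) = cgerm (shift F) - cgerm (shift H)"
    and cgerm_shift_mult: "cgerm (shift (\<lambda>s. F s * H s)) = cgerm (shift F) * cgerm (shift H)"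
  using cgerm_add[OF assms[THEN shift_holo]] cgerm_diff[OF assms[THEN shift_holo]]
    cgerm_mult[OF assms[THEN shift_holo]]
  by (simp_all add: shift_def[abs_def])

lemma cgerm_shift_eq_0_iff:
  "F holomorphic_on P \<Longrightarrow> cgerm (shift F) = 0 \<longleftrightarrow> cgerm F = 0"
  using cgerm_shift_eq_iff[of F "\<lambda>_. 0"] by simp

lemma dg_holo: "F holomorphic_on P \<Longrightarrow> (\<lambda>s. deriv F s / deriv g s) holomorphic_on P"
  by (intro holomorphic_intros holomorphic_deriv open_P g_holo g'_nz) auto

lemma cgerm_deriv_shift:
  assumes F: "F holomorphic_on P"
  shows "fls_deriv (cgerm (shift F)) = cgerm (shift (\<lambda>s. deriv F s / deriv g s))"
  unfolding cgerm_deriv[OF shift_holo[OF F]]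
proof (rule cgerm_cong)
  fix s assume s: "s \<in> P"
  have deriv_shift: "deriv (\<lambda>s. H (s + \<tau>)) s = deriv H (s + \<tau>)" if "H holomorphic_on P" for H
  proof -
    have "(H has_field_derivative deriv H (s + \<tau>)) (at (s + \<tau>))"
      using that open_P s by (intro holomorphic_derivI) (auto simp: P_shift)
    then show ?thesis by (intro DERIV_imp_deriv) (simp only: DERIV_shift)
  qed
  have "deriv (shift F) s = deriv F (s + \<tau>)"
    using deriv_shift[OF F] unfolding shift_def[abs_def] .
  moreover have "deriv g (s + \<tau>) = deriv g s"
  proof -
    have "eventually (\<lambda>s. s \<in> P) (nhds s)" by (rule eventually_nhds_in_open[OF open_P s])
    then have "eventually (\<lambda>s. g (s + \<tau>) = g s + l) (nhds s)"
      by eventually_elim (rule g_shift)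
    then have "deriv (\<lambda>s. g (s + \<tau>)) s = deriv (\<lambda>s. g s + l) s"
      by (rule deriv_cong_ev) simp
    also have "\<dots> = deriv g s"
      using holomorphic_on_imp_differentiable_at[OF g_holo open_P s] by (simp add: deriv_add)
    also have "deriv (\<lambda>s. g (s + \<tau>)) s = deriv g (s + \<tau>)"
      by (rule deriv_shift[OF g_holo])
    finally show ?thesis .
  qed
  ultimately show "deriv (shift F) s / deriv g s = shift (\<lambda>s. deriv F s / deriv g s) s"
    by (simp only: shift_def)
qed

text \<open>
  Continuation \<open>F \<mapsto> shift F\<close>, extended from the ring of germs of holomorphic functions on \<open>P\<close> to
  its field of fractions.
\<close>

definition corr :: "complex fls \<Rightarrow> complex fls \<Rightarrow> bool" where
  "corr x y \<longleftrightarrow> (\<exists>F H. F holomorphic_on P \<and> H holomorphic_on P \<and> cgerm H \<noteq> 0 \<and>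
     x = cgerm F / cgerm H \<and> y = cgerm (shift F) / cgerm (shift H))"

lemma corrI:
  "F holomorphic_on P \<Longrightarrow> H holomorphic_on P \<Longrightarrow> cgerm H \<noteq> 0 \<Longrightarrow>
   x = cgerm F / cgerm H \<Longrightarrow> y = cgerm (shift F) / cgerm (shift H) \<Longrightarrow> corr x y"
  unfolding corr_def by blast

lemma corr_cgerm: "F holomorphic_on P \<Longrightarrow> corr (cgerm F) (cgerm (shift F))"
  by (rule corrI[of F "\<lambda>_. 1"]) auto

text \<open>
  Equality of fractions is an identity between holomorphic functions on \<open>P\<close>, and \<open>shift\<close> is a
  bijection on those.
\<close>

lemma corr_functional:
  assumes "corr x y" "corr x' y'"
  shows "x = x' \<longleftrightarrow> y = y'"
proof -
  obtain F H where 1: "F holomorphic_on P" "H holomorphic_on P" "cgerm H \<noteq> 0"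
    "x = cgerm F / cgerm H" "y = cgerm (shift F) / cgerm (shift H)"
    using assms(1) unfolding corr_def by blast
  obtain F' H' where 2: "F' holomorphic_on P" "H' holomorphic_on P" "cgerm H' \<noteq> 0"
    "x' = cgerm F' / cgerm H'" "y' = cgerm (shift F') / cgerm (shift H')"
    using assms(2) unfolding corr_def by blast
  have "x = x' \<longleftrightarrow> cgerm F * cgerm H' = cgerm F' * cgerm H"
    using 1 2 by (simp add: frac_eq_eq)
  also have "\<dots> \<longleftrightarrow> cgerm (\<lambda>s. F s * H' s) = cgerm (\<lambda>s. F' s * H s)"
    using 1 2 by (simp add: cgerm_mult)
  also have "\<dots> \<longleftrightarrow> cgerm (shift (\<lambda>s. F s * H' s)) = cgerm (shift (\<lambda>s. F' s * H s))"
    using 1 2 by (intro cgerm_shift_eq_iff[symmetric] holomorphic_intros)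
  also have "\<dots> \<longleftrightarrow> cgerm (shift F) * cgerm (shift H') = cgerm (shift F') * cgerm (shift H)"
    using 1 2 by (simp add: cgerm_shift_mult)
  also have "\<dots> \<longleftrightarrow> y = y'"
    using 1 2 by (simp add: frac_eq_eq cgerm_shift_eq_0_iff)
  finally show ?thesis .
qed

lemma
  assumes "corr x y" "corr x' y'"
  shows corr_add: "corr (x + x') (y + y')" and corr_mult: "corr (x * x') (y * y')"
proof -
  obtain F H where 1: "F holomorphic_on P" "H holomorphic_on P" "cgerm H \<noteq> 0"
    "x = cgerm F / cgerm H" "y = cgerm (shift F) / cgerm (shift H)"
    using assms(1) unfolding corr_def by blast
  obtain F' H' where 2: "F' holomorphic_on P" "H' holomorphic_on P" "cgerm H' \<noteq> 0"
    "x' = cgerm F' / cgerm H'" "y' = cgerm (shift F') / cgerm (shift H')"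
    using assms(2) unfolding corr_def by blast
  have nz: "cgerm (shift H) \<noteq> 0" "cgerm (shift H') \<noteq> 0"
    using 1 2 by (simp_all add: cgerm_shift_eq_0_iff)
  have holo: "(\<lambda>s. F s * H' s) holomorphic_on P" "(\<lambda>s. F' s * H s) holomorphic_on P"
    "(\<lambda>s. H s * H' s) holomorphic_on P" "(\<lambda>s. F s * F' s) holomorphic_on P"
    using 1 2 by (auto intro!: holomorphic_intros)
  show "corr (x + x') (y + y')"
  proof (rule corrI[of "\<lambda>s. F s * H' s + F' s * H s" "\<lambda>s. H s * H' s"])
    show "(\<lambda>s. F s * H' s + F' s * H s) holomorphic_on P" by (intro holomorphic_intros holo)
    show "cgerm (\<lambda>s. H s * H' s) \<noteq> 0" using 1 2 by (simp add: cgerm_mult)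
    show "x + x' = cgerm (\<lambda>s. F s * H' s + F' s * H s) / cgerm (\<lambda>s. H s * H' s)"
      unfolding cgerm_add[OF holo(1,2)] cgerm_mult[OF 1(1) 2(2)] cgerm_mult[OF 2(1) 1(2)]
        cgerm_mult[OF 1(2) 2(2)] 1(4) 2(4)
      by (rule add_frac_eq[OF 1(3) 2(3)])
    show "y + y' = cgerm (shift (\<lambda>s. F s * H' s + F' s * H s)) / cgerm (shift (\<lambda>s. H s * H' s))"
      unfolding cgerm_shift_add[OF holo(1,2)] cgerm_shift_mult[OF 1(1) 2(2)]
        cgerm_shift_mult[OF 2(1) 1(2)] cgerm_shift_mult[OF 1(2) 2(2)] 1(5) 2(5)
      by (rule add_frac_eq[OF nz])
  qed (rule holo)
  show "corr (x * x') (y * y')"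
    by (rule corrI[OF holo(4,3)]) (use 1 2 in \<open>simp_all add: cgerm_mult cgerm_shift_mult\<close>)
qed

lemma corr_uminus: "corr x y \<Longrightarrow> corr (- x) (- y)"
  using corr_mult[OF corr_cgerm[of "\<lambda>_. -1"], of x y] by simp

lemma corr_inverse:
  assumes "corr x y"
  shows "corr (inverse x) (inverse y)"
proof -
  obtain F H where 1: "F holomorphic_on P" "H holomorphic_on P" "cgerm H \<noteq> 0"
    "x = cgerm F / cgerm H" "y = cgerm (shift F) / cgerm (shift H)"
    using assms(1) unfolding corr_def by blast
  show ?thesis
  proof (cases "cgerm F = 0")
    case True
    then have "x = 0" "y = 0" using 1 by (simp_all add: cgerm_shift_eq_0_iff)
    then show ?thesis using assms by simp
  next
    case False
    then show ?thesis by (intro corrI[OF 1(2,1)]) (simp_all add: 1(4,5))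
  qed
qed

lemma corr_deriv:
  assumes "corr x y"
  shows "corr (fls_deriv x) (fls_deriv y)"
proof -
  obtain F H where 1: "F holomorphic_on P" "H holomorphic_on P" "cgerm H \<noteq> 0"
    "x = cgerm F / cgerm H" "y = cgerm (shift F) / cgerm (shift H)"
    using assms(1) unfolding corr_def by blast
  let ?d = "\<lambda>F s. deriv F s / deriv g s"
  note d = dg_holo[OF 1(1)] dg_holo[OF 1(2)]
  have holo: "(\<lambda>s. ?d F s * H s) holomorphic_on P" "(\<lambda>s. F s * ?d H s) holomorphic_on P"
    "(\<lambda>s. H s * H s) holomorphic_on P"
    by (intro holomorphic_intros 1 d holomorphic_deriv open_P g_holo g'_nz; assumption)+
  show ?thesis
  proof (rule corrI[of "\<lambda>s. ?d F s * H s - F s * ?d H s" "\<lambda>s. H s * H s"])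
    show "(\<lambda>s. ?d F s * H s - F s * ?d H s) holomorphic_on P" by (rule holomorphic_on_diff[OF holo(1,2)])
    show "cgerm (\<lambda>s. H s * H s) \<noteq> 0" using 1 by (simp add: cgerm_mult)
    show "fls_deriv x = cgerm (\<lambda>s. ?d F s * H s - F s * ?d H s) / cgerm (\<lambda>s. H s * H s)"
      unfolding 1(4) fls_deriv_quotient[OF 1(3)] cgerm_diff[OF holo(1,2)] cgerm_mult[OF d(1) 1(2)]
        cgerm_mult[OF 1(1) d(2)] cgerm_mult[OF 1(2,2)] cgerm_deriv[OF 1(1)] cgerm_deriv[OF 1(2)] ..
    have "cgerm (shift H) \<noteq> 0" using 1 by (simp add: cgerm_shift_eq_0_iff)
    then show "fls_deriv y = cgerm (shift (\<lambda>s. ?d F s * H s - F s * ?d H s)) / cgerm (shift (\<lambda>s. H s * H s))"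
      unfolding 1(5) cgerm_shift_diff[OF holo(1,2)] cgerm_shift_mult[OF d(1) 1(2)]
        cgerm_shift_mult[OF 1(1) d(2)] cgerm_shift_mult[OF 1(2,2)] cgerm_deriv_shift[OF 1(1), symmetric]
        cgerm_deriv_shift[OF 1(2), symmetric]
      by (rule fls_deriv_quotient)
  qed (rule holo)
qed

lemma corr_K:
  assumes "k \<in> K"
  shows "corr k k"
proof -
  have const: "corr (fls_const u) (fls_const u)" for u
    using corr_cgerm[of "\<lambda>_. u"] by simp
  have "corr (germ t0 (\<lambda>t. exp (\<i> * t))) (germ t0 (\<lambda>t. exp (\<i> * t)))"
  proof -
    have holo: "(\<lambda>s. exp (\<i> * g s)) holomorphic_on P" by (intro holomorphic_intros g_holo)
    have "cgerm (shift (\<lambda>s. exp (\<i> * g s))) = cgerm (\<lambda>s. exp (\<i> * g s))"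
      by (rule cgerm_cong) (simp add: shift_def g_shift distrib_left exp_add exp_l)
    then show ?thesis
      using corr_cgerm[OF holo] cgerm_comp[OF exp_i_analytic] by simp
  qed
  moreover have "is_subfield {k. corr k k}"
    unfolding is_subfield_def mem_Collect_eq
    using const[of 0] const[of 1] by (auto intro: corr_add corr_mult corr_uminus corr_inverse)
  ultimately have "K \<subseteq> {k. corr k k}"
    unfolding K_exp_def by (intro hull_minimal) (use const in auto)
  then show ?thesis using assms by blast
qed

lemma cgerm_osc: "cgerm (\<lambda>s. osc b p q (g s)) = germ t0 (osc b p q)"
  by (rule cgerm_comp) (rule osc_analytic)

lemma osc_g_holo: "(\<lambda>s. osc b p q (g s)) holomorphic_on P"
  by (rule osc_holomorphic[OF g_holo])

text \<open>
  The integrand of variation of constants, as a differential in the coordinate \<open>s\<close>, where \<open>B\<close> is one of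
  the basic solutions of the homogeneous equation.
\<close>

abbreviation "driving_term p q B s \<equiv> th / sin (g s) * (osc a p q (g s))\<^sup>2 * B (g s) * deriv g s"

lemma variation_of_constants:
  assumes J1: "\<And>s. s \<in> P \<Longrightarrow> (J1 has_field_derivative driving_term p q (osc_cos c) s) (at s)"
    and J2: "\<And>s. s \<in> P \<Longrightarrow> (J2 has_field_derivative driving_term p q (osc_sin c) s) (at s)"
  shows "(germ t0 (osc a p q), cgerm (\<lambda>s. osc_sin c (g s) * J1 s - osc_cos c (g s) * J2 s)) \<in> sols"
proof -
  define C S x k where "C = germ t0 (osc_cos c)" and "S = germ t0 (osc_sin c)"
    and "x = germ t0 (osc a p q)" and "k = fls_const th / germ t0 sin * x\<^sup>2"
  have J_holo: "J1 holomorphic_on P" "J2 holomorphic_on P"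
    using J1 J2 by (auto simp: holomorphic_on_open[OF open_P])
  have CS_holo: "(\<lambda>s. osc_sin c (g s)) holomorphic_on P" "(\<lambda>s. osc_cos c (g s)) holomorphic_on P"
    by (simp_all add: osc_1_0 osc_0_1 osc_g_holo)
  have an: "osc_cos c analytic_on {t0}" "osc_sin c analytic_on {t0}" "osc a p q analytic_on {t0}"
    by (simp_all add: osc_1_0 osc_0_1 osc_analytic)
  have sin_an: "sin analytic_on {t0}" "(\<lambda>t. inverse (sin t)) analytic_on {t0}"
    using sin_t0 by (auto intro!: analytic_intros)
  have C': "fls_deriv C = - fls_const (c\<^sup>2) * S" and S': "fls_deriv S = C"
    and CS: "C * C + fls_const (c\<^sup>2) * (S * S) = 1"
    unfolding C_def S_def
    by (rule fls_deriv_germ_osc_cos fls_deriv_germ_osc_sin germ_osc_cos_sin_squared)+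
  have integrand: "cgerm (\<lambda>s. th / sin (g s) * (osc a p q (g s))\<^sup>2 * B (g s)) = k * germ t0 B"
    if B: "B analytic_on {t0}" for B
  proof -
    have "cgerm (\<lambda>s. th / sin (g s) * (osc a p q (g s))\<^sup>2 * B (g s))
        = germ t0 (\<lambda>t. th * inverse (sin t) * (osc a p q t * osc a p q t) * B t)"
      unfolding divide_inverse power2_eq_square
      by (rule cgerm_comp) (intro analytic_intros sin_an an B)
    also have "\<dots> = fls_const th * inverse (germ t0 sin) * (x * x) * germ t0 B"
      unfolding x_def
      by (simp only: germ_mult germ_cmult germ_inverse[OF sin_an(1) sin_t0] analytic_on_mult sin_an an B
          analytic_on_const germ_const)
    finally show ?thesis
      by (simp add: k_def divide_inverse power2_eq_square)
  qed
  have j: "fls_deriv (cgerm J1) = k * C" "fls_deriv (cgerm J2) = k * S"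
    unfolding cgerm_deriv[OF J_holo(1)] cgerm_deriv[OF J_holo(2)] C_def S_def
      integrand[OF an(1), symmetric] integrand[OF an(2), symmetric]
    by (rule cgerm_cong; use DERIV_imp_deriv[OF J1] DERIV_imp_deriv[OF J2] g'_nz in simp)+
  define z where "z = S * cgerm J1 - C * cgerm J2"
  have z: "cgerm (\<lambda>s. osc_sin c (g s) * J1 s - osc_cos c (g s) * J2 s) = z"
    unfolding z_def C_def S_def cgerm_comp[OF an(1), symmetric] cgerm_comp[OF an(2), symmetric]
    by (subst cgerm_diff) (simp_all add: cgerm_mult CS_holo J_holo holomorphic_intros)
  have z': "fls_deriv z = C * cgerm J1 + fls_const (c\<^sup>2) * (S * cgerm J2)"
    unfolding z_def by (simp add: C' S' j algebra_simps)
  have "fls_deriv (fls_deriv z) = - fls_const (c\<^sup>2) * z + k * (C * C + fls_const (c\<^sup>2) * (S * S))"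
    unfolding z' unfolding z_def by (simp add: C' S' j algebra_simps)
  then have "fls_deriv (fls_deriv z) = - fls_const (c\<^sup>2) * z + k"
    by (simp add: CS)
  then show ?thesis
    unfolding z by (simp add: VE2_def x_def[symmetric] k_def) (simp add: x_def fls_deriv2_germ_osc)
qed

lemma primitives_exist:
  obtains J1 J2 where
    "\<And>s. s \<in> P \<Longrightarrow> (J1 has_field_derivative driving_term p q (osc_cos c) s) (at s)"
    "\<And>s. s \<in> P \<Longrightarrow> (J2 has_field_derivative driving_term p q (osc_sin c) s) (at s)"
proof -
  have *: "\<exists>J. \<forall>s\<in>P. (J has_field_derivative driving_term p q (osc c p' q') s) (at s)" for p' q'
  proof -
    have "driving_term p q (osc c p' q') holomorphic_on P"
      by (intro holomorphic_intros osc_g_holo g_holo open_P sin_g)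
    from holomorphic_convex_primitive'[OF convex_P open_P this]
    obtain J where "\<And>s. s \<in> P \<Longrightarrow> (J has_field_derivative driving_term p q (osc c p' q') s) (at s within P)"
      by blast
    then show ?thesis using at_within_open[OF _ open_P] by auto
  qed
  show thesis
    using *[of 1 0] *[of 0 1] that unfolding osc_1_0[symmetric] osc_0_1[symmetric] by blast
qed

lemma solution_exists: "\<exists>z. (germ t0 (osc a p q), z) \<in> sols"
proof -
  obtain J1 J2 where J: "\<And>s. s \<in> P \<Longrightarrow> (J1 has_field_derivative driving_term p q (osc_cos c) s) (at s)"
    "\<And>s. s \<in> P \<Longrightarrow> (J2 has_field_derivative driving_term p q (osc_sin c) s) (at s)"
    by (rule primitives_exist[of p q]) blast
  show ?thesis using variation_of_constants[OF J] by blast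
qed

lemma solution_is_cgerm:
  assumes "(germ t0 (osc a p q), z) \<in> sols"
    and J: "\<And>s. s \<in> P \<Longrightarrow> (J1 has_field_derivative driving_term p q (osc_cos c) s) (at s)"
     "\<And>s. s \<in> P \<Longrightarrow> (J2 has_field_derivative driving_term p q (osc_sin c) s) (at s)"
  obtains p' q' where
    "(\<lambda>s. osc_sin c (g s) * J1 s - osc_cos c (g s) * J2 s + osc c p' q' (g s)) holomorphic_on P"
    "z = cgerm (\<lambda>s. osc_sin c (g s) * J1 s - osc_cos c (g s) * J2 s + osc c p' q' (g s))"
proof -
  obtain p' q' where z: "z = cgerm (\<lambda>s. osc_sin c (g s) * J1 s - osc_cos c (g s) * J2 s) + germ t0 (osc c p' q')"
    using sols_diff_homogeneous[OF variation_of_constants[OF J] assms(1)] by blast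
  have "J1 holomorphic_on P" "J2 holomorphic_on P"
    using J by (auto simp: holomorphic_on_open[OF open_P])
  then have holo: "(\<lambda>s. osc_sin c (g s) * J1 s - osc_cos c (g s) * J2 s) holomorphic_on P"
    by (auto intro!: holomorphic_intros osc_g_holo simp: osc_1_0 osc_0_1)
  show thesis
    by (rule that[of p' q'])
      (auto intro!: holomorphic_on_add holo osc_g_holo simp: z cgerm_add[OF holo osc_g_holo] cgerm_osc)
qed

lemma sols_are_cgerms:
  assumes "(x, z) \<in> sols"
  shows "\<exists>F. F holomorphic_on P \<and> x = cgerm F" "\<exists>F. F holomorphic_on P \<and> z = cgerm F"
proof -
  obtain p q where x: "x = germ t0 (osc a p q)"
    using osc_solutions[OF VE2_D(1)[OF assms]] by blast
  then show "\<exists>F. F holomorphic_on P \<and> x = cgerm F"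
    using osc_g_holo[of a p q] cgerm_osc[of a p q] by auto
  show "\<exists>F. F holomorphic_on P \<and> z = cgerm F"
  proof -
    obtain J1 J2 where J: "\<And>s. s \<in> P \<Longrightarrow> (J1 has_field_derivative driving_term p q (osc_cos c) s) (at s)"
      "\<And>s. s \<in> P \<Longrightarrow> (J2 has_field_derivative driving_term p q (osc_sin c) s) (at s)"
      by (rule primitives_exist[of p q]) blast
    show ?thesis
      by (rule solution_is_cgerm[OF assms[unfolded x] J]) blast+
  qed
qed

text \<open>
  The inverse of the continuation is the substitution \<open>s \<mapsto> s - \<tau>\<close>, which gives each solution a preimage.
\<close>

lemma continuation_automorphism:
  obtains \<sigma> where "\<sigma> \<in> carrier G"
    "\<And>F. F holomorphic_on P \<Longrightarrow> cgerm F \<in> L \<Longrightarrow> \<sigma> (cgerm F) = cgerm (shift F)"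
proof -
  have unshift: "corr (cgerm (\<lambda>s. F (s - \<tau>))) (cgerm F)" if "F holomorphic_on P" for F
  proof -
    have "shift (\<lambda>s. F (s - \<tau>)) = F" by (simp add: shift_def fun_eq_iff)
    then show ?thesis using corr_cgerm[OF unshift_holo[OF that]] by simp
  qed
  obtain \<sigma> where \<sigma>: "\<sigma> \<in> carrier G" "\<And>x y. x \<in> L \<Longrightarrow> corr x y \<Longrightarrow> \<sigma> x = y"
  proof (rule galois_element_of_correspondence[of corr])
    fix x z assume "(x, z) \<in> sols"
    from sols_are_cgerms[OF this] obtain F H where
      F: "F holomorphic_on P" "x = cgerm F" and H: "H holomorphic_on P" "z = cgerm H" by blast
    show "(\<exists>y. corr x y) \<and> (\<exists>y. corr z y)" "(\<exists>y. corr y x) \<and> (\<exists>y. corr y z)"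
      using corr_cgerm unshift F H by blast+
  qed (use corr_functional in \<open>blast intro: corr_add corr_mult corr_uminus corr_inverse corr_deriv corr_K\<close>)+
  show thesis
    by (rule that[OF \<sigma>(1)]) (use \<sigma>(2) corr_cgerm in blast)
qed

lemma continuation_of_osc:
  assumes \<sigma>: "\<And>F. F holomorphic_on P \<Longrightarrow> cgerm F \<in> L \<Longrightarrow> \<sigma> (cgerm F) = cgerm (shift F)"
    and L: "germ t0 (\<lambda>t. osc b p q (t + u)) \<in> L"
  shows "\<sigma> (germ t0 (\<lambda>t. osc b p q (t + u))) = germ t0 (\<lambda>t. osc b p q (t + (u + l)))"
proof -
  obtain p' q' where pq: "(\<lambda>t. osc b p q (t + u)) = osc b p' q'"
  proof
    show "(\<lambda>t. osc b p q (t + u)) = osc b (osc b p q u) (osc b q (- (b\<^sup>2) * p) u)"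
      by (rule ext) (rule osc_shift)
  qed
  have "\<sigma> (germ t0 (osc b p' q')) = cgerm (shift (\<lambda>s. osc b p' q' (g s)))"
    using \<sigma>[OF osc_g_holo, of b p' q'] L by (simp add: cgerm_osc pq)
  also have "\<dots> = cgerm (\<lambda>s. osc b p' q' (g s + l))"
    by (rule cgerm_cong) (simp add: shift_def g_shift)
  also have "\<dots> = germ t0 (\<lambda>t. osc b p' q' (t + l))"
    by (rule cgerm_comp) (simp add: osc_shift osc_analytic)
  also have "(\<lambda>t. osc b p' q' (t + l)) = (\<lambda>t. osc b p q (t + (u + l)))"
  proof
    fix t
    show "osc b p' q' (t + l) = osc b p q (t + (u + l))"
      using fun_cong[OF pq, of "t + l"] by (simp add: add_ac)
  qed
  finally show ?thesis by (simp add: pq)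
qed

text \<open>
  When the path is closed, the factors \<open>osc_sin c (g s)\<close> and \<open>osc_cos c (g s)\<close> return to
  themselves and only the two primitives pick up their periods.
\<close>

lemma monodromy_on_solution:
  assumes \<sigma>: "\<And>F. F holomorphic_on P \<Longrightarrow> cgerm F \<in> L \<Longrightarrow> \<sigma> (cgerm F) = cgerm (shift F)"
    and l: "l = 0"
    and xz: "(germ t0 (osc a p q), z) \<in> sols"
    and J: "\<And>s. s \<in> P \<Longrightarrow> (J1 has_field_derivative driving_term p q (osc_cos c) s) (at s)"
     "\<And>s. s \<in> P \<Longrightarrow> (J2 has_field_derivative driving_term p q (osc_sin c) s) (at s)"
    and per: "\<And>s. s \<in> P \<Longrightarrow> J1 (s + \<tau>) = J1 s + j1" "\<And>s. s \<in> P \<Longrightarrow> J2 (s + \<tau>) = J2 s + j2"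
  shows "\<sigma> z = z + germ t0 (osc c (- j2) j1)"
proof -
  obtain p' q' where
    F': "(\<lambda>s. osc_sin c (g s) * J1 s - osc_cos c (g s) * J2 s + osc c p' q' (g s)) holomorphic_on P"
    and z': "z = cgerm (\<lambda>s. osc_sin c (g s) * J1 s - osc_cos c (g s) * J2 s + osc c p' q' (g s))"
    by (rule solution_is_cgerm[OF xz J])
  define F where "F = (\<lambda>s. osc_sin c (g s) * J1 s - osc_cos c (g s) * J2 s + osc c p' q' (g s))"
  note F = F'[folded F_def] and z = z'[folded F_def]
  have "\<sigma> z = cgerm (shift F)"
    unfolding z by (rule \<sigma>[OF F]) (use sols_sub_L(2)[OF xz] z in simp)
  also have "\<dots> = cgerm (\<lambda>s. F s + osc c (- j2) j1 (g s))"
    by (rule cgerm_cong) (simp add: F_def shift_def g_shift l per osc_def algebra_simps)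
  also have "\<dots> = z + germ t0 (osc c (- j2) j1)"
    unfolding z by (subst cgerm_add[OF F osc_g_holo]) (simp add: cgerm_osc)
  finally show ?thesis .
qed

end

section \<open>Charts for the translation and for a loop around a pole\<close>

lemma exp_i_2pi_nat: "exp (\<i> * of_real (2 * pi * of_nat N)) = 1"
  unfolding exp_eq_1 by (auto intro!: exI[of _ "int N"])

lemma sin_eq_0_imp_exp:
  fixes z :: complex
  assumes "sin z = 0"
  shows "exp (\<i> * z) = 1 \<or> exp (\<i> * z) = -1"
proof -
  have "(cos z)\<^sup>2 = 1" using sin_cos_squared_add[of z] assms by simp
  moreover have "exp (\<i> * z) = cos z" using assms by (simp add: exp_Euler)
  ultimately show ?thesis by (simp add: power2_eq_1_iff)
qed

lemma sin_eq_0_imp_real: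
  fixes z :: complex
  assumes "sin z = 0"
  shows "Im z = 0"
proof -
  have "cmod (exp (\<i> * z)) = 1"
    using sin_eq_0_imp_exp[OF assms] by (metis norm_minus_cancel norm_one)
  then show ?thesis by simp
qed

lemma half_plane_chart:
  fixes t0 :: complex and r :: real
  assumes "r * Im t0 > 0"
  shows "chart t0 {s. r * Im s > 0} (\<lambda>s. s) t0 (of_real (2 * pi * of_nat N)) (of_real (2 * pi * of_nat N))"
proof unfold_locales
  show "sin t0 \<noteq> 0" using assms sin_eq_0_imp_real[of t0] by auto
  show "open {s. r * Im s > 0}" by (intro open_Collect_less continuous_intros)
  show "convex {s. r * Im s > 0}"
    using convex_halfspace_gt[of 0 "of_real r * \<i>"] by (simp add: inner_complex_def)
  show "exp (\<i> * of_real (2 * pi * of_nat N)) = 1" by (rule exp_i_2pi_nat)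
qed (use assms in \<open>auto dest: sin_eq_0_imp_real\<close>)

text \<open>
  The upper half plane in \<open>t\<close> is the unit disc in \<open>u = exp (\<i> t)\<close>, with the points \<open>\<plusminus>1\<close> of the boundary
  excluded. A real \<open>t0\<close> lies on the boundary, so a larger disc is required that still contains 0 and
  avoids \<open>\<plusminus>1\<close>: the one with centre \<open>\<i>\<close> and radius \<open>sqrt 2\<close>, whose boundary passes through \<open>\<plusminus>1\<close> and which
  contains the upper half of the unit circle. The map \<open>v \<mapsto> \<i> v / (sqrt 2 - v)\<close> takes the unit disc onto
  it and fixes 0; \<open>g\<close> is this map written in \<open>v = exp (\<i> s)\<close> and \<open>u = exp (\<i> t)\<close>. The lower half of the circle is
  reached by the shift \<open>\<epsilon>\<close>, which will be 0 or \<open>\<pi>\<close>.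
\<close>

lemma real_axis_chart:
  fixes t0 \<epsilon> :: complex
  assumes \<epsilon>: "sin \<epsilon> = 0" and real: "Im (t0 - \<epsilon>) = 0" and pos: "Re (sin (t0 - \<epsilon>)) > 0"
  shows "\<exists>s0. chart t0 {s. Im s > 0} (\<lambda>s. s + of_real (pi / 2) + \<i> * Ln (of_real (sqrt 2) - exp (\<i> * s)) + \<epsilon>) s0
    (of_real (2 * pi * of_nat N)) (of_real (2 * pi * of_nat N))"
proof -
  define g where "g = (\<lambda>s. s + of_real (pi / 2) + \<i> * Ln (of_real (sqrt 2) - exp (\<i> * s)) + \<epsilon>)"
  define P where "P = {s. Im s > 0}"
  define r :: complex where "r = of_real (sqrt 2)"
  have r: "r \<noteq> 0" "cmod r = sqrt 2" by (simp_all add: r_def)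
  have v: "cmod (exp (\<i> * s)) < 1" if "s \<in> P" for s using that by (simp add: P_def)
  have g_eq: "g s = s + of_real (pi / 2) + \<i> * Ln (r - exp (\<i> * s)) + \<epsilon>" for s
    by (simp add: g_def r_def)
  have Re: "Re (r - exp (\<i> * s)) > 0" if "s \<in> P" for s
  proof -
    have "Re (exp (\<i> * s)) \<le> cmod (exp (\<i> * s))" by (rule complex_Re_le_cmod)
    moreover have "sqrt 2 > 1" by simp
    ultimately have "Re (exp (\<i> * s)) < sqrt 2" using v[OF that] by linarith
    then show ?thesis by (simp add: r_def)
  qed
  have slit: "r - exp (\<i> * s) \<notin> \<real>\<^sub>\<le>\<^sub>0" "r - exp (\<i> * s) \<noteq> 0" if "s \<in> P" for s
    using Re[OF that] by (auto simp: complex_nonpos_Reals_iff complex_eq_iff)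
  have exp_g: "exp (\<i> * g s) = \<i> * exp (\<i> * s) / (r - exp (\<i> * s)) * exp (\<i> * \<epsilon>)" if s: "s \<in> P" for s
  proof -
    have "\<i> * g s = \<i> * s + of_real (pi / 2) * \<i> - Ln (r - exp (\<i> * s)) + \<i> * \<epsilon>"
      by (simp add: g_eq algebra_simps)
    then have "exp (\<i> * g s) = exp (\<i> * s) * exp (of_real (pi / 2) * \<i>) / exp (Ln (r - exp (\<i> * s))) * exp (\<i> * \<epsilon>)"
      by (simp only: exp_add exp_diff)
    moreover have "exp (of_real (pi / 2) * \<i>) = \<i>"
      using cis_pi_half unfolding cis_conv_exp by (simp only: mult.commute)
    ultimately show ?thesis using slit(2)[OF s] by (simp add: mult_ac)
  qed
  have g': "(g has_field_derivative r / (r - exp (\<i> * s))) (at s)" if s: "s \<in> P" for s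
  proof -
    have "((\<lambda>s. Ln (r - exp (\<i> * s))) has_field_derivative
        inverse (r - exp (\<i> * s)) * (0 - exp (\<i> * s) * (\<i> * 1))) (at s)"
      by (intro DERIV_chain2[of Ln] has_field_derivative_Ln slit(1)[OF s] DERIV_diff DERIV_const
          DERIV_chain2[of exp] DERIV_exp DERIV_cmult DERIV_ident)
    then have "((\<lambda>s. s + of_real (pi / 2) + \<i> * Ln (r - exp (\<i> * s)) + \<epsilon>) has_field_derivative
        1 + 0 + \<i> * (inverse (r - exp (\<i> * s)) * (0 - exp (\<i> * s) * (\<i> * 1))) + 0) (at s)"
      by (intro DERIV_add DERIV_ident DERIV_const DERIV_cmult)
    moreover have "1 + 0 + \<i> * (inverse (r - exp (\<i> * s)) * (0 - exp (\<i> * s) * (\<i> * 1))) + 0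
        = r / (r - exp (\<i> * s))"
      using slit(2)[OF s] by (simp add: divide_simps) (simp add: algebra_simps)
    ultimately show ?thesis unfolding g_eq[abs_def] by simp
  qed
  have sin_g: "sin (g s) \<noteq> 0" if s: "s \<in> P" for s
  proof
    assume "sin (g s) = 0"
    define w where "w = exp (\<i> * s)"
    have w: "cmod w < 1" "r - w \<noteq> 0" using v[OF s] slit(2)[OF s] by (simp_all add: w_def)
    let ?X = "\<i> * w / (r - w)"
    have "(?X * exp (\<i> * \<epsilon>))\<^sup>2 = 1"
      using sin_eq_0_imp_exp[OF \<open>sin (g s) = 0\<close>] unfolding exp_g[OF s] w_def power2_eq_1_iff .
    moreover have "(exp (\<i> * \<epsilon>))\<^sup>2 = 1"
      using sin_eq_0_imp_exp[OF \<epsilon>] unfolding power2_eq_1_iff .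
    ultimately have "?X\<^sup>2 = 1" by (simp only: power_mult_distrib mult_1_right)
    then have "?X = 1 \<or> ?X = -1" unfolding power2_eq_1_iff .
    then have "\<i> * w = r - w \<or> \<i> * w = - (r - w)"
      using w(2) by (simp add: divide_eq_eq)
    then have "(1 + \<i>) * w = r \<or> (1 - \<i>) * w = r"
      by (auto simp: algebra_simps)
    then have "cmod (1 + \<i>) * cmod w = sqrt 2 \<or> cmod (1 - \<i>) * cmod w = sqrt 2"
      using r(2) by (metis norm_mult)
    moreover have "cmod (1 + \<i>) = sqrt 2" "cmod (1 - \<i>) = sqrt 2"
      by (simp_all add: cmod_def)
    ultimately show False using w(1) by auto
  qed
  define u where "u = exp (\<i> * (t0 - \<epsilon>))"
  have u: "cmod u = 1" using real by (simp add: u_def)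
  have Im_u: "Im u > 0"
  proof -
    have "t0 - \<epsilon> = of_real (Re (t0 - \<epsilon>))" using real by (simp add: complex_eq_iff)
    then obtain x :: real where x: "t0 - \<epsilon> = of_real x" by blast
    have "Im u = sin x" by (simp add: u_def x cis_conv_exp[symmetric])
    then show ?thesis using pos by (simp add: x sin_of_real)
  qed
  have u_i: "u + \<i> \<noteq> 0" using Im_u by (auto simp: complex_eq_iff)
  define w where "w = r * u / (u + \<i>)"
  have "cmod w < 1"
  proof -
    have "(cmod (u + \<i>))\<^sup>2 = (cmod u)\<^sup>2 + 2 * Im u + 1"
      unfolding cmod_power2 by (simp add: power2_eq_square algebra_simps)
    then have "(cmod (u + \<i>))\<^sup>2 > 2" using Im_u u by simp
    then have "cmod (u + \<i>) > sqrt 2"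
      using real_sqrt_less_mono[of 2 "(cmod (u + \<i>))\<^sup>2"] by simp
    moreover have "cmod w = sqrt 2 / cmod (u + \<i>)"
      by (simp add: w_def norm_mult norm_divide u r)
    moreover have "cmod (u + \<i>) > 0" using u_i by simp
    ultimately show ?thesis by (simp add: divide_less_eq)
  qed
  have "u \<noteq> 0" using u by auto
  then have w0: "w \<noteq> 0" using u_i r by (simp add: w_def)
  define s1 where "s1 = - \<i> * Ln w"
  have exp_s1: "exp (\<i> * s1) = w" using w0 by (simp add: s1_def flip: mult.assoc)
  have s1: "s1 \<in> P"
  proof -
    have "cmod (exp (\<i> * s1)) < 1" using \<open>cmod w < 1\<close> by (simp add: exp_s1)
    then show ?thesis by (simp add: P_def)
  qed
  have "exp (\<i> * g s1) = exp (\<i> * t0)"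
  proof -
    have "\<i> * w / (r - w) = u"
    proof -
      have "r - w = r * \<i> / (u + \<i>)" using u_i by (simp add: w_def field_simps)
      moreover have "\<i> * w = u * (r * \<i> / (u + \<i>))" by (simp add: w_def)
      ultimately show ?thesis using u_i r by simp
    qed
    then show ?thesis
      unfolding exp_g[OF s1] exp_s1 by (simp add: u_def exp_add[symmetric] distrib_left[symmetric])
  qed
  then obtain n :: int where n: "\<i> * g s1 = \<i> * t0 + (of_int (2 * n) * of_real pi) * \<i>"
    unfolding exp_eq by auto
  have n': "g s1 = t0 + of_int (2 * n) * of_real pi"
  proof -
    have "\<i> * g s1 = \<i> * (t0 + of_int (2 * n) * of_real pi)" using n by (simp add: algebra_simps)
    then show ?thesis by (subst (asm) mult_cancel_left) simp
  qed
  \<comment> \<open>The coordinate \<open>s1\<close> meets \<open>t0\<close> only modulo \<open>2 \<pi>\<close>; periodicity of \<open>g\<close> corrects this.\<close>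
  have g_per: "g (s + of_int (2 * k) * of_real pi) = g s + of_int (2 * k) * of_real pi" for s k
  proof -
    have "exp (\<i> * (s + of_int (2 * k) * of_real pi)) = exp (\<i> * s)"
      unfolding exp_eq by (rule exI[of _ k]) (simp add: algebra_simps)
    then show ?thesis by (simp add: g_def)
  qed
  have "chart t0 P g (s1 + of_int (2 * (- n)) * of_real pi) (of_real (2 * pi * of_nat N)) (of_real (2 * pi * of_nat N))"
  proof unfold_locales
    show "sin t0 \<noteq> 0"
    proof
      assume "sin t0 = 0"
      then have "sin (t0 - \<epsilon>) = 0" using \<epsilon> by (simp add: sin_diff)
      then show False using pos by simp
    qed
    show "open P" unfolding P_def by (rule open_halfspace_Im_gt)
    show "convex P" unfolding P_def by (rule convex_halfspace_Im_gt)
    show "s1 + of_int (2 * (- n)) * of_real pi \<in> P" using s1 by (simp add: P_def)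
    show "g holomorphic_on P"
      unfolding holomorphic_on_open[OF \<open>open P\<close>] using g' by blast
    show "deriv g s \<noteq> 0" if "s \<in> P" for s
      unfolding DERIV_imp_deriv[OF g'[OF that]] using slit(2)[OF that] r by simp
    show "g (s1 + of_int (2 * (- n)) * of_real pi) = t0"
      unfolding g_per n' by simp
    show "g (s + of_real (2 * pi * of_nat N)) = g s + of_real (2 * pi * of_nat N)" if "s \<in> P" for s
      using g_per[of s "int N"] by (simp add: mult_ac)
    show "(s + of_real (2 * pi * of_nat N) \<in> P) = (s \<in> P)" for s by (simp add: P_def)
  qed (use sin_g exp_i_2pi_nat in auto)
  then show ?thesis unfolding P_def g_def by blast
qed

lemma translation_chart_exists:
  assumes "sin t0 \<noteq> 0"
  shows "\<exists>P g s0. chart t0 P g s0 (of_real (2 * pi * of_nat N)) (of_real (2 * pi * of_nat N))"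
proof (cases "Im t0 = 0")
  case False
  then have "Im t0 * Im t0 > 0" by (simp add: zero_less_mult_iff linorder_neq_iff disj_commute)
  then show ?thesis using half_plane_chart[of "Im t0" t0 N] by blast
next
  case True
  then have t0: "t0 = of_real (Re t0)" by (simp add: complex_eq_iff)
  have "sin (Re t0) \<noteq> 0" using assms sin_of_real[of "Re t0", where 'a = complex] t0 by auto
  then consider "sin (Re t0) > 0" | "sin (Re t0) < 0" by linarith
  then show ?thesis
  proof cases
    case 1
    have "Re (sin (t0 - 0)) > 0" using 1 sin_of_real[of "Re t0", where 'a = complex] t0 by (metis Re_complex_of_real diff_zero)
    then show ?thesis using real_axis_chart[of 0 t0 N] True by auto
  next
    case 2
    have "Re (sin (t0 - pi)) > 0"
      using 2 sin_of_real[of "Re t0", where 'a = complex] t0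
      by (metis Re_complex_of_real sin_minus_pi neg_0_less_iff_less of_real_diff sin_of_real)
    then show ?thesis using real_axis_chart[of pi t0 N] True by auto
  qed
qed

lemma sin_4Arctan:
  fixes w :: complex
  assumes "w\<^sup>2 \<noteq> -1" "w \<noteq> 0"
  shows "sin (4 * Arctan w) = 4 * w * (1 - w\<^sup>2) / (1 + w\<^sup>2)\<^sup>2"
proof -
  define A where "A = Arctan w"
  have tan: "tan A = w" using assms by (simp add: A_def)
  then have c: "cos A \<noteq> 0" using assms(2) by (auto simp: tan_def)
  have s: "sin A = w * cos A" using tan c by (simp add: tan_def field_simps)
  have nz: "1 + w\<^sup>2 \<noteq> 0" using assms(1) by (metis add.commute add_eq_0_iff)
  have "(cos A)\<^sup>2 * (1 + w\<^sup>2) = 1"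
    using sin_cos_squared_add[of A] by (simp add: s algebra_simps power_mult_distrib)
  then have c2: "(cos A)\<^sup>2 = 1 / (1 + w\<^sup>2)" using nz by (simp add: field_simps)
  have "sin (4 * A) = 2 * sin (2 * A) * cos (2 * A)" using sin_double[of "2 * A"] by simp
  also have "sin (2 * A) = 2 * w * (cos A)\<^sup>2"
    unfolding sin_double s by (simp add: power2_eq_square)
  also have "cos (2 * A) = (1 - w\<^sup>2) * (cos A)\<^sup>2"
    unfolding cos_double s by (simp add: algebra_simps power_mult_distrib)
  finally show ?thesis
    unfolding A_def[symmetric] c2 by (simp add: power2_eq_square)
qed

lemma norm_tan_less_1:
  fixes x :: complex
  assumes "\<bar>Re x\<bar> < pi / 4"
  shows "cmod (tan x) < 1"
proof -
  have "cos (2 * Re x) > 0" using assms by (intro cos_gt_zero_pi) auto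
  then have "(cmod (sin x))\<^sup>2 < (cmod (cos x))\<^sup>2"
  proof -
    have "cos (2 * Re x) = 2 * (cos (Re x))\<^sup>2 - 1" by (rule cos_double_cos)
    moreover have "(exp (Im x) - inverse (exp (Im x)))\<^sup>2 = exp (2 * Im x) + inverse (exp (2 * Im x)) - 2"
      by (simp add: power2_diff exp_double power_inverse)
    moreover have "(A + B - 2 * k) / 4 < C + Q / 4" if "k = 2 * C - 1" "Q = A + B - 2" "k > 0"
      for A B C Q k :: real
      using that by (simp add: field_simps)
    ultimately show ?thesis
      using \<open>cos (2 * Re x) > 0\<close> unfolding norm_sin_squared norm_cos_squared by blast
  qed
  then have "cmod (sin x) < cmod (cos x)" by (rule power_less_imp_less_base) simp
  then show ?thesis by (simp add: tan_def norm_divide divide_simps)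
qed

lemma norm_less_1_square:
  fixes w :: complex
  assumes "cmod w < 1"
  shows "w\<^sup>2 \<noteq> -1" "1 + w\<^sup>2 \<noteq> 0" "1 - w\<^sup>2 \<noteq> 0"
proof -
  have "cmod (w\<^sup>2) < 1" using assms by (simp add: norm_power power_less_one_iff)
  then show "w\<^sup>2 \<noteq> -1" "1 + w\<^sup>2 \<noteq> 0" "1 - w\<^sup>2 \<noteq> 0"
    by (auto simp: add_eq_0_iff)
qed

lemma Arctan_exp_deriv:
  assumes "Re s < 0"
  shows "((\<lambda>s. p + 4 * Arctan (exp s)) has_field_derivative 4 * exp s / (1 + (exp s)\<^sup>2)) (at s)"
proof -
  have n: "cmod (exp s) < 1" using assms by simp
  have "\<bar>Im (exp s)\<bar> < 1" using abs_Im_le_cmod[of "exp s"] n by linarith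
  then show ?thesis
    by (auto intro!: derivative_eq_intros has_field_derivative_Arctan simp: divide_inverse)
qed

lemma sin_Arctan_exp:
  assumes "sin p = 0" "Re s < 0"
  shows "sin (p + 4 * Arctan (exp s)) = cos p * (4 * exp s * (1 - (exp s)\<^sup>2) / (1 + (exp s)\<^sup>2)\<^sup>2)"
  using assms norm_less_1_square[of "exp s"] by (simp add: sin_add sin_4Arctan)

lemma cos_at_pole: "sin (p::complex) = 0 \<Longrightarrow> cos p \<noteq> 0"
  using sin_cos_squared_add[of p] by auto

text \<open>
  The map \<open>w \<mapsto> 4 Arctan w\<close> takes the unit disc conformally onto the strip \<open>\<bar>Re t\<bar> < \<pi>\<close>, and
  \<open>w = exp s\<close> is the universal covering of the punctured disc. With the multiple \<open>p\<close> of \<open>\<pi>\<close> that is nearest to \<open>t0\<close>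
  the strip around \<open>p\<close> contains \<open>t0\<close>, whatever its imaginary part.
\<close>

lemma pole_chart_exists:
  assumes "sin t0 \<noteq> 0"
  shows "\<exists>p s0. sin p = 0 \<and> chart t0 {s. Re s < 0} (\<lambda>s. p + 4 * Arctan (exp s)) s0 (2 * of_real pi * \<i>) 0"
proof -
  define k where "k = round (Re t0 / pi)"
  define p :: complex where "p = of_real (pi * of_int k)"
  have sin_p: "sin p = 0" unfolding p_def sin_of_real by simp
  define x where "x = (t0 - p) / 4"
  have Re_x: "\<bar>Re x\<bar> < pi / 4"
  proof -
    have "\<bar>of_int k - Re t0 / pi\<bar> \<le> 1 / 2" unfolding k_def by (rule of_int_round_abs_le)
    moreover have "Re t0 - pi * of_int k = - (pi * (of_int k - Re t0 / pi))"
      by (simp add: field_simps)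
    ultimately have "\<bar>Re t0 - pi * of_int k\<bar> \<le> pi * (1 / 2)"
      by (simp only: abs_minus_cancel abs_mult abs_of_pos[OF pi_gt_zero]) (intro mult_left_mono, auto)
    then have "\<bar>Re t0 - pi * of_int k\<bar> < pi" using pi_gt_zero by linarith
    then show ?thesis unfolding x_def p_def by simp
  qed
  define w where "w = tan x"
  have w1: "cmod w < 1" unfolding w_def by (rule norm_tan_less_1[OF Re_x])
  have Arctan_w: "Arctan w = x" unfolding w_def by (rule Arctan_tan) (use Re_x pi_gt_zero in linarith)
  have w0: "w \<noteq> 0"
  proof
    assume "w = 0"
    then have "t0 = p" using Arctan_w by (simp add: x_def)
    then show False using sin_p assms by simp
  qed
  define s0 where "s0 = Ln w"
  have exp_s0: "exp s0 = w" using w0 by (simp add: s0_def)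
  have P: "open {s. Re s < 0}" by (rule open_halfspace_Re_lt)
  have "chart t0 {s. Re s < 0} (\<lambda>s. p + 4 * Arctan (exp s)) s0 (2 * of_real pi * \<i>) 0"
  proof unfold_locales
    show "convex {s. Re s < 0}" by (rule convex_halfspace_Re_lt)
    have "cmod (exp s0) < 1" using w1 by (simp add: exp_s0)
    then show "s0 \<in> {s. Re s < 0}" by simp
    show "(\<lambda>s. p + 4 * Arctan (exp s)) holomorphic_on {s. Re s < 0}"
      unfolding holomorphic_on_open[OF P] using Arctan_exp_deriv by blast
    show "p + 4 * Arctan (exp s0) = t0" unfolding exp_s0 Arctan_w by (simp add: x_def diff_divide_distrib)
    fix s :: complex assume s: "s \<in> {s. Re s < 0}"
    then have "cmod (exp s) < 1" by simp
    note sq = norm_less_1_square[OF this]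
    show "deriv (\<lambda>s. p + 4 * Arctan (exp s)) s \<noteq> 0"
      using s sq by (simp add: DERIV_imp_deriv[OF Arctan_exp_deriv])
    show "sin (p + 4 * Arctan (exp s)) \<noteq> 0"
      using s sq by (simp add: sin_Arctan_exp[OF sin_p] cos_at_pole[OF sin_p])
    show "p + 4 * Arctan (exp (s + 2 * of_real pi * \<i>)) = p + 4 * Arctan (exp s) + 0"
      by (simp add: exp_add)
  qed (use P assms in auto)
  then show ?thesis using sin_p by blast
qed

text \<open>
  Since \<open>ds = dw / w\<close> for \<open>w = exp s\<close>, this is the residue theorem for \<open>\<Phi> w / w\<close>, whose primitive is
  \<open>\<Phi> 0 log w\<close> plus a holomorphic function of \<open>w\<close>.
\<close>

lemma primitive_of_exp_composition:
  assumes \<Phi>: "\<Phi> holomorphic_on ball 0 1"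
  obtains J where "\<And>s. Re s < 0 \<Longrightarrow> (J has_field_derivative \<Phi> (exp s)) (at s)"
    "\<And>s. J (s + 2 * of_real pi * \<i>) = J s + 2 * of_real pi * \<i> * \<Phi> 0"
proof -
  \<comment> \<open>The quotient \<open>(\<Phi> w - \<Phi> 0) / w\<close>, continued to \<open>w = 0\<close>.\<close>
  define \<phi> where "\<phi> w = (if w = 0 then deriv \<Phi> 0 else (\<Phi> w - \<Phi> 0) / (w - 0))" for w
  have "\<phi> holomorphic_on ball 0 1"
    unfolding \<phi>_def[abs_def] by (rule pole_lemma_open[OF \<Phi> open_ball])
  from holomorphic_convex_primitive'[OF convex_ball open_ball this]
  obtain Q where Q: "\<And>w. w \<in> ball 0 1 \<Longrightarrow> (Q has_field_derivative \<phi> w) (at w within ball 0 1)"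
    by blast
  let ?J = "\<lambda>s. \<Phi> 0 * s + Q (exp s)"
  show thesis
  proof (rule that[of ?J])
    fix s :: complex assume "Re s < 0"
    then have w: "exp s \<in> ball 0 1" by simp
    have "(Q has_field_derivative \<phi> (exp s)) (at (exp s))"
      using Q[OF w] at_within_open[OF w open_ball] by simp
    then have "(?J has_field_derivative \<Phi> 0 * 1 + \<phi> (exp s) * exp s) (at s)"
      by (intro DERIV_add DERIV_cmult DERIV_ident DERIV_chain2[of Q] DERIV_exp)
    moreover have "\<Phi> 0 * 1 + \<phi> (exp s) * exp s = \<Phi> (exp s)"
      by (simp add: \<phi>_def)
    ultimately show "(?J has_field_derivative \<Phi> (exp s)) (at s)" by simp
  next
    fix s :: complex
    show "?J (s + 2 * of_real pi * \<i>) = ?J s + 2 * of_real pi * \<i> * \<Phi> 0"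
      by (simp add: exp_add algebra_simps)
  qed
qed

section \<open>Necessity: two elements of the identity component that do not commute\<close>

context variational_equation
begin

text \<open>
  Near \<open>p\<close> the integrand \<open>\<theta> x\<^sup>2 B / sin\<close> has the residue \<open>\<theta> x(p)\<^sup>2 B(p) / cos p\<close>. So the monodromy of
  \<open>S\<^sub>c \<integral> \<theta> x\<^sup>2 C\<^sub>c / sin - C\<^sub>c \<integral> \<theta> x\<^sup>2 S\<^sub>c / sin\<close> is \<open>2 \<pi> \<i> \<theta> x(p)\<^sup>2 / cos p\<close> times
  \<open>S\<^sub>c(t) C\<^sub>c(p) - C\<^sub>c(t) S\<^sub>c(p) = S\<^sub>c(t - p)\<close>.
\<close>

lemma pole_monodromy:
  obtains h p \<kappa> where "h \<in> carrier G" "\<kappa> = 0 \<longleftrightarrow> th = 0"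
    "\<And>b q q'. germ t0 (osc b q q') \<in> L \<Longrightarrow> h (germ t0 (osc b q q')) = germ t0 (osc b q q')"
    "\<And>q q' z. (germ t0 (osc a q q'), z) \<in> sols \<Longrightarrow>
      h z = z + germ t0 (\<lambda>t. \<kappa> * (osc a q q' p)\<^sup>2 * osc_sin c (t - p))"
proof -
  obtain p s0 where p: "sin p = 0"
    and ch: "chart t0 {s. Re s < 0} (\<lambda>s. p + 4 * Arctan (exp s)) s0 (2 * of_real pi * \<i>) 0"
    using pole_chart_exists[OF sin_t0] by blast
  interpret chart t0 a c th "{s. Re s < 0}" "\<lambda>s. p + 4 * Arctan (exp s)" s0 "2 * of_real pi * \<i>" 0
    by (rule ch)
  let ?P = "{s. Re s < 0}" and ?g = "\<lambda>s. p + 4 * Arctan (exp s)"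
  obtain h where h: "h \<in> carrier G"
    "\<And>F. F holomorphic_on ?P \<Longrightarrow> cgerm F \<in> L \<Longrightarrow> h (cgerm F) = cgerm (shift F)"
    by (rule continuation_automorphism) blast
  define \<kappa> where "\<kappa> = 2 * of_real pi * \<i> * th / cos p"
  have cos_p: "cos p \<noteq> 0" by (rule cos_at_pole[OF p])
  show thesis
  proof (rule that[OF h(1), of \<kappa>])
    show "\<kappa> = 0 \<longleftrightarrow> th = 0" using cos_p by (simp add: \<kappa>_def)
    show "h (germ t0 (osc b q q')) = germ t0 (osc b q q')" if "germ t0 (osc b q q') \<in> L" for b q q'
      using continuation_of_osc[OF h(2), of b q q' 0] that by simp
  next
    fix q q' z assume xz: "(germ t0 (osc a q q'), z) \<in> sols"
    define \<Phi> where "\<Phi> u v w = th / cos p * (osc a q q' (p + 4 * Arctan w))\<^sup>2 *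
      osc c u v (p + 4 * Arctan w) * (1 + w\<^sup>2) / (1 - w\<^sup>2)" for u v w
    have \<Phi>_holo: "\<Phi> u v holomorphic_on ball 0 1" for u v
    proof -
      have A: "Arctan holomorphic_on ball 0 1"
      proof (rule holomorphic_on_Arctan)
        fix w :: complex assume "w \<in> ball 0 1"
        then show "\<bar>Im w\<bar> < 1" using abs_Im_le_cmod[of w] by simp
      qed
      show ?thesis
        unfolding \<Phi>_def by (intro holomorphic_intros osc_holomorphic A) (rule norm_less_1_square(3), simp)
    qed
    have integrand: "th / sin (?g s) * (osc a q q' (?g s))\<^sup>2 * osc c u v (?g s) * deriv ?g s = \<Phi> u v (exp s)"
      if s: "s \<in> ?P" for s u v
    proof -
      have w: "cmod (exp s) < 1" using s by simp
      have eq: "deriv ?g s / sin (?g s) = (1 + (exp s)\<^sup>2) / (1 - (exp s)\<^sup>2) / cos p"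
        using s norm_less_1_square[OF w] cos_p
        by (simp add: DERIV_imp_deriv[OF Arctan_exp_deriv] sin_Arctan_exp[OF p] power2_eq_square[of "1 + _"])
      have "th * (deriv ?g s / sin (?g s)) * (osc a q q' (?g s))\<^sup>2 * osc c u v (?g s) = \<Phi> u v (exp s)"
        unfolding eq \<Phi>_def by (simp add: mult_ac)
      then show ?thesis by (simp add: mult_ac)
    qed
    obtain J1 where J1: "\<And>s. Re s < 0 \<Longrightarrow> (J1 has_field_derivative \<Phi> 1 0 (exp s)) (at s)"
      "\<And>s. J1 (s + 2 * of_real pi * \<i>) = J1 s + 2 * of_real pi * \<i> * \<Phi> 1 0 0"
      by (rule primitive_of_exp_composition[OF \<Phi>_holo[of 1 0]]) blast
    obtain J2 where J2: "\<And>s. Re s < 0 \<Longrightarrow> (J2 has_field_derivative \<Phi> 0 1 (exp s)) (at s)"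
      "\<And>s. J2 (s + 2 * of_real pi * \<i>) = J2 s + 2 * of_real pi * \<i> * \<Phi> 0 1 0"
      by (rule primitive_of_exp_composition[OF \<Phi>_holo[of 0 1]]) blast
    have "h z = z + germ t0 (osc c (- (2 * of_real pi * \<i> * \<Phi> 0 1 0)) (2 * of_real pi * \<i> * \<Phi> 1 0 0))"
    proof (rule monodromy_on_solution[OF _ refl xz])
      show "h (cgerm F) = cgerm (shift F)" if "F holomorphic_on ?P" "cgerm F \<in> L" for F
        by (rule h(2)[OF that])
      show "(J1 has_field_derivative
        th / sin (?g s) * (osc a q q' (?g s))\<^sup>2 * osc_cos c (?g s) * deriv ?g s) (at s)" if "s \<in> ?P" for s
        using J1(1)[of s] that unfolding osc_1_0 integrand[OF that] by simp
      show "(J2 has_field_derivative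
        th / sin (?g s) * (osc a q q' (?g s))\<^sup>2 * osc_sin c (?g s) * deriv ?g s) (at s)" if "s \<in> ?P" for s
        using J2(1)[of s] that unfolding osc_0_1 integrand[OF that] by simp
      show "J1 (s + 2 * of_real pi * \<i>) = J1 s + 2 * of_real pi * \<i> * \<Phi> 1 0 0" for s
        by (rule J1(2))
      show "J2 (s + 2 * of_real pi * \<i>) = J2 s + 2 * of_real pi * \<i> * \<Phi> 0 1 0" for s
        by (rule J2(2))
    qed
    also have "osc c (- (2 * of_real pi * \<i> * \<Phi> 0 1 0)) (2 * of_real pi * \<i> * \<Phi> 1 0 0)
        = (\<lambda>t. \<kappa> * (osc a q q' p)\<^sup>2 * osc_sin c (t - p))"
    proof
      fix t
      have "2 * of_real pi * \<i> * \<Phi> 1 0 0 = \<kappa> * (osc a q q' p)\<^sup>2 * osc_cos c p"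
        "2 * of_real pi * \<i> * \<Phi> 0 1 0 = \<kappa> * (osc a q q' p)\<^sup>2 * osc_sin c p"
        by (simp_all add: \<Phi>_def \<kappa>_def osc_1_0 osc_0_1)
      then show "osc c (- (2 * of_real pi * \<i> * \<Phi> 0 1 0)) (2 * of_real pi * \<i> * \<Phi> 1 0 0) t
        = \<kappa> * (osc a q q' p)\<^sup>2 * osc_sin c (t - p)"
        unfolding osc_def[of c] osc_sin_diff by (simp add: algebra_simps)
    qed
    finally show "h z = z + germ t0 (\<lambda>t. \<kappa> * (osc a q q' p)\<^sup>2 * osc_sin c (t - p))" .
  qed
qed

lemma solution_over_osc: "\<exists>z. (germ t0 (osc a q q'), z) \<in> sols"
proof -
  obtain p s0 where
    ch: "chart t0 {s. Re s < 0} (\<lambda>s. p + 4 * Arctan (exp s)) s0 (2 * of_real pi * \<i>) 0"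
    using pole_chart_exists[OF sin_t0] by blast
  interpret chart t0 a c th "{s. Re s < 0}" "\<lambda>s. p + 4 * Arctan (exp s)" s0 "2 * of_real pi * \<i>" 0
    by (rule ch)
  show ?thesis by (rule solution_exists)
qed

lemma osc_in_L: "germ t0 (osc a q q') \<in> L" "germ t0 (osc c q q') \<in> L"
  using solution_over_osc[of q q'] homogeneous_solution_in_sols[of q q'] sols_sub_L by blast+

lemma translation_automorphism:
  obtains T where "T \<in> carrier G"
    "\<And>b p q u. germ t0 (\<lambda>t. osc b p q (t + u)) \<in> L \<Longrightarrow>
      T (germ t0 (\<lambda>t. osc b p q (t + u))) = germ t0 (\<lambda>t. osc b p q (t + (u + of_real (2 * pi * of_nat N))))"
proof -
  let ?l = "of_real (2 * pi * of_nat N) :: complex"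
  obtain P g s0 where ch: "chart t0 P g s0 ?l ?l"
    using translation_chart_exists[OF sin_t0, of N] by blast
  interpret chart t0 a c th P g s0 ?l ?l by (rule ch)
  obtain T where T: "T \<in> carrier G"
    "\<And>F. F holomorphic_on P \<Longrightarrow> cgerm F \<in> L \<Longrightarrow> T (cgerm F) = cgerm (shift F)"
    by (rule continuation_automorphism) blast
  show thesis
    by (rule that[OF T(1)]) (rule continuation_of_osc[OF T(2)])
qed

lemma exp_i_translation:
  assumes "k \<in> \<int>"
  shows "exp (\<i> * b * of_real (2 * pi * of_nat N)) = e2pi (of_nat N * b - k)"
proof -
  have "e2pi (of_nat N * b) = exp (\<i> * b * of_real (2 * pi * of_nat N))"
    by (simp add: e2pi_def mult_ac)
  moreover have "e2pi (of_nat N * b - k) = e2pi (of_nat N * b)"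
    unfolding e2pi_eq_iff using assms by simp
  ultimately show ?thesis by simp
qed

text \<open>
  The commutator of the translation \<open>T\<close> and the monodromy \<open>h\<close> decides both frequencies at once.
\<close>

theorem rational_if_virtually_abelian:
  assumes va: "virtually_abelian W G" and th: "th \<noteq> 0"
  shows "a \<in> \<rat> - {0} \<and> c \<in> \<rat> - {0}"
proof -
  obtain M N where M: "exponents M" and N: "N > 0"
    and ka: "\<exists>k\<in>\<int>. of_nat N * a - k \<in> M" and kc: "\<exists>k\<in>\<int>. of_nat N * c - k \<in> M"
    by (rule exponents_exist)
  define l :: complex where "l = of_real (2 * pi * of_nat N)"
  obtain T where T: "T \<in> carrier G"
    "\<And>b p q u. germ t0 (\<lambda>t. osc b p q (t + u)) \<in> L \<Longrightarrow>
      T (germ t0 (\<lambda>t. osc b p q (t + u))) = germ t0 (\<lambda>t. osc b p q (t + (u + l)))"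
    unfolding l_def by (rule translation_automorphism[of N]) blast
  obtain h p \<kappa> where h: "h \<in> carrier G" and \<kappa>: "\<kappa> = 0 \<longleftrightarrow> th = 0"
    and h_fix: "\<And>b q q'. germ t0 (osc b q q') \<in> L \<Longrightarrow> h (germ t0 (osc b q q')) = germ t0 (osc b q q')"
    and h_sol: "\<And>q q' z. (germ t0 (osc a q q'), z) \<in> sols \<Longrightarrow>
      h z = z + germ t0 (\<lambda>t. \<kappa> * (osc a q q' p)\<^sup>2 * osc_sin c (t - p))"
    by (rule pole_monodromy) blast
  have \<kappa>0: "\<kappa> \<noteq> 0" using \<kappa> th by simp
  obtain na where na: "na \<in> \<int>" "of_nat N * a - na \<in> M" using ka by blast
  obtain nc where nc: "nc \<in> \<int>" "of_nat N * c - nc \<in> M" using kc by blast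
  \<comment> \<open>The numbers \<open>N a\<close> and \<open>N c\<close> may be changed by integers to bring the exponents into \<open>M\<close>.\<close>
  have T0: "T \<in> G0"
    by (rule translation_in_G0[OF M T na(2) exp_i_translation[OF na(1), where b = a and N = N, folded l_def, symmetric]
          nc(2) exp_i_translation[OF nc(1), where b = c and N = N, folded l_def, symmetric]])
  have kick: "(\<lambda>t. k * osc_sin c (t - p)) = osc c (- k * osc_sin c p) (k * osc_cos c p)" for k
  proof
    fix t
    show "k * osc_sin c (t - p) = osc c (- k * osc_sin c p) (k * osc_cos c p) t"
      unfolding osc_def osc_sin_diff by (simp add: algebra_simps)
  qed
  have h0: "h \<in> G0"
  proof (rule unipotent_in_G0[OF h])
    fix x z assume xz: "(x, z) \<in> sols"
    obtain q q' where x: "x = germ t0 (osc a q q')"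
      using osc_solutions[OF VE2_D(1)[OF xz]] by blast
    show "h x = x" unfolding x by (rule h_fix) (rule osc_in_L)
    show "h (h z - z) = h z - z"
      unfolding h_sol[OF xz[unfolded x]] kick using h_fix[OF osc_in_L(2)] by simp
  qed
  have key: "(osc a q q' p)\<^sup>2 * osc_sin c (t + l - p) = (osc a q q' (p + l))\<^sup>2 * osc_sin c (t - p)" for q q' t
  proof -
    obtain z where xz: "(germ t0 (osc a q q'), z) \<in> sols" using solution_over_osc by blast
    define k k' where "k = \<kappa> * (osc a q q' p)\<^sup>2" and "k' = \<kappa> * (osc a q q' (p + l))\<^sup>2"
    have Tx: "T (germ t0 (osc a q q')) = germ t0 (osc a (osc a q q' l) (osc a q' (- (a\<^sup>2) * q) l))"
    proof -
      have "T (germ t0 (osc a q q')) = germ t0 (\<lambda>t. osc a q q' (t + l))"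
        using T(2)[of a q q' 0] osc_in_L(1) by simp
      also have "(\<lambda>t. osc a q q' (t + l)) = osc a (osc a q q' l) (osc a q' (- (a\<^sup>2) * q) l)"
        by (rule ext) (rule osc_shift)
      finally show ?thesis .
    qed
    have "h z = z + germ t0 (\<lambda>t. k * osc_sin c (t - p))"
      unfolding k_def by (rule h_sol[OF xz])
    moreover have "T (germ t0 (\<lambda>t. k * osc_sin c (t - p))) = germ t0 (\<lambda>t. k * osc_sin c (t + l - p))"
    proof -
      have "T (germ t0 (osc c (- k * osc_sin c p) (k * osc_cos c p)))
          = germ t0 (\<lambda>t. osc c (- k * osc_sin c p) (k * osc_cos c p) (t + l))"
        using T(2)[of c "- k * osc_sin c p" "k * osc_cos c p" 0] osc_in_L(2) by simp
      then show ?thesis unfolding kick[symmetric] .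
    qed
    ultimately have Th: "T (h z) = T z + germ t0 (\<lambda>t. k * osc_sin c (t + l - p))"
      using sols_sub_L(2)[OF xz] osc_in_L(2) by (simp add: G_add[OF T(1)] kick)
    have hT: "h (T z) = T z + germ t0 (\<lambda>t. k' * osc_sin c (t - p))"
      unfolding k'_def osc_shift by (rule h_sol) (use G_sols[OF T(1) xz] Tx in simp)
    have "T (h z) = h (T z)"
    proof -
      have "T \<otimes>\<^bsub>G\<^esub> h = h \<otimes>\<^bsub>G\<^esub> T"
        using va T0 h0 unfolding virtually_abelian_iff by blast
      then show ?thesis
        using G_mult_apply[OF T(1) h sols_sub_L(2)[OF xz]] G_mult_apply[OF h T(1) sols_sub_L(2)[OF xz]] by simp
    qed
    then have eq: "germ t0 (\<lambda>t. k * osc_sin c (t + l - p)) = germ t0 (\<lambda>t. k' * osc_sin c (t - p))"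
      unfolding Th hT by simp
    have "k * osc_sin c (t + l - p) = k' * osc_sin c (t - p)"
      by (rule entire_eq_if_germ_eq[OF _ _ eq])
        (auto intro!: holomorphic_intros osc_holomorphic simp: osc_0_1)
    then show ?thesis using \<kappa>0 by (simp add: k_def k'_def)
  qed
  \<comment> \<open>The solution \<open>osc_sin a (t - p)\<close> vanishes at \<open>p\<close>, which removes the left side of \<open>key\<close>.\<close>
  have "osc_sin a l = 0"
  proof -
    have x: "osc a (- osc_sin a p) (osc_cos a p) t = osc_sin a (t - p)" for t
      unfolding osc_def osc_sin_diff by (simp add: algebra_simps)
    obtain t where t: "osc_sin c (t - p) \<noteq> 0"
    proof (cases "c = 0")
      case True
      show thesis by (rule that[of "p + 1"]) (simp add: True osc_sin_def)
    next
      case False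
      have "sin (of_real (pi / 2) :: complex) = 1"
        unfolding sin_of_real by simp
      then show thesis
        by (intro that[of "p + of_real (pi / 2) / c"]) (simp add: False osc_sin_def del: of_real_divide)
    qed
    show ?thesis using key[of "- osc_sin a p" "osc_cos a p" t] t unfolding x by simp
  qed
  \<comment> \<open>The solution \<open>osc_cos a (t - p)\<close> is 1 at \<open>p\<close>, and at \<open>t = p\<close> the right side of \<open>key\<close> vanishes.\<close>
  moreover have "osc_sin c l = 0"
  proof -
    have x: "osc a (osc_cos a p) (a\<^sup>2 * osc_sin a p) t = osc_cos a (t - p)" for t
      unfolding osc_def osc_cos_diff by (simp add: algebra_simps)
    show ?thesis using key[of "osc_cos a p" "a\<^sup>2 * osc_sin a p" p] unfolding x by simp
  qed
  ultimately show ?thesis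
    unfolding l_def using osc_sin_translation_zero N by blast
qed

section \<open>Sufficiency\<close>

text \<open>
  The quotient of two solutions of a first order linear equation is a constant.
\<close>

lemma eigenvector_scaled:
  assumes s: "\<sigma> \<in> carrier G" and p: "p \<in> L" "fls_deriv p = fls_const u * p"
  shows "\<exists>k. \<sigma> p = fls_const k * p"
proof (cases "p = 0")
  case True
  then show ?thesis using G_fixes_const[OF s, of 0] by simp
next
  case False
  have "fls_deriv (\<sigma> p) = fls_const u * \<sigma> p"
    using G_deriv[OF s p(1)] p by (simp add: G_scale[OF s])
  moreover have "fls_deriv (\<sigma> p) = \<sigma> p / p * fls_deriv p + fls_deriv (\<sigma> p / p) * p"
    using fls_deriv_mult[of "\<sigma> p / p" p] False by simp
  ultimately have "fls_deriv (\<sigma> p / p) = 0"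
    using p(2) False by (simp add: field_simps)
  then obtain k where "\<sigma> p / p = fls_const k" unfolding fls_deriv_eq_0_iff_const by blast
  then show ?thesis using False by (metis nonzero_divide_eq_eq)
qed

text \<open>
  The factorisation \<open>y'' + b\<^sup>2 y = (d/dt - \<i> b) (d/dt + \<i> b) y\<close> splits a solution into two exponential
  solutions that again belong to every differential field containing \<open>y\<close> and the constants.
\<close>

lemma factors_of_osc:
  assumes "fls_deriv (fls_deriv y) = - fls_const (b\<^sup>2) * y"
  defines "p \<equiv> fls_deriv y + fls_const (\<i> * b) * y" and "q \<equiv> fls_deriv y - fls_const (\<i> * b) * y"
  shows "fls_deriv p = fls_const (\<i> * b) * p" "fls_deriv q = fls_const (- (\<i> * b)) * q"
    "p - q = fls_const (2 * \<i> * b) * y"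
proof -
  have sq: "fls_const (\<i> * b) * fls_const (\<i> * b) = - fls_const (b\<^sup>2)"
  proof -
    have "\<i> * b * (\<i> * b) = - (b\<^sup>2)" by (simp add: power2_eq_square algebra_simps)
    then show ?thesis by (simp only: fls_const_mult_const fls_const_uminus)
  qed
  have sq': "fls_const (\<i> * b) * (fls_const (\<i> * b) * y) = - fls_const (b\<^sup>2) * y"
    by (simp only: mult.assoc[symmetric] sq)
  show "fls_deriv p = fls_const (\<i> * b) * p"
    unfolding p_def distrib_left sq' by (simp add: assms(1))
  have "fls_const (- (\<i> * b)) * q = - (fls_const (\<i> * b) * fls_deriv y) + fls_const (\<i> * b) * (fls_const (\<i> * b) * y)"
    unfolding q_def fls_const_uminus by (simp only: right_diff_distrib mult_minus_left) simp
  then show "fls_deriv q = fls_const (- (\<i> * b)) * q"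
    unfolding sq' by (simp add: q_def assms(1))
  have "fls_const (2 * \<i> * b) = fls_const (\<i> * b) + fls_const (\<i> * b)"
    by (simp add: fls_plus_const mult.assoc)
  then show "p - q = fls_const (2 * \<i> * b) * y"
    by (simp add: p_def q_def algebra_simps)
qed

lemma osc_commute:
  assumes s: "\<sigma> \<in> carrier G" and t: "\<tau> \<in> carrier G" and y: "y \<in> L"
    and ode: "fls_deriv (fls_deriv y) = - fls_const (b\<^sup>2) * y"
  shows "\<sigma> (\<tau> y) = \<tau> (\<sigma> y)"
proof (cases "b = 0")
  case True
  then have "fls_deriv (fls_deriv y) = 0" using ode by simp
  then obtain k where k: "fls_deriv y = fls_const k" unfolding fls_deriv_eq_0_iff_const by blast
  have "\<exists>u. \<rho> y = y + fls_const u" if r: "\<rho> \<in> carrier G" for \<rho>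
  proof -
    have "fls_deriv (\<rho> y - y) = 0"
      using G_deriv[OF r y] by (simp add: k G_fixes_const[OF r])
    then obtain u where "\<rho> y - y = fls_const u" unfolding fls_deriv_eq_0_iff_const by blast
    then have "\<rho> y = y + fls_const u" by (simp add: algebra_simps)
    then show ?thesis by blast
  qed
  then obtain u v where uv: "\<sigma> y = y + fls_const u" "\<tau> y = y + fls_const v" using s t by blast
  show ?thesis
    unfolding uv by (simp add: G_add[OF s y fls_const_in_L] G_add[OF t y fls_const_in_L]
        G_fixes_const[OF s] G_fixes_const[OF t] uv)
next
  case False
  define p q where "p = fls_deriv y + fls_const (\<i> * b) * y" and "q = fls_deriv y - fls_const (\<i> * b) * y"
  note pq = factors_of_osc[OF ode, folded p_def q_def]
  have L: "p \<in> L" "q \<in> L"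
    unfolding p_def q_def
    by (intro subfield_add subfield_diff subfield_mult L_subfield L_deriv y fls_const_in_L)+
  have comm: "\<sigma> (\<tau> w) = \<tau> (\<sigma> w)" if w: "w \<in> L" "fls_deriv w = fls_const u * w" for w u
  proof -
    obtain k where k: "\<sigma> w = fls_const k * w" using eigenvector_scaled[OF s w] by blast
    obtain k' where k': "\<tau> w = fls_const k' * w" using eigenvector_scaled[OF t w] by blast
    show ?thesis unfolding k k' by (simp only: G_scale[OF s w(1)] G_scale[OF t w(1)] k k' mult.left_commute)
  qed
  have y_eq: "y = fls_const (1 / (2 * \<i> * b)) * (p - q)"
    unfolding pq(3) using False by (simp add: mult.assoc[symmetric])
  have "\<sigma> (\<tau> (p - q)) = \<tau> (\<sigma> (p - q))"
    using comm[OF L(1) pq(1)] comm[OF L(2) pq(2)] L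
    by (simp add: G_diff[OF s] G_diff[OF t] G_closed[OF s] G_closed[OF t])
  then show ?thesis
    using subfield_diff[OF L_subfield L] unfolding y_eq
    by (simp add: G_scale[OF s] G_scale[OF t] G_closed[OF s] G_closed[OF t])
qed

lemma virtually_abelian_if_th_0:
  assumes "th = 0"
  shows "virtually_abelian W G"
  unfolding virtually_abelian_iff
proof (intro ballI G_commute_if_commute_on_solutions)
  fix \<sigma> \<tau> assume "\<sigma> \<in> G0" "\<tau> \<in> G0"
  then show st: "\<sigma> \<in> carrier G" "\<tau> \<in> carrier G" using G0_sub_G by auto
  fix x z assume xz: "(x, z) \<in> sols"
  show "\<sigma> (\<tau> x) = \<tau> (\<sigma> x) \<and> \<sigma> (\<tau> z) = \<tau> (\<sigma> z)"
    using osc_commute[OF st sols_sub_L(1)[OF xz] VE2_D(1)[OF xz]]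
      osc_commute[OF st sols_sub_L(2)[OF xz], of c] VE2_D(2)[OF xz] assms by simp
qed

text \<open>
  A matrix coefficient with finitely many values is locally constant: the set where it takes a
  given value is closed, and it is also open, being the set where the product of the differences to the
  other values does not vanish.
\<close>

lemma G0_fixes_finite_orbit:
  assumes s: "\<sigma> \<in> G0" and \<phi>: "linear_functional_on W \<phi>" and w: "w \<in> W"
    and fin: "finite ((\<lambda>\<tau>. \<phi> (\<tau> w)) ` carrier G)"
  shows "\<phi> (\<sigma> w) = \<phi> w"
proof -
  interpret group G by (rule G_group)
  let ?E = "(\<lambda>\<tau>. \<phi> (\<tau> w)) ` carrier G"
  have coeff: "(\<lambda>\<tau>. \<phi> (\<tau> w) + - k) \<in> polynomial_functions W" for k
    by (intro polynomial_functions.add polynomial_functions.matrix_coeff polynomial_functions.const w \<phi>)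
  have open_ne: "openin Zar {\<tau> \<in> carrier G. \<phi> (\<tau> w) \<noteq> k}" for k
    using openin_nonvanishing[OF coeff[of k]] by simp
  have "openin Zar {\<tau> \<in> carrier G. \<phi> (\<tau> w) = \<phi> w}"
  proof -
    have prod: "(\<lambda>\<tau>. \<Prod>k\<in>A. \<phi> (\<tau> w) + - k) \<in> polynomial_functions W" if "finite A" for A
      using that
    proof (induction A rule: finite_induct)
      case (insert k A)
      then show ?case using polynomial_functions.mult[OF coeff[of k] insert.IH] by simp
    qed (simp add: polynomial_functions.const)
    have "{\<tau> \<in> carrier G. \<phi> (\<tau> w) = \<phi> w} = {\<tau> \<in> carrier G. (\<Prod>k\<in>?E - {\<phi> w}. \<phi> (\<tau> w) + - k) \<noteq> 0}"
      using fin by (auto simp: prod_zero_iff)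
    then show ?thesis
      using openin_nonvanishing[OF prod[of "?E - {\<phi> w}"]] fin by simp
  qed
  moreover note open_ne[of "\<phi> w"] connectedin_G0
  moreover have "G0 \<subseteq> {\<tau> \<in> carrier G. \<phi> (\<tau> w) = \<phi> w} \<union> {\<tau> \<in> carrier G. \<phi> (\<tau> w) \<noteq> \<phi> w}"
    using G0_sub_G by blast
  moreover have "\<one>\<^bsub>G\<^esub> \<in> {\<tau> \<in> carrier G. \<phi> (\<tau> w) = \<phi> w} \<inter> G0"
    using one_in_G0 w by (simp add: G_one_apply W_sub_L)
  ultimately have "{\<tau> \<in> carrier G. \<phi> (\<tau> w) \<noteq> \<phi> w} \<inter> G0 = {}"
    unfolding connectedin by blast
  then show ?thesis using s G0_sub_G by blast
qed

text \<open>
  If \<open>b\<close> has the denominator \<open>N\<close>, the \<open>N\<close>-th power of \<open>exp (\<i> b t)\<close> lies in \<open>K\<close>, so Galois elements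
  multiply \<open>exp (\<i> b t)\<close> by \<open>N\<close>-th roots of unity. The value at \<open>t0\<close>, which is the coefficient of index 0, serves
  as the functional that tells the multiples apart.
\<close>

lemma G0_fixes_rational_exponential:
  assumes b: "b \<in> \<rat>" and W: "germ t0 (\<lambda>t. exp (\<i> * b * t)) \<in> W" and s: "\<sigma> \<in> G0"
  shows "\<sigma> (germ t0 (\<lambda>t. exp (\<i> * b * t))) = germ t0 (\<lambda>t. exp (\<i> * b * t))"
proof -
  let ?e = "\<lambda>b. germ t0 (\<lambda>t. exp (\<i> * b * t))"
  have an: "(\<lambda>t. exp (u * t)) analytic_on {t0}" for u by (intro analytic_intros)
  have e_add: "?e (u + v) = ?e u * ?e v" for u v
    using germ_mult[OF an[of "\<i> * u"] an[of "\<i> * v"]] by (simp add: algebra_simps exp_add)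
  have e_0: "?e 0 = 1" using germ_const[of t0 1] by simp
  have e_nat: "?e (of_nat n * u) = ?e u ^ n" for n u
    by (induction n) (simp_all add: e_0 e_add distrib_right)
  have e_K: "?e (of_int n) \<in> K" for n :: int
  proof -
    have pos: "?e (of_nat n) \<in> K" for n
    proof (induction n)
      case (Suc n)
      have "?e (of_nat (Suc n)) = ?e 1 * ?e (of_nat n)" using e_add[of 1 "of_nat n"] by simp
      then show ?case
        using Suc germ_exp_in_K_exp[of t0] by (simp add: subfield_mult[OF K_exp_is_subfield])
    qed (simp add: e_0 subfield_1[OF K_exp_is_subfield])
    show ?thesis
    proof (cases "n \<ge> 0")
      case True
      then show ?thesis using pos[of "nat n"] by simp
    next
      case False
      have "?e (of_int n) * ?e (of_nat (nat (- n))) = 1"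
        using e_add[of "of_int n" "of_nat (nat (- n))"] False by (simp add: e_0)
      then have "?e (of_int n) = inverse (?e (of_nat (nat (- n))))"
        by (metis inverse_unique mult.commute)
      then show ?thesis using pos by (simp add: subfield_inverse[OF K_exp_is_subfield])
    qed
  qed
  obtain m n :: int where mn: "n > 0" "b = of_int m / of_int n"
    using b by (auto elim: Rats_cases')
  define N where "N = nat n"
  have N: "N > 0" "?e b ^ N \<in> K"
  proof -
    show "N > 0" using mn by (simp add: N_def)
    have "of_nat N * b = of_int m" using mn by (simp add: N_def)
    then show "?e b ^ N \<in> K" using e_nat[of N b] e_K[of m] by simp
  qed
  have nz: "?e b \<noteq> 0" using e_add[of b "- b"] e_0 by auto
  have de: "fls_deriv (?e b) = fls_const (\<i> * b) * ?e b"
  proof -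
    have "deriv (\<lambda>t. exp (\<i> * b * t)) = (\<lambda>t. \<i> * b * exp (\<i> * b * t))"
      by (rule ext, rule DERIV_imp_deriv) (auto intro!: derivative_eq_intros)
    then show ?thesis
      using germ_deriv[OF an[of "\<i> * b"]] germ_cmult[OF an[of "\<i> * b"], of "\<i> * b"] by simp
  qed
  have root: "\<exists>k. k ^ N = 1 \<and> \<tau> (?e b) = fls_const k * ?e b" if t: "\<tau> \<in> carrier G" for \<tau>
  proof -
    obtain k where k: "\<tau> (?e b) = fls_const k * ?e b"
      using eigenvector_scaled[OF t W_sub_L[OF W] de] by blast
    have "?e b ^ N = (fls_const k * ?e b) ^ N"
      using G_fixes_K[OF t N(2)] G_power[OF t W_sub_L[OF W], of N] k by simp
    then have "fls_const (k ^ N) = 1"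
      using nz by (simp add: power_mult_distrib fls_const_power)
    then show ?thesis using k by auto
  qed
  let ?\<phi> = "\<lambda>f :: complex fls. fls_nth f 0"
  have \<phi>: "linear_functional_on W ?\<phi>" by (simp add: linear_functional_on_def)
  have \<phi>_e: "?\<phi> (?e b) \<noteq> 0"
    by (simp add: germ_def fps_expansion_def)
  have "(\<lambda>\<tau>. ?\<phi> (\<tau> (?e b))) ` carrier G \<subseteq> (\<lambda>k. k * ?\<phi> (?e b)) ` {k. k ^ N = 1}"
    using root by force
  moreover have "finite {k :: complex. k ^ N = 1}"
    using N(1) by (intro finite_roots_unity) simp
  ultimately have "finite ((\<lambda>\<tau>. ?\<phi> (\<tau> (?e b))) ` carrier G)"
    by (meson finite_imageI finite_subset)
  then have "?\<phi> (\<sigma> (?e b)) = ?\<phi> (?e b)"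
    by (rule G0_fixes_finite_orbit[OF s \<phi> W])
  moreover obtain k where "\<sigma> (?e b) = fls_const k * ?e b" using root s G0_sub_G by blast
  ultimately show ?thesis using \<phi>_e by simp
qed

lemma G0_fixes_rational_osc:
  assumes b: "b \<in> \<rat> - {0}" and W: "\<And>q q'. germ t0 (osc b q q') \<in> W" and s: "\<sigma> \<in> G0"
  shows "\<sigma> (germ t0 (osc b q q')) = germ t0 (osc b q q')"
proof -
  have sG: "\<sigma> \<in> carrier G" using s G0_sub_G by blast
  have b0: "b \<noteq> 0" using b by simp
  let ?e = "\<lambda>b. germ t0 (\<lambda>t. exp (\<i> * b * t))"
  have e: "?e b = germ t0 (osc b 1 (\<i> * b))" "?e (- b) = germ t0 (osc b 1 (- (\<i> * b)))"
  proof -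
    show "?e b = germ t0 (osc b 1 (\<i> * b))" using osc_exp[OF b0] by (simp add: fun_eq_iff[symmetric])
    have "exp (\<i> * (- b) * t) = osc b 1 (- (\<i> * b)) t" for t
      using osc_exp[of "- b" t] b0 by (simp add: osc_def osc_cos_def osc_sin_def)
    then show "?e (- b) = germ t0 (osc b 1 (- (\<i> * b)))" by (simp add: fun_eq_iff[symmetric])
  qed
  have fix_e: "\<sigma> (?e b) = ?e b" "\<sigma> (?e (- b)) = ?e (- b)"
    using b W e by (intro G0_fixes_rational_exponential[OF _ _ s]; simp)+
  define u v where "u = (q - \<i> * q' / b) / 2" and "v = (q + \<i> * q' / b) / 2"
  have eq: "germ t0 (osc b q q') = fls_const u * ?e b + fls_const v * ?e (- b)"
  proof -
    have "osc b q q' t = u * osc b 1 (\<i> * b) t + v * osc b 1 (- (\<i> * b)) t" for t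
      unfolding osc_linear using b0 by (simp add: u_def v_def field_simps)
    then have "germ t0 (osc b q q') = germ t0 (\<lambda>t. u * osc b 1 (\<i> * b) t + v * osc b 1 (- (\<i> * b)) t)"
      by presburger
    also have "\<dots> = fls_const u * ?e b + fls_const v * ?e (- b)"
      unfolding e by (simp add: germ_add germ_cmult osc_analytic analytic_intros)
    finally show ?thesis .
  qed
  have "?e b \<in> L" "?e (- b) \<in> L" unfolding e by (intro W_sub_L W)+
  then show ?thesis
    by (simp only: eq G_add[OF sG] G_scale[OF sG] fix_e subfield_mult[OF L_subfield] fls_const_in_L)
qed

text \<open>
  An element of \<open>G0\<close> fixes all oscillator solutions and so translates \<open>z\<close> by one of them; translations commute.
\<close>

lemma virtually_abelian_if_rational:
  assumes a: "a \<in> \<rat> - {0}" and c: "c \<in> \<rat> - {0}"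
  shows "virtually_abelian W G"
  unfolding virtually_abelian_iff
proof (intro ballI G_commute_if_commute_on_solutions)
  fix \<sigma> \<tau> assume st0: "\<sigma> \<in> G0" "\<tau> \<in> G0"
  then show st: "\<sigma> \<in> carrier G" "\<tau> \<in> carrier G" using G0_sub_G by auto
  have osc_W: "germ t0 (osc a q q') \<in> W" "germ t0 (osc c q q') \<in> W" for q q'
    using solution_over_osc[of q q'] homogeneous_solution_in_sols[of q q'] sols_sub_W by blast+
  fix x z assume xz: "(x, z) \<in> sols"
  obtain q q' where x: "x = germ t0 (osc a q q')"
    using osc_solutions[OF VE2_D(1)[OF xz]] by blast
  have fix_x: "\<rho> x = x" if "\<rho> \<in> G0" for \<rho>
    unfolding x by (rule G0_fixes_rational_osc[OF a osc_W(1) that])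
  have fix_hom: "\<rho> (germ t0 (osc c u v)) = germ t0 (osc c u v)" if "\<rho> \<in> G0" for \<rho> u v
    by (rule G0_fixes_rational_osc[OF c osc_W(2) that])
  have move: "\<exists>u v. \<rho> z = z + germ t0 (osc c u v)" if r: "\<rho> \<in> G0" for \<rho>
  proof -
    have "(x, \<rho> z) \<in> sols" using G_sols[of \<rho>, OF _ xz] r G0_sub_G fix_x[OF r] by auto
    then show ?thesis using sols_diff_homogeneous[OF xz] by blast
  qed
  obtain u v where s: "\<sigma> z = z + germ t0 (osc c u v)" using move st0 by blast
  obtain u' v' where t: "\<tau> z = z + germ t0 (osc c u' v')" using move st0 by blast
  have "\<sigma> (\<tau> z) = \<tau> (\<sigma> z)"
    unfolding s t using sols_sub_L(2)[OF xz] osc_in_L(2)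
    by (simp add: G_add[OF st(1)] G_add[OF st(2)] fix_hom st0 s t)
  then show "\<sigma> (\<tau> x) = \<tau> (\<sigma> x) \<and> \<sigma> (\<tau> z) = \<tau> (\<sigma> z)"
    by (simp add: fix_x st0)
qed

theorem virtually_abelian_criterion:
  "virtually_abelian W G \<longleftrightarrow> th = 0 \<or> a \<in> \<rat> - {0} \<and> c \<in> \<rat> - {0}"
  using rational_if_virtually_abelian virtually_abelian_if_th_0 virtually_abelian_if_rational by blast

end

theorem lemma4p2:
  fixes V :: "complex^'n \<Rightarrow> complex" and U :: "(complex^'n) set" and d :: "complex^'n"
    and \<omega> :: "'n \<Rightarrow> complex" and \<alpha> \<gamma> :: 'n and t0 :: complex
  assumes "d \<in> U"
    and "holomorphic_potential_on V U"
    and "homogeneous_potential_on 2 V U"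
    and "d \<noteq> 0"
    and "grad V d = d"
    and "hessian V d = (\<chi> i j. if i = j then (\<omega> i)\<^sup>2 else 0)"
    and "sin t0 \<noteq> 0"
  shows "virtually_abelian
           (solution_span t0 (\<omega> \<alpha>) (\<omega> \<gamma>) (theta V d \<gamma> \<alpha> \<alpha>))
           (Gal_VE2 t0 (\<omega> \<alpha>) (\<omega> \<gamma>) (theta V d \<gamma> \<alpha> \<alpha>))
         \<longleftrightarrow>
           theta V d \<gamma> \<alpha> \<alpha> = 0 \<or>
           (theta V d \<gamma> \<alpha> \<alpha> \<noteq> 0 \<and> \<omega> \<alpha> \<in> \<rat> - {0} \<and> \<omega> \<gamma> \<in> \<rat> - {0})"
proof -
  interpret variational_equation t0 "\<omega> \<alpha>" "\<omega> \<gamma>" "theta V d \<gamma> \<alpha> \<alpha>"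
    by unfold_locales (rule assms(7))
  show ?thesis using virtually_abelian_criterion by blast
qed

end
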